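(* Let $X, X_1, X_2, \ldots$ be i.i.d. mean zero random elements of $L^2 = L^2(\mathcal{T})$, where $X$ is regularly varying with index $\alpha \in (2,4)$. Let $C=E[X\otimes X]$ have eigenvalues $\lambda_1\ge\lambda_2\ge\cdots$ and orthonormal eigenfunctions $v_1,v_2,\ldots$, let $\xi_j=\langle X,v_j\rangle$, and suppose that $Q_{nm}>0$ for all $n,m\ge1$, where $$Q_{nm} = \lim_{u\to\infty} \frac{P\left( \left\{\sum_{j=n}^\infty \xi_j^2\right\}^{1/2} \left\{\sum_{j=m}^\infty \xi_j^2\right\}^{1/2} > u\right)}{P\left(\sum_{j=1}^\infty \xi_j^2 > u\right)}.$$ Let $\hat\lambda_j,\hat v_j$ be the eigenvalues (in decreasing order) and orthonormal eigenfunctions of $\widehat C=N^{-1}\sum_{n=1}^N X_n\otimes X_n$. Then for each $\gamma\in(0,\alpha/2)$ there is a slowly varying function $L_\gamma$ such that $$\limsup_{N\to\infty}N^{\gamma(1-2/\alpha)}L_\gamma(N)\,E\|\widehat C-C\|_{\mathcal{S}}^\gamma<\infty$$ and, for $j\ge1$, $$\limsup_{N\to\infty}N^{\gamma(1-2/\alpha)}L_\gamma(N)\,E|\hat\lambda_j-\lambda_j|^\gamma<\infty.$$ If, in addition, $\lambda_1>\lambda_2>\cdots>\lambda_p>\lambda_{p+1}$, then for $1\le j\le p$, $$\limsup_{N\to\infty}N^{\gamma(1-2/\alpha)}L_\gamma(N)\,E\|\hat v_j-v_j\|^\gamma<\infty.$$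
   Context: $L^2(\mathcal{T})$ is the separable Hilbert space of square integrable real functions on a compact subset $\mathcal{T}$ of a Euclidean space. $\mathcal{S}$ is the Hilbert space of Hilbert–Schmidt operators on $L^2$, with Hilbert–Schmidt norm $\|\cdot\|_{\mathcal{S}}$. For $y,z\in L^2$, $(y\otimes z)(x)=\langle y,x\rangle z$. Regular variation: a random element $X$ of a separable Banach space is regularly varying with index $\alpha>0$ if $P(\|X\|>u)=u^{-\alpha}L(u)$ for some slowly varying $L$ and, for a probability measure $\Gamma_X$ on the unit sphere, $P(X/\|X\|\in\cdot\mid\|X\|>u)\to\Gamma_X(\cdot)$ weakly as $u\to\infty$. A measurable, eventually positive function $L$ on $(0,\infty)$ is slowly varying if $L(\lambda u)/L(u)\to1$ as $u\to\infty$ for all $\lambda>0$. The convention is that the sign of $\hat v_j$ is chosen so that $\operatorname{sign}\langle\hat v_j,v_j\rangle=1$. *)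

theory Defs
  imports "HOL-Probability.Probability"
begin

section \<open>Preliminaries on normed spaces\<close>

lemma subspace_closure:
  fixes S :: "'a::real_normed_vector set"
  assumes "subspace S"
  shows "subspace (closure S)"
proof (rule subspaceI)
  show "0 \<in> closure S"
    using subspace_0[OF assms] closure_subset by blast
next
  fix x y assume "x \<in> closure S" "y \<in> closure S"
  then obtain a b where "\<forall>n. a n \<in> S" "a \<longlonglongrightarrow> x" "\<forall>n. b n \<in> S" "b \<longlonglongrightarrow> y"
    unfolding closure_sequential by metis
  then show "x + y \<in> closure S"
    unfolding closure_sequential
    by (intro exI[of _ "\<lambda>n. a n + b n"]) (auto intro: tendsto_add subspace_add assms)
next
  fix c x assume "x \<in> closure S"
  then obtain a where "\<forall>n. a n \<in> S" "a \<longlonglongrightarrow> x"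
    unfolding closure_sequential by metis
  then show "c *\<^sub>R x \<in> closure S"
    unfolding closure_sequential
    by (intro exI[of _ "\<lambda>n. c *\<^sub>R a n"]) (auto intro: tendsto_scaleR subspace_scale assms)
qed

lemma second_countable_of_total:
  fixes S :: "'a::real_normed_vector set"
  assumes S: "countable S" and tot: "closure (span S) = UNIV"
  shows "\<exists>B::'a set set. countable B \<and> open = generate_topology B"
proof -
  define D where "D = (\<lambda>l. sum_list (map (\<lambda>(q, s). q *\<^sub>R s) l)) ` lists (\<rat> \<times> S)"
  have cD: "countable D"
    unfolding D_def by (intro countable_image countable_lists countable_SIGMA countable_rat S)
  have D0: "0 \<in> D"
    unfolding D_def by (rule image_eqI[of _ _ "[]"]) auto
  have Dadd: "q *\<^sub>R s + d \<in> D" if "q \<in> \<rat>" "s \<in> S" "d \<in> D" for q s d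
  proof -
    obtain l where "l \<in> lists (\<rat> \<times> S)" "d = sum_list (map (\<lambda>(q, s). q *\<^sub>R s) l)"
      using \<open>d \<in> D\<close> unfolding D_def by auto
    then show ?thesis
      unfolding D_def using that by (intro image_eqI[of _ _ "(q, s) # l"]) auto
  qed
  have "x \<in> closure D" if "x \<in> span S" for x
    using that
  proof (induction rule: span_induct_alt)
    case base
    then show ?case using D0 closure_subset by blast
  next
    case (step c x y)
    show ?case
      unfolding closure_approachable
    proof safe
      fix e :: real assume e: "e > 0"
      obtain d where d: "d \<in> D" "dist d y < e / 2"
        using step e unfolding closure_approachable by (meson half_gt_zero)
      define \<delta> where "\<delta> = e / 2 / (norm x + 1)"
      have \<delta>: "\<delta> > 0" using e by (simp add: \<delta>_def add_nonneg_pos)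
      then obtain q where q: "q \<in> \<rat>" "c < q" "q < c + \<delta>"
        using Rats_dense_in_real[of c "c + \<delta>"] by auto
      have "dist (q *\<^sub>R x + d) (c *\<^sub>R x + y) \<le> norm ((q - c) *\<^sub>R x) + dist d y"
        unfolding dist_norm by (rule order_trans[OF _ norm_triangle_ineq]) (simp add: algebra_simps)
      also have "norm ((q - c) *\<^sub>R x) \<le> \<delta> * (norm x + 1)"
        using q by (auto intro!: mult_mono)
      also have "\<delta> * (norm x + 1) = e / 2"
        unfolding \<delta>_def using add_nonneg_pos[OF norm_ge_zero[of x] zero_less_one]
        by (intro nonzero_eq_divide_eq[THEN iffD1]) auto
      finally show "\<exists>y'\<in>D. dist y' (c *\<^sub>R x + y) < e"
        using d Dadd[OF q(1) step(1) d(1)] by (intro bexI[of _ "q *\<^sub>R x + d"]) auto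
    qed
  qed
  then have "closure (span S) \<subseteq> closure D"
    by (simp add: closure_minimal subsetI)
  then have dense: "closure D = UNIV" using tot by auto
  define B where "B = (\<lambda>(d, r). ball d r) ` (D \<times> \<rat>)"
  have "topological_basis B"
  proof (rule topological_basisI)
    show "open b" if "b \<in> B" for b using that by (auto simp: B_def)
    fix U :: "'a set" and x assume U: "open U" "x \<in> U"
    then obtain e where e: "e > 0" "ball x e \<subseteq> U" by (meson openE)
    obtain d where d: "d \<in> D" "dist d x < e / 3"
      using dense e unfolding closure_approachable set_eq_iff by (metis UNIV_I zero_less_divide_iff zero_less_numeral)
    obtain r where r: "r \<in> \<rat>" "e / 3 < r" "r < e / 2"
      using Rats_dense_in_real[of "e / 3" "e / 2"] e by auto
    have "ball d r \<subseteq> ball x e"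
    proof
      fix z assume "z \<in> ball d r"
      then show "z \<in> ball x e"
        using d r dist_triangle[of x z d] by (simp add: dist_commute)
    qed
    then show "\<exists>b\<in>B. x \<in> b \<and> b \<subseteq> U"
      using d r e unfolding B_def by (intro bexI[of _ "ball d r"]) (auto intro: rev_image_eqI[of "(d, r)"])
  qed
  moreover have "countable B" unfolding B_def by (intro countable_image countable_SIGMA cD countable_rat)
  ultimately show ?thesis
    using topological_basis_imp_subbasis by blast
qed

lemma closure_eq_UNIV_if_dense:
  assumes "\<And>X. open X \<Longrightarrow> X \<noteq> {} \<Longrightarrow> \<exists>d\<in>D. d \<in> X"
  shows "closure D = UNIV"
proof (rule ccontr)
  assume "closure D \<noteq> UNIV"
  then have "- closure D \<noteq> {}" by auto
  then obtain d where "d \<in> D" "d \<in> - closure D"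
    using assms[of "- closure D"] by auto
  then show False using closure_subset[of D] by auto
qed

section \<open>The space of square integrable functions on a compact set\<close>

text \<open>
  The compact set \<open>\<T>\<close> is carried by the type of its ambient Euclidean space, so that \<open>L\<^sup>2(\<T>)\<close> is a
  type to which the library's classes for inner product and Banach spaces, its Borel sets and its
  Bochner integral apply.  A type variable \<open>'t::compact_domain\<close> ranges over all pairs of a Euclidean
  space and a compact subset of it (a second set in the same space being attached to a copy of
  the type), in the same way as \<open>'n::finite\<close> ranges over all dimensions in \<open>real ^ 'n\<close>.
\<close>

class compact_domain = euclidean_space +
  fixes \<T> :: "'a set"
  assumes compact_\<T>: "compact \<T>"

instantiation real :: compact_domain
begin

definition \<T>_real :: "real set" where
  "\<T>_real = {0..1}"

instance
  by standard (simp add: \<T>_real_def)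

end

definition square_integrable :: "('t::compact_domain \<Rightarrow> real) \<Rightarrow> bool" where
  "square_integrable f \<longleftrightarrow>
     f \<in> borel_measurable (lebesgue_on \<T>) \<and> integrable (lebesgue_on \<T>) (\<lambda>x. (f x)\<^sup>2)"

lemma sq_measurable: "square_integrable f \<Longrightarrow> f \<in> borel_measurable (lebesgue_on \<T>)"
  by (simp add: square_integrable_def)

lemma sq_mult:
  assumes "square_integrable f" "square_integrable g"
  shows "integrable (lebesgue_on \<T>) (\<lambda>x. f x * g x)"
proof (rule Bochner_Integration.integrable_bound)
  show "integrable (lebesgue_on \<T>) (\<lambda>x. (f x)\<^sup>2 + (g x)\<^sup>2)"
    using assms by (auto simp: square_integrable_def)
  show "(\<lambda>x. f x * g x) \<in> borel_measurable (lebesgue_on \<T>)"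
    using assms by (auto simp: square_integrable_def)
  have "\<bar>a * b\<bar> \<le> \<bar>a\<^sup>2 + b\<^sup>2\<bar>" for a b :: real
  proof -
    have "2 * \<bar>a * b\<bar> \<le> a\<^sup>2 + b\<^sup>2"
      using sum_squares_bound[of "\<bar>a\<bar>" "\<bar>b\<bar>"] by (simp add: abs_mult)
    then show ?thesis by linarith
  qed
  then show "AE x in lebesgue_on \<T>. norm (f x * g x) \<le> norm ((f x)\<^sup>2 + (g x)\<^sup>2)"
    by simp
qed

lemma sq_add:
  assumes "square_integrable f" "square_integrable g"
  shows "square_integrable (\<lambda>x. f x + g x)"
proof -
  have "integrable (lebesgue_on \<T>) (\<lambda>x. (f x)\<^sup>2 + (g x)\<^sup>2 + 2 * (f x * g x))"
    using assms sq_mult[OF assms] by (auto simp: square_integrable_def)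
  then show ?thesis
    using assms by (auto simp: square_integrable_def power2_sum mult.assoc)
qed

lemma sq_scale: "square_integrable f \<Longrightarrow> square_integrable (\<lambda>x. c * f x)"
  by (auto simp: square_integrable_def power_mult_distrib)

lemma sq_uminus: "square_integrable f \<Longrightarrow> square_integrable (\<lambda>x. - f x)"
  using sq_scale[of f "-1"] by simp

lemma sq_diff:
  "square_integrable f \<Longrightarrow> square_integrable g \<Longrightarrow> square_integrable (\<lambda>x. f x - g x)"
  using sq_add[of f "\<lambda>x. - g x"] sq_uminus[of g] by simp

lemma sq_zero: "square_integrable (\<lambda>x. 0)"
  by (auto simp: square_integrable_def)

lemma sq_abs: "square_integrable f \<Longrightarrow> square_integrable (\<lambda>x. \<bar>f x\<bar>)"
  by (auto simp: square_integrable_def)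

lemma sq_bound:
  assumes "square_integrable w" "f \<in> borel_measurable (lebesgue_on \<T>)"
    "AE x in lebesgue_on \<T>. \<bar>f x\<bar> \<le> w x"
  shows "square_integrable f"
  unfolding square_integrable_def
proof
  show "integrable (lebesgue_on \<T>) (\<lambda>x. (f x)\<^sup>2)"
  proof (rule Bochner_Integration.integrable_bound)
    show "integrable (lebesgue_on \<T>) (\<lambda>x. (w x)\<^sup>2)"
      using assms by (simp add: square_integrable_def)
    show "AE x in lebesgue_on \<T>. norm ((f x)\<^sup>2) \<le> norm ((w x)\<^sup>2)"
      using assms(3) by eventually_elim (auto simp: abs_le_square_iff[symmetric])
  qed (use assms in auto)
qed fact

lemma finite_measure_\<T>: "finite_measure (lebesgue_on (\<T> :: 't::compact_domain set))"
  by (rule finite_measure_lebesgue_on) (simp add: compact_\<T> lmeasurable_compact)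

lemma sq_const: "square_integrable (\<lambda>x. c)"
  using finite_measure.integrable_const[OF finite_measure_\<T>] by (simp add: square_integrable_def)

quotient_type (overloaded) 't L2 = "'t::compact_domain \<Rightarrow> real" / partial:
  "\<lambda>f g. square_integrable f \<and> square_integrable g \<and> (AE x in lebesgue_on \<T>. f x = g x)"
proof (rule part_equivpI)
  show "\<exists>f :: 't \<Rightarrow> real. square_integrable f \<and> square_integrable f \<and> (AE x in lebesgue_on \<T>. f x = f x)"
    using sq_zero by blast
qed (auto intro!: sympI transpI elim: eventually_elim2)

instantiation L2 :: (compact_domain) real_inner
begin

lift_definition zero_L2 :: "'a L2" is "\<lambda>x. 0"
  by (simp add: sq_zero)

lift_definition plus_L2 :: "'a L2 \<Rightarrow> 'a L2 \<Rightarrow> 'a L2" is "\<lambda>f g x. f x + g x"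
  by (auto intro: sq_add)

lift_definition uminus_L2 :: "'a L2 \<Rightarrow> 'a L2" is "\<lambda>f x. - f x"
  by (auto intro: sq_uminus)

lift_definition minus_L2 :: "'a L2 \<Rightarrow> 'a L2 \<Rightarrow> 'a L2" is "\<lambda>f g x. f x - g x"
  by (auto intro: sq_diff)

lift_definition scaleR_L2 :: "real \<Rightarrow> 'a L2 \<Rightarrow> 'a L2" is "\<lambda>c f x. c * f x"
  by (auto intro: sq_scale)

lift_definition inner_L2 :: "'a L2 \<Rightarrow> 'a L2 \<Rightarrow> real" is "\<lambda>f g. \<integral>x. f x * g x \<partial>lebesgue_on \<T>"
  by (intro integral_cong_AE) (auto intro: borel_measurable_times sq_measurable elim: eventually_elim2)

definition norm_L2 :: "'a L2 \<Rightarrow> real" where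
  "norm_L2 f = sqrt (inner f f)"

definition dist_L2 :: "'a L2 \<Rightarrow> 'a L2 \<Rightarrow> real" where
  "dist_L2 f g = norm (f - g)"

definition sgn_L2 :: "'a L2 \<Rightarrow> 'a L2" where
  "sgn_L2 f = scaleR (inverse (norm f)) f"

definition uniformity_L2 :: "('a L2 \<times> 'a L2) filter" where
  "uniformity_L2 = (INF e\<in>{0<..}. principal {(f, g). dist f g < e})"

definition open_L2 :: "'a L2 set \<Rightarrow> bool" where
  "open_L2 U \<longleftrightarrow> (\<forall>f\<in>U. eventually (\<lambda>(f', g). f' = f \<longrightarrow> g \<in> U) uniformity)"

instance
proof
  fix f g h :: "'a L2" and a b :: real
  show "f + g + h = f + (g + h)"
    by transfer (simp add: sq_add add.assoc)
  show "f + g = g + f"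
    by transfer (simp add: sq_add add.commute)
  show "0 + f = f"
    by transfer simp
  show "- f + f = 0"
    by transfer (simp add: sq_zero)
  show "f - g = f + - g"
    by transfer (simp add: sq_diff)
  show "a *\<^sub>R (f + g) = a *\<^sub>R f + a *\<^sub>R g"
    by transfer (simp add: sq_add sq_scale distrib_left)
  show "(a + b) *\<^sub>R f = a *\<^sub>R f + b *\<^sub>R f"
    by transfer (simp add: sq_add sq_scale distrib_right)
  show "a *\<^sub>R b *\<^sub>R f = (a * b) *\<^sub>R f"
    by transfer (simp add: sq_scale mult.assoc)
  show "1 *\<^sub>R f = f"
    by transfer simp
  show "inner f g = inner g f"
    by transfer (simp add: mult.commute)
  show "inner (f + g) h = inner f h + inner g h"
    by transfer (simp add: distrib_right sq_mult)
  show "inner (a *\<^sub>R f) g = a * inner f g"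
    by transfer (simp add: mult.assoc)
  show "0 \<le> inner f f"
    by transfer simp
  show "inner f f = 0 \<longleftrightarrow> f = 0"
  proof transfer
    fix f :: "'a \<Rightarrow> real"
    assume "square_integrable f \<and> square_integrable f \<and> (AE x in lebesgue_on \<T>. f x = f x)"
    then have f: "square_integrable f" by simp
    have "(\<integral>x. f x * f x \<partial>lebesgue_on \<T>) = 0 \<longleftrightarrow> (AE x in lebesgue_on \<T>. f x * f x = 0)"
      by (intro integral_nonneg_eq_0_iff_AE sq_mult f) simp
    then show "((\<integral>x. f x * f x \<partial>lebesgue_on \<T>) = 0) =
      (square_integrable f \<and> square_integrable (\<lambda>x::'a. 0) \<and> (AE x in lebesgue_on \<T>. f x = 0))"
      using f by (simp add: sq_zero)
  qed
qed (fact dist_L2_def sgn_L2_def uniformity_L2_def open_L2_def norm_L2_def)+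

end

lemma norm_abs_diff_sq:
  assumes "square_integrable f" "square_integrable g"
  shows "(norm (abs_L2 f - abs_L2 g))\<^sup>2 = (\<integral>x. (f x - g x)\<^sup>2 \<partial>lebesgue_on \<T>)"
  unfolding power2_norm_eq_inner
  using assms by (simp add: minus_L2.abs_eq inner_L2.abs_eq sq_diff power2_eq_square)

lemma abs_L2_cong:
  assumes "square_integrable f" "g \<in> borel_measurable (lebesgue_on \<T>)"
    "AE x in lebesgue_on \<T>. f x = g x"
  shows "abs_L2 f = abs_L2 g" "square_integrable g"
proof -
  show g: "square_integrable g"
    by (rule sq_bound[OF sq_abs[OF assms(1)] assms(2)]) (use assms(3) in \<open>eventually_elim, simp\<close>)
  show "abs_L2 f = abs_L2 g"
    using Quotient3_rel[OF Quotient3_L2, of f g] assms g by auto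
qed

lemma L2_obtain:
  obtains f where "square_integrable f" "F = abs_L2 f"
  by (metis (mono_tags, lifting) Quotient3_L2 Quotient3_abs_rep Quotient3_rep_reflp)

lemma L2_dominated_convergence:
  fixes g :: "'t::compact_domain \<Rightarrow> real"
  assumes w: "square_integrable w"
    and s: "\<And>n. s n \<in> borel_measurable (lebesgue_on \<T>)"
    and g: "g \<in> borel_measurable (lebesgue_on \<T>)"
    and le: "\<And>n. AE x in lebesgue_on \<T>. \<bar>s n x\<bar> \<le> w x"
    and lim: "AE x in lebesgue_on \<T>. (\<lambda>n. s n x) \<longlonglongrightarrow> g x"
  shows "(\<lambda>n. abs_L2 (s n)) \<longlonglongrightarrow> abs_L2 g" "square_integrable g"
proof -
  have sqs: "square_integrable (s n)" for n
    by (rule sq_bound[OF w s le])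
  have leA: "AE x in lebesgue_on \<T>. \<forall>n. \<bar>s n x\<bar> \<le> w x"
    using le by (simp add: AE_all_countable)
  have leg: "AE x in lebesgue_on \<T>. \<bar>g x\<bar> \<le> w x"
    using leA lim
  proof eventually_elim
    case (elim x)
    then show ?case by (intro LIMSEQ_le_const2[OF tendsto_rabs[OF elim(2)]]) auto
  qed
  show sqg: "square_integrable g"
    by (rule sq_bound[OF w g leg])
  have "(\<lambda>n. \<integral>x. (s n x - g x)\<^sup>2 \<partial>lebesgue_on \<T>) \<longlonglongrightarrow> (\<integral>x. 0 \<partial>lebesgue_on (\<T> :: 't set))"
  proof (rule integral_dominated_convergence[where w = "\<lambda>x. (2 * w x)\<^sup>2"])
    show "integrable (lebesgue_on \<T>) (\<lambda>x. (2 * w x)\<^sup>2)"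
      using sq_scale[OF w, of 2] by (simp add: square_integrable_def)
    show "AE x in lebesgue_on \<T>. (\<lambda>n. (s n x - g x)\<^sup>2) \<longlonglongrightarrow> 0"
      using lim
    proof eventually_elim
      case (elim x)
      have "(\<lambda>n. (s n x - g x)\<^sup>2) \<longlonglongrightarrow> (g x - g x)\<^sup>2"
        by (intro tendsto_intros elim)
      then show ?case by simp
    qed
    show "AE x in lebesgue_on \<T>. norm ((s n x - g x)\<^sup>2) \<le> (2 * w x)\<^sup>2" for n
      using leA leg
    proof eventually_elim
      case (elim x)
      then have "\<bar>s n x\<bar> \<le> w x" by simp
      then have "\<bar>s n x - g x\<bar> \<le> \<bar>2 * w x\<bar>" using elim(2) by linarith
      then show ?case by (simp only: abs_le_square_iff real_norm_def abs_power2)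
    qed
  qed (use s g in auto)
  then have "(\<lambda>n. (norm (abs_L2 (s n) - abs_L2 g))\<^sup>2) \<longlonglongrightarrow> 0"
    by (simp add: norm_abs_diff_sq sqs sqg)
  then have "(\<lambda>n. norm (abs_L2 (s n) - abs_L2 g)) \<longlonglongrightarrow> 0"
    using tendsto_real_sqrt[of "\<lambda>n. (norm (abs_L2 (s n) - abs_L2 g))\<^sup>2" 0 sequentially] by simp
  then show "(\<lambda>n. abs_L2 (s n)) \<longlonglongrightarrow> abs_L2 g"
    using LIM_zero_iff tendsto_norm_zero_iff by blast
qed

instance L2 :: (compact_domain) complete_space
proof
  fix X :: "nat \<Rightarrow> 'a L2"
  assume X: "Cauchy X"
  have "\<forall>k. \<exists>N. \<forall>m\<ge>N. \<forall>n\<ge>N. norm (X m - X n) < (1/2) ^ k"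
    using X unfolding Cauchy_def dist_norm by simp
  then obtain N where N: "\<And>k m n. m \<ge> N k \<Longrightarrow> n \<ge> N k \<Longrightarrow> norm (X m - X n) < (1/2) ^ k"
    by metis
  define r where "r = rec_nat (N 0) (\<lambda>k i. max (Suc i) (N (Suc k)))"
  have r_Suc: "r k < r (Suc k)" for k by (simp add: r_def)
  have r: "strict_mono r" using r_Suc by (rule strict_mono_Suc_iff[THEN iffD2, rule_format])
  have rN: "N k \<le> r k" for k by (cases k) (auto simp: r_def)
  have Xr: "norm (X (r m) - X (r k)) < (1/2) ^ k" if "k \<le> m" for k m
    using that rN[of k] r by (intro N) (auto intro: order_trans simp: strict_mono_less_eq)
  have "\<exists>f. square_integrable f \<and> X (r k) = abs_L2 f" for k
    using L2_obtain by metis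
  then obtain f where f: "\<And>k. square_integrable (f k)" "\<And>k. X (r k) = abs_L2 (f k)"
    by metis
  note [measurable] = f(1)[THEN sq_measurable]
  define h where "h k x = f (Suc k) x - f k x" for k x
  have h: "square_integrable (h k)" for k
    unfolding h_def by (intro sq_diff f)
  note [measurable] = h[THEN sq_measurable]
  define c where "c = norm (abs_L2 (\<lambda>x. 1) :: 'a L2)"
  have c: "c \<ge> 0" by (simp add: c_def)
  have int_h: "(\<integral>\<^sup>+x. ennreal \<bar>h k x\<bar> \<partial>lebesgue_on \<T>) \<le> ennreal ((1/2) ^ k * c)" for k
  proof -
    have i: "integrable (lebesgue_on \<T>) (\<lambda>x. \<bar>h k x\<bar>)"
      using sq_mult[OF sq_abs[OF h] sq_const[of 1]] by simp
    have "(\<integral>x. \<bar>h k x\<bar> \<partial>lebesgue_on \<T>) = inner (abs_L2 (\<lambda>x. \<bar>h k x\<bar>)) (abs_L2 (\<lambda>x. 1))"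
      by (simp add: inner_L2.abs_eq sq_abs h sq_const)
    also have "\<dots> \<le> norm (abs_L2 (\<lambda>x. \<bar>h k x\<bar>)) * c"
      unfolding c_def by (rule norm_cauchy_schwarz)
    also have "norm (abs_L2 (\<lambda>x. \<bar>h k x\<bar>)) = norm (abs_L2 (h k))"
      by (simp add: norm_L2_def inner_L2.abs_eq sq_abs h)
    also have "abs_L2 (h k) = X (r (Suc k)) - X (r k)"
      by (simp add: f minus_L2.abs_eq h_def[abs_def])
    also have "norm (X (r (Suc k)) - X (r k)) * c \<le> (1/2) ^ k * c"
      using Xr[of k "Suc k"] c by (intro mult_right_mono) auto
    finally show ?thesis
      using i by (subst nn_integral_eq_integral) (auto intro!: ennreal_leI)
  qed
  have "(\<integral>\<^sup>+x. (\<Sum>k. ennreal \<bar>h k x\<bar>) \<partial>lebesgue_on \<T>) = (\<Sum>k. \<integral>\<^sup>+x. ennreal \<bar>h k x\<bar> \<partial>lebesgue_on \<T>)"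
    by (rule nn_integral_suminf) simp
  also have "\<dots> \<le> (\<Sum>k. ennreal ((1/2) ^ k * c))"
    by (intro suminf_le int_h) auto
  also have "\<dots> = ennreal (\<Sum>k. (1/2) ^ k * c)"
    using c by (intro suminf_ennreal2) (auto intro!: summable_mult2)
  finally have "(\<integral>\<^sup>+x. (\<Sum>k. ennreal \<bar>h k x\<bar>) \<partial>lebesgue_on \<T>) \<noteq> \<infinity>"
    by (auto simp: top_unique)
  then have "AE x in lebesgue_on \<T>. (\<Sum>k. ennreal \<bar>h k x\<bar>) \<noteq> \<infinity>"
    by (intro nn_integral_PInf_AE) auto
  then have conv: "AE x in lebesgue_on \<T>. convergent (\<lambda>k. f k x)"
  proof eventually_elim
    case (elim x)
    then have "summable (\<lambda>k. \<bar>h k x\<bar>)"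
      by (intro summable_suminf_not_top) auto
    then have "summable (\<lambda>k. f (Suc k) x - f k x)"
      unfolding h_def by (rule summable_rabs_cancel)
    then have "convergent (\<lambda>n. \<Sum>k<n. f (Suc k) x - f k x)"
      by (simp add: summable_iff_convergent)
    then have "convergent (\<lambda>n. f n x - f 0 x)"
      unfolding sum_lessThan_telescope[of "\<lambda>k. f k x"] .
    then have "convergent (\<lambda>n. f n x - f 0 x + f 0 x)"
      by (rule convergent_add) (rule convergent_const)
    then show ?case by simp
  qed
  define g where "g x = lim (\<lambda>k. f k x)" for x
  have g[measurable]: "g \<in> borel_measurable (lebesgue_on \<T>)"
    unfolding g_def by (rule borel_measurable_lim_metric) simp
  have lim: "AE x in lebesgue_on \<T>. (\<lambda>k. f k x) \<longlonglongrightarrow> g x"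
    using conv unfolding g_def by eventually_elim (simp add: convergent_LIMSEQ_iff)
  have nn: "(\<integral>\<^sup>+x. ennreal ((g x - f k x)\<^sup>2) \<partial>lebesgue_on \<T>) \<le> ennreal (((1/2) ^ k)\<^sup>2)" for k
  proof -
    have "(\<integral>\<^sup>+x. ennreal ((g x - f k x)\<^sup>2) \<partial>lebesgue_on \<T>) =
        (\<integral>\<^sup>+x. liminf (\<lambda>m. ennreal ((f m x - f k x)\<^sup>2)) \<partial>lebesgue_on \<T>)"
    proof (rule nn_integral_cong_AE)
      show "AE x in lebesgue_on \<T>.
          ennreal ((g x - f k x)\<^sup>2) = liminf (\<lambda>m. ennreal ((f m x - f k x)\<^sup>2))"
        using lim
      proof eventually_elim
        case (elim x)
        then have "(\<lambda>m. ennreal ((f m x - f k x)\<^sup>2)) \<longlonglongrightarrow> ennreal ((g x - f k x)\<^sup>2)"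
          by (intro tendsto_intros)
        then show ?case
          by (intro lim_imp_Liminf[symmetric]) auto
      qed
    qed
    also have "\<dots> \<le> liminf (\<lambda>m. \<integral>\<^sup>+x. ennreal ((f m x - f k x)\<^sup>2) \<partial>lebesgue_on \<T>)"
      by (rule nn_integral_liminf) simp
    also have "\<dots> \<le> liminf (\<lambda>m. ennreal (((1/2) ^ k)\<^sup>2))"
    proof (rule Liminf_mono)
      show "\<forall>\<^sub>F m in sequentially. (\<integral>\<^sup>+x. ennreal ((f m x - f k x)\<^sup>2) \<partial>lebesgue_on \<T>)
          \<le> ennreal (((1/2) ^ k)\<^sup>2)"
        using eventually_ge_at_top[of k]
      proof eventually_elim
        case (elim m)
        have "integrable (lebesgue_on \<T>) (\<lambda>x. (f m x - f k x)\<^sup>2)"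
          using sq_diff[OF f(1) f(1)] by (simp add: square_integrable_def)
        then have "(\<integral>\<^sup>+x. ennreal ((f m x - f k x)\<^sup>2) \<partial>lebesgue_on \<T>) = ennreal ((norm (X (r m) - X (r k)))\<^sup>2)"
          by (subst nn_integral_eq_integral) (auto simp: f norm_abs_diff_sq)
        also have "\<dots> \<le> ennreal (((1/2) ^ k)\<^sup>2)"
          using Xr[OF elim] by (intro ennreal_leI power_mono) auto
        finally show ?case .
      qed
    qed
    finally show ?thesis by (simp add: Liminf_const)
  qed
  have sqd: "square_integrable (\<lambda>x. g x - f k x)" for k
    unfolding square_integrable_def
    using nn[of k] by (auto intro!: integrableI_nonneg simp: less_top[symmetric] top_unique)
  have sqg: "square_integrable g"
    using sq_add[OF sqd[of 0] f(1)[of 0]] by simp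
  have "norm (abs_L2 g - X (r k)) \<le> (1/2) ^ k" for k
  proof -
    have "ennreal ((norm (abs_L2 g - X (r k)))\<^sup>2) = (\<integral>\<^sup>+x. ennreal ((g x - f k x)\<^sup>2) \<partial>lebesgue_on \<T>)"
      using sqd[of k] unfolding f(2) norm_abs_diff_sq[OF sqg f(1)]
      by (intro nn_integral_eq_integral[symmetric]) (auto simp: square_integrable_def)
    also note nn[of k]
    finally show ?thesis
      by simp
  qed
  then have "(\<lambda>k. norm (X (r k) - abs_L2 g)) \<longlonglongrightarrow> 0"
    by (intro real_tendsto_sandwich[OF _ _ tendsto_const LIMSEQ_power_zero[of "1/2::real"]])
       (auto simp: norm_minus_commute)
  then have "(X \<circ> r) \<longlonglongrightarrow> abs_L2 g"
    using LIM_zero_iff tendsto_norm_zero_iff by (fastforce simp: o_def)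
  then have "X \<longlonglongrightarrow> abs_L2 g"
    using Cauchy_converges_subseq[OF X r] by simp
  then show "convergent X" by (auto simp: convergent_def)
qed

instance L2 :: (compact_domain) banach ..

instance L2 :: (compact_domain) second_countable_topology
proof
  obtain \<B> :: "'a set set" where \<B>: "countable \<B>" "topological_basis \<B>"
    using ex_countable_basis by blast
  define I where "I A = (abs_L2 (indicator A) :: 'a L2)" for A :: "'a set"
  define S where "S = (\<lambda>F. I (\<Union>F)) ` {F. finite F \<and> F \<subseteq> \<B>}"
  define V where "V = closure (span S)"
  have V: "subspace V" unfolding V_def by (intro subspace_closure subspace_span)
  have S_V: "S \<subseteq> V"
    unfolding V_def by (rule order_trans[OF span_superset closure_subset])
  have lim_V: "x \<in> V" if "\<And>n. s n \<in> V" "s \<longlonglongrightarrow> x" for s :: "nat \<Rightarrow> 'a L2" and x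
    using closed_sequentially[of V s x] that by (auto simp: V_def)
  have meas: "f \<in> borel_measurable (lebesgue_on \<T>)" if "f \<in> borel_measurable borel" for f :: "'a \<Rightarrow> real"
    using that by (intro measurable_restrict_space1 measurable_completion) simp
  have sq_ind: "square_integrable (indicator A :: 'a \<Rightarrow> real)" if "A \<in> sets borel" for A
  proof (rule sq_bound[OF sq_const[of 1] meas])
    show "indicator A \<in> borel_measurable borel" using that by simp
  qed (simp add: indicator_def)
  have lim_I: "(\<lambda>n. I (A n)) \<longlonglongrightarrow> I (\<Union>n. A n)"
    if "\<And>n. A n \<in> sets borel" "incseq A" for A
    unfolding I_def
  proof (rule L2_dominated_convergence(1)[OF sq_const[of 1]])
    show "AE x in lebesgue_on \<T>. (\<lambda>n. indicat_real (A n) x) \<longlonglongrightarrow> indicator (\<Union>n. A n) x"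
      using LIMSEQ_indicator_incseq[OF that(2)] by auto
    show "indicat_real (A n) \<in> borel_measurable (lebesgue_on \<T>)" for n
      by (rule meas, rule borel_measurable_indicator) (rule that(1))
    show "indicat_real (\<Union>n. A n) \<in> borel_measurable (lebesgue_on \<T>)"
      by (rule meas, rule borel_measurable_indicator) (use that(1) in auto)
  qed (simp add: indicator_def)
  have open_V: "I U \<in> V" if oU: "open U" for U
  proof -
    obtain B where B: "B \<subseteq> \<B>" "U = \<Union>B"
      using \<B>(2)[unfolded topological_basis_def, THEN conjunct2, rule_format, OF oU] by metis
    show ?thesis
    proof (cases "B = {}")
      case True
      then have "I U \<in> S"
        unfolding S_def using B by (auto intro!: image_eqI[of _ _ "{}"])
      then show ?thesis using S_V by (rule set_mp[rotated])
    next
      case False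
      define A where "A n = (\<Union>i\<le>n. from_nat_into B i)" for n :: nat
      have cB: "countable B" using B \<B> countable_subset by blast
      have in_B: "from_nat_into B i \<in> B" for i using from_nat_into[OF False] .
      have "I (A n) \<in> S" for n
        unfolding S_def A_def using in_B B by (intro image_eqI[of _ _ "from_nat_into B ` {..n}"]) auto
      then have *: "I (A n) \<in> V" for n using S_V by (rule set_mp[rotated])
      have "open (A n)" for n
        unfolding A_def by (intro open_UN ballI topological_basis_open[OF \<B>(2)]) (use in_B B in auto)
      then have "(\<lambda>n. I (A n)) \<longlonglongrightarrow> I (\<Union>n. A n)"
        by (intro lim_I) (auto simp: A_def incseq_def intro: order_trans)
      moreover have "(\<Union>n. A n) = (\<Union>i. from_nat_into B i)"
        by (force simp: A_def)
      moreover have "(\<Union>i. from_nat_into B i) = U"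
        using range_from_nat_into[OF False cB] B(2) by simp
      ultimately show ?thesis using lim_V[OF *] by simp
    qed
  qed
  have borel_V: "I A \<in> V" if "A \<in> sets borel" for A
  proof -
    have "Int_stable {U :: 'a set. open U}" by (auto simp: Int_stable_def)
    moreover have "{U :: 'a set. open U} \<subseteq> Pow UNIV" by auto
    moreover have "A \<in> sigma_sets UNIV {U. open U}" using that by (simp add: borel_def)
    ultimately have "A \<in> sets borel \<and> I A \<in> V"
    proof (induction rule: sigma_sets_induct_disjoint)
      case (basic A)
      then show ?case using open_V by auto
    next
      case empty
      then show ?case using open_V by auto
    next
      case (compl A)
      have "I (UNIV - A) = I UNIV - I A"
      proof -
        have *: "indicat_real (UNIV - A) = (\<lambda>x. indicator UNIV x - indicator A x)"
          by (auto simp: indicator_def fun_eq_iff)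
        show ?thesis
          unfolding I_def * using compl sq_ind[of A] sq_ind[of UNIV] by (subst minus_L2.abs_eq) auto
      qed
      then show ?case
        using compl open_V[of UNIV] V by (auto intro: subspace_diff)
    next
      case (union A)
      have meas_A: "(\<Union>i<n. A i) \<in> sets borel" for n
        using union by auto
      have "I (\<Union>i<n. A i) \<in> V" for n
      proof (induction n)
        case 0
        then show ?case using open_V[of "{}"] by simp
      next
        case (Suc n)
        have "A i \<inter> A n = {}" if "i < n" for i
          using disjoint_family_onD[OF union(1), of i n] that by simp
        then have dis: "(\<Union>i<n. A i) \<inter> A n = {}" by blast
        have "I (\<Union>i<Suc n. A i) = I (\<Union>i<n. A i) + I (A n)"
        proof -
          have *: "indicat_real (\<Union>i<Suc n. A i) = (\<lambda>x. indicator (\<Union>i<n. A i) x + indicator (A n) x)"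
            using dis by (auto simp: indicator_def fun_eq_iff lessThan_Suc)
          show ?thesis
            unfolding I_def * using union sq_ind[OF meas_A[of n]] sq_ind[of "A n"]
            by (subst plus_L2.abs_eq) auto
        qed
        then show ?case using Suc union V by (auto intro: subspace_add)
      qed
      moreover have "(\<lambda>n. I (\<Union>i<n. A i)) \<longlonglongrightarrow> I (\<Union>n. \<Union>i<n. A i)"
        by (intro lim_I meas_A incseq_SucI UN_mono) auto
      moreover have "(\<Union>n. \<Union>i<n. A i) = (\<Union>i. A i)"
        using UN_UN_finite_eq[of A] by (simp add: atLeast0LessThan)
      ultimately have "I (\<Union>i. A i) \<in> V" using lim_V by metis
      then show ?case using union by auto
    qed
    then show ?thesis by simp
  qed
  have simple_V: "abs_L2 s \<in> V \<and> square_integrable s" if s: "simple_function borel s" for s :: "'a \<Rightarrow> real"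
  proof -
    have fin: "finite (range s)" using s by (simp add: simple_function_def)
    have ms: "s -` {y} \<in> sets borel" for y
      using simple_functionD(2)[OF s, of "{y}"] by simp
    define G where "G Y x = (\<Sum>y\<in>Y. y * indicator (s -` {y}) x)" for Y :: "real set" and x
    have "abs_L2 (G Y) \<in> V \<and> square_integrable (G Y)" if "finite Y" for Y
      using that
    proof induction
      case empty
      have "G {} = (\<lambda>x. 0)" by (simp add: G_def fun_eq_iff)
      then show ?case using subspace_0[OF V] by (simp add: zero_L2_def sq_zero)
    next
      case (insert y Y)
      have "abs_L2 (\<lambda>x. y * indicator (s -` {y}) x) = y *\<^sub>R I (s -` {y})"
        unfolding I_def by (simp add: scaleR_L2.abs_eq sq_ind ms)
      then have 1: "abs_L2 (\<lambda>x. y * indicator (s -` {y}) x) \<in> V"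
        using borel_V[OF ms] V by (simp add: subspace_scale)
      have 2: "square_integrable (\<lambda>x. y * indicator (s -` {y}) x)"
        by (intro sq_scale sq_ind ms)
      have 3: "G (insert y Y) = (\<lambda>x. y * indicator (s -` {y}) x + G Y x)"
        by (rule ext) (simp only: G_def sum.insert[OF insert(1,2)])
      have "abs_L2 (G (insert y Y)) = abs_L2 (\<lambda>x. y * indicator (s -` {y}) x) + abs_L2 (G Y)"
        unfolding 3 using insert 2 by (subst plus_L2.abs_eq) auto
      then show ?case
        using insert 1 2 subspace_add[OF V] unfolding 3 by (auto intro: sq_add)
    qed
    moreover have "G (range s) = s"
      unfolding G_def fun_eq_iff using fin
      by (simp add: indicator_def of_bool_def if_distrib cong: if_cong)
    ultimately show ?thesis
      using fin by metis
  qed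
  have "F \<in> V" for F
  proof -
    obtain f where f: "square_integrable f" "F = abs_L2 f" by (rule L2_obtain)
    have T: "(\<T> :: 'a set) \<in> sets lebesgue"
      using lmeasurable_compact[OF compact_\<T>] by (rule fmeasurableD)
    have "(\<lambda>x. if x \<in> \<T> then f x else 0) \<in> borel_measurable (completion lborel)"
      using sq_measurable[OF f(1)] T by (subst borel_measurable_if) auto
    then obtain g where g: "g \<in> borel_measurable lborel"
      and fg: "AE x in lborel. (if x \<in> \<T> then f x else 0) = g x"
      using completion_ex_borel_measurable_real by blast
    have g': "g \<in> borel_measurable borel" using g by simp
    have "AE x in lebesgue. x \<in> \<T> \<longrightarrow> f x = g x"
      using AE_completion[OF fg] by eventually_elim auto
    then have ae: "AE x in lebesgue_on \<T>. f x = g x"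
      using T by (subst AE_restrict_space_iff) auto
    have F: "F = abs_L2 g" and sqg: "square_integrable g"
      using abs_L2_cong[OF f(1) meas[OF g'] ae] f(2) by auto
    obtain s where s: "\<And>i. simple_function borel (s i)"
      "\<And>x. (\<lambda>i. s i x) \<longlonglongrightarrow> g x" "\<And>i x. dist (s i x) 0 \<le> 2 * dist (g x) 0"
      using borel_measurable_implies_sequence_metric[OF g', of 0] by auto
    have "(\<lambda>i. abs_L2 (s i)) \<longlonglongrightarrow> abs_L2 g"
    proof (rule L2_dominated_convergence(1))
      show "square_integrable (\<lambda>x. 2 * \<bar>g x\<bar>)"
        by (intro sq_scale sq_abs sqg)
      show "s i \<in> borel_measurable (lebesgue_on \<T>)" for i
        by (rule meas, rule borel_measurable_simple_function, rule s(1))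
      show "g \<in> borel_measurable (lebesgue_on \<T>)"
        by (rule meas[OF g'])
    qed (use s(2,3) in \<open>simp_all add: dist_real_def\<close>)
    then show "F \<in> V" unfolding F by (rule lim_V[rotated]) (simp add: simple_V[OF s(1)])
  qed
  then have "closure (span S) = UNIV" by (auto simp: V_def)
  moreover have "countable S"
    unfolding S_def by (rule countable_image[OF countable_Collect_finite_subset[OF \<B>(1)]])
  ultimately show "\<exists>B::'a L2 set set. countable B \<and> open = generate_topology B"
    by (rule second_countable_of_total[rotated])
qed

section \<open>Hilbert--Schmidt operators\<close>

class separable_hilbert_space = real_inner + banach + second_countable_topology

instance L2 :: (compact_domain) separable_hilbert_space ..

definition orthonormal_set :: "'a::real_inner set \<Rightarrow> bool" where
  "orthonormal_set B \<longleftrightarrow> (\<forall>e\<in>B. norm e = 1) \<and> pairwise orthogonal B"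

definition orthonormal_basis :: "'a::real_inner set \<Rightarrow> bool" where
  "orthonormal_basis B \<longleftrightarrow> orthonormal_set B \<and> closure (span B) = UNIV"

lemma norm_sum_orthonormal:
  assumes "orthonormal_set B" "finite F" "F \<subseteq> B"
  shows "(norm (\<Sum>e\<in>F. c e *\<^sub>R e))\<^sup>2 = (\<Sum>e\<in>F. (c e)\<^sup>2)"
proof -
  have "(norm (\<Sum>e\<in>F. c e *\<^sub>R e))\<^sup>2 = (\<Sum>e\<in>F. (norm (c e *\<^sub>R e))\<^sup>2)"
    using assms by (intro norm_sum_Pythagorean)
      (auto simp: orthonormal_set_def pairwise_def orthogonal_def)
  also have "\<dots> = (\<Sum>e\<in>F. (c e)\<^sup>2)"
    using assms by (intro sum.cong) (auto simp: orthonormal_set_def)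
  finally show ?thesis .
qed

lemma bessel:
  assumes "orthonormal_set B" "finite F" "F \<subseteq> B"
  shows "(\<Sum>e\<in>F. (inner x e)\<^sup>2) \<le> (norm x)\<^sup>2"
proof -
  let ?y = "\<Sum>e\<in>F. inner x e *\<^sub>R e"
  have 1: "inner x ?y = (\<Sum>e\<in>F. (inner x e)\<^sup>2)"
    by (simp add: inner_sum_right power2_eq_square)
  have 2: "inner ?y ?y = (\<Sum>e\<in>F. (inner x e)\<^sup>2)"
    using norm_sum_orthonormal[OF assms, of "inner x"] by (simp add: power2_norm_eq_inner)
  have "0 \<le> inner (x - ?y) (x - ?y)" by simp
  also have "\<dots> = inner x x - 2 * inner x ?y + inner ?y ?y"
    by (simp add: inner_diff_left inner_diff_right inner_commute)
  finally show ?thesis using 1 2 by (simp add: power2_norm_eq_inner)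
qed

lemma orthonormal_basis_exists:
  "\<exists>B :: 'a::{real_inner, second_countable_topology} set. orthonormal_basis B \<and> countable B"
proof -
  obtain D :: "'a set" where D: "countable D" "\<And>X. open X \<Longrightarrow> X \<noteq> {} \<Longrightarrow> \<exists>d\<in>D. d \<in> X"
    using countable_dense_exists by blast
  have "D \<noteq> {}" using D(2)[of UNIV] by auto
  define d where "d = from_nat_into D"
  have d: "range d = D" unfolding d_def by (rule range_from_nat_into) (use D \<open>D \<noteq> {}\<close> in auto)
  define res where "res F x = x - (\<Sum>e\<in>F. inner x e *\<^sub>R e)" for F and x :: 'a
  define B where "B = rec_nat {} (\<lambda>n F. if res F (d n) = 0 then F else insert (sgn (res F (d n))) F)"
  have B0: "B 0 = {}" and BS: "B (Suc n) = (if res (B n) (d n) = 0 then B n else insert (sgn (res (B n) (d n))) (B n))" for n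
    by (simp_all add: B_def)
  have fin: "finite (B n)" for n by (induction n) (auto simp: B0 BS)
  have on: "orthonormal_set (B n)" for n
  proof (induction n)
    case 0
    then show ?case by (simp add: B0 orthonormal_set_def)
  next
    case (Suc n)
    have "inner (res (B n) x) e = 0" if "e \<in> B n" for e x
    proof -
      have "inner (\<Sum>e\<in>B n. inner x e *\<^sub>R e) e = (\<Sum>e'\<in>B n. if e' = e then inner x e' else 0)"
        unfolding inner_sum_left
        using Suc that by (intro sum.cong) (auto simp: orthonormal_set_def pairwise_def orthogonal_def norm_eq_1)
      also have "\<dots> = inner x e" using that fin by simp
      finally show ?thesis by (simp add: res_def inner_diff_left)
    qed
    then have "orthogonal (sgn (res (B n) x)) e" "orthogonal e (sgn (res (B n) x))" if "e \<in> B n" for e x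
      using that by (simp_all add: sgn_div_norm orthogonal_def inner_commute)
    then show ?case
      using Suc by (auto simp: BS orthonormal_set_def norm_sgn pairwise_insert)
  qed
  have "incseq B" by (rule incseq_SucI) (auto simp: BS)
  have "orthonormal_set (\<Union>n. B n)"
    unfolding orthonormal_set_def pairwise_def
  proof (intro conjI ballI impI)
    fix e assume "e \<in> (\<Union>n. B n)"
    then show "norm e = 1" using on by (auto simp: orthonormal_set_def)
  next
    fix e e' assume "e \<in> (\<Union>n. B n)" "e' \<in> (\<Union>n. B n)" and ne: "e \<noteq> e'"
    then obtain m n where "e \<in> B m" "e' \<in> B n" by auto
    then have "e \<in> B (max m n)" "e' \<in> B (max m n)"
      using incseqD[OF \<open>incseq B\<close>] by (meson max.cobounded1 max.cobounded2 subsetD)+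
    then show "orthogonal e e'" using on[of "max m n"] ne by (auto simp: orthonormal_set_def pairwise_def)
  qed
  moreover have "closure (span (\<Union>n. B n)) = UNIV"
  proof -
    have "d n \<in> span (B (Suc n))" for n
    proof -
      have 1: "(\<Sum>e\<in>B n. inner (d n) e *\<^sub>R e) \<in> span (B (Suc n))"
        by (intro span_sum span_scale span_base) (auto simp: BS)
      have 2: "res (B n) (d n) \<in> span (B (Suc n))"
      proof (cases "res (B n) (d n) = 0")
        case False
        have "res (B n) (d n) = norm (res (B n) (d n)) *\<^sub>R sgn (res (B n) (d n))"
          using False by (simp add: sgn_div_norm)
        also have "\<dots> \<in> span (B (Suc n))"
          by (intro span_scale span_base) (use False in \<open>simp add: BS\<close>)
        finally show ?thesis .
      qed (simp add: span_zero)
      show ?thesis using span_add[OF 1 2] by (simp add: res_def)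
    qed
    then have "D \<subseteq> span (\<Union>n. B n)"
      unfolding d[symmetric] using span_mono[of "B _" "\<Union>n. B n"] by blast
    then have "closure D \<subseteq> closure (span (\<Union>n. B n))" by (rule closure_mono)
    moreover have "closure D = UNIV"
      using D(2) by (rule closure_eq_UNIV_if_dense)
    ultimately show ?thesis by auto
  qed
  moreover have "countable (\<Union>n. B n)" using fin by (intro countable_UN) (auto intro: countable_finite)
  ultimately show ?thesis unfolding orthonormal_basis_def by blast
qed

text \<open>
  Neither the set of Hilbert--Schmidt operators nor the Hilbert--Schmidt norm depends on the
  orthonormal basis; one is fixed by choice.
\<close>

definition onb :: "'a::separable_hilbert_space set" where
  "onb = (SOME B. orthonormal_basis B)"

lemma onb: "orthonormal_basis (onb :: 'a::separable_hilbert_space set)"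
  unfolding onb_def using orthonormal_basis_exists by (metis someI_ex)

lemma onb_set: "orthonormal_set onb" and onb_dense: "closure (span onb) = UNIV"
  using onb by (auto simp: orthonormal_basis_def)

definition hilbert_schmidt :: "('a::separable_hilbert_space \<Rightarrow> 'a) \<Rightarrow> bool" where
  "hilbert_schmidt A \<longleftrightarrow> bounded_linear A \<and> (\<lambda>e. (norm (A e))\<^sup>2) summable_on onb"

lemma hs_summable: "hilbert_schmidt A \<Longrightarrow> (\<lambda>e. (norm (A e))\<^sup>2) summable_on onb"
  by (simp add: hilbert_schmidt_def)

lemma hs_inner_summable:
  assumes "hilbert_schmidt A" "hilbert_schmidt A'"
  shows "(\<lambda>e. inner (A e) (A' e)) summable_on onb"
proof (rule abs_summable_summable, rule summable_on_comparison_test)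
  show "(\<lambda>e. (norm (A e))\<^sup>2 + (norm (A' e))\<^sup>2) summable_on onb"
    using assms by (intro summable_on_add hs_summable)
  fix e
  have "2 * (norm (A e) * norm (A' e)) \<le> (norm (A e))\<^sup>2 + (norm (A' e))\<^sup>2"
    using sum_squares_bound[of "norm (A e)" "norm (A' e)"] by simp
  moreover have "0 \<le> norm (A e) * norm (A' e)" by simp
  ultimately show "norm (inner (A e) (A' e)) \<le> (norm (A e))\<^sup>2 + (norm (A' e))\<^sup>2"
    using Cauchy_Schwarz_ineq2[of "A e" "A' e"] unfolding real_norm_def by linarith
qed simp

lemma hs_zero: "hilbert_schmidt (\<lambda>x. 0)"
  by (simp add: hilbert_schmidt_def bounded_linear_zero)

lemma hs_add:
  assumes "hilbert_schmidt A" "hilbert_schmidt A'"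
  shows "hilbert_schmidt (\<lambda>x. A x + A' x)"
  unfolding hilbert_schmidt_def
proof
  show "bounded_linear (\<lambda>x. A x + A' x)"
    using assms by (intro bounded_linear_add) (simp_all add: hilbert_schmidt_def)
  have *: "(norm (A e + A' e))\<^sup>2 = (norm (A e))\<^sup>2 + (norm (A' e))\<^sup>2 + 2 * inner (A e) (A' e)" for e
    using dot_norm[of "A e" "A' e"] by simp
  show "(\<lambda>e. (norm (A e + A' e))\<^sup>2) summable_on onb"
    unfolding * using assms by (intro summable_on_add summable_on_cmult_right hs_summable hs_inner_summable)
qed

lemma hs_scale: "hilbert_schmidt A \<Longrightarrow> hilbert_schmidt (\<lambda>x. c *\<^sub>R A x)"
  by (auto simp: hilbert_schmidt_def power_mult_distrib intro!: bounded_linear_const_scaleR summable_on_cmult_right)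

lemma hs_uminus: "hilbert_schmidt A \<Longrightarrow> hilbert_schmidt (\<lambda>x. - A x)"
  using hs_scale[of A "-1"] by simp

lemma hs_diff:
  "hilbert_schmidt A \<Longrightarrow> hilbert_schmidt A' \<Longrightarrow> hilbert_schmidt (\<lambda>x. A x - A' x)"
  using hs_add[of A "\<lambda>x. - A' x"] hs_uminus[of A'] by simp

lemma norm_le_on_dense:
  fixes A :: "'a::separable_hilbert_space \<Rightarrow> 'b::real_normed_vector"
  assumes A: "bounded_linear A" and le: "\<And>x. x \<in> span onb \<Longrightarrow> norm (A x) \<le> K * norm x"
  shows "norm (A x) \<le> K * norm x"
proof -
  have "x \<in> closure (span onb)" by (simp add: onb_dense)
  then obtain s where s: "\<And>n. s n \<in> span onb" "s \<longlonglongrightarrow> x"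
    unfolding closure_sequential by blast
  show ?thesis
    by (rule LIMSEQ_le[of "\<lambda>n. norm (A (s n))" _ "\<lambda>n. K * norm (s n)"])
       (auto intro!: tendsto_intros bounded_linear.tendsto[OF A] s le)
qed

lemma hs_norm_bound:
  assumes "hilbert_schmidt A"
  shows "norm (A x) \<le> sqrt (infsum (\<lambda>e. (norm (A e))\<^sup>2) onb) * norm x"
proof (rule norm_le_on_dense)
  show A: "bounded_linear A" using assms by (simp add: hilbert_schmidt_def)
  fix x :: 'a assume "x \<in> span onb"
  then obtain F c where F: "finite F" "F \<subseteq> onb" and x: "x = (\<Sum>e\<in>F. c e *\<^sub>R e)"
    unfolding span_explicit by blast
  have "norm (A x) = norm (\<Sum>e\<in>F. c e *\<^sub>R A e)"
    unfolding x using bounded_linear.linear[OF A] by (simp add: linear_sum linear_cmul)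
  also have "\<dots> \<le> (\<Sum>e\<in>F. \<bar>c e\<bar> * \<bar>norm (A e)\<bar>)"
    by (rule sum_norm_le) simp
  also have "\<dots> \<le> L2_set c F * L2_set (\<lambda>e. norm (A e)) F"
    by (rule L2_set_mult_ineq)
  also have "L2_set c F = norm x"
    unfolding L2_set_def x norm_sum_orthonormal[OF onb_set F, symmetric] by simp
  also have "norm x * L2_set (\<lambda>e. norm (A e)) F \<le> norm x * sqrt (infsum (\<lambda>e. (norm (A e))\<^sup>2) onb)"
    unfolding L2_set_def
    by (intro mult_left_mono real_sqrt_le_mono finite_sum_le_infsum hs_summable assms F) simp_all
  finally show "norm (A x) \<le> sqrt (infsum (\<lambda>e. (norm (A e))\<^sup>2) onb) * norm x"
    by (simp add: mult.commute)
qed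

typedef (overloaded) 'a hs_op = "{A :: 'a::separable_hilbert_space \<Rightarrow> 'a. hilbert_schmidt A}"
  morphisms hs_apply Abs_hs_op
  using hs_zero by blast

setup_lifting type_definition_hs_op

lemma hs_apply: "hilbert_schmidt (hs_apply A)"
  using hs_apply by simp

instantiation hs_op :: (separable_hilbert_space) real_inner
begin

lift_definition zero_hs_op :: "'a hs_op" is "\<lambda>x. 0"
  by (rule hs_zero)

lift_definition plus_hs_op :: "'a hs_op \<Rightarrow> 'a hs_op \<Rightarrow> 'a hs_op" is "\<lambda>A A' x. A x + A' x"
  by (rule hs_add)

lift_definition uminus_hs_op :: "'a hs_op \<Rightarrow> 'a hs_op" is "\<lambda>A x. - A x"
  by (rule hs_uminus)

lift_definition minus_hs_op :: "'a hs_op \<Rightarrow> 'a hs_op \<Rightarrow> 'a hs_op" is "\<lambda>A A' x. A x - A' x"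
  by (rule hs_diff)

lift_definition scaleR_hs_op :: "real \<Rightarrow> 'a hs_op \<Rightarrow> 'a hs_op" is "\<lambda>c A x. c *\<^sub>R A x"
  by (rule hs_scale)

lift_definition inner_hs_op :: "'a hs_op \<Rightarrow> 'a hs_op \<Rightarrow> real"
  is "\<lambda>A A'. \<Sum>\<^sub>\<infinity>e\<in>onb. inner (A e) (A' e)" .

definition norm_hs_op :: "'a hs_op \<Rightarrow> real" where
  "norm_hs_op A = sqrt (inner A A)"

definition dist_hs_op :: "'a hs_op \<Rightarrow> 'a hs_op \<Rightarrow> real" where
  "dist_hs_op A A' = norm (A - A')"

definition sgn_hs_op :: "'a hs_op \<Rightarrow> 'a hs_op" where
  "sgn_hs_op A = scaleR (inverse (norm A)) A"

definition uniformity_hs_op :: "('a hs_op \<times> 'a hs_op) filter" where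
  "uniformity_hs_op = (INF e\<in>{0<..}. principal {(A, A'). dist A A' < e})"

definition open_hs_op :: "'a hs_op set \<Rightarrow> bool" where
  "open_hs_op U \<longleftrightarrow> (\<forall>A\<in>U. eventually (\<lambda>(A', A''). A' = A \<longrightarrow> A'' \<in> U) uniformity)"

instance
proof
  fix A A' A'' :: "'a hs_op" and a b :: real
  show "A + A' + A'' = A + (A' + A'')" by transfer (simp add: add.assoc)
  show "A + A' = A' + A" by transfer (simp add: add.commute)
  show "0 + A = A" by transfer simp
  show "- A + A = 0" by transfer simp
  show "A - A' = A + - A'" by transfer simp
  show "a *\<^sub>R (A + A') = a *\<^sub>R A + a *\<^sub>R A'" by transfer (simp add: scaleR_add_right)
  show "(a + b) *\<^sub>R A = a *\<^sub>R A + b *\<^sub>R A" by transfer (simp add: scaleR_add_left)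
  show "a *\<^sub>R b *\<^sub>R A = (a * b) *\<^sub>R A" by transfer simp
  show "1 *\<^sub>R A = A" by transfer simp
  show "inner A A' = inner A' A" by transfer (simp add: inner_commute)
  show "inner (A + A') A'' = inner A A'' + inner A' A''"
    by transfer (simp add: inner_add_left infsum_add hs_inner_summable)
  show "inner (a *\<^sub>R A) A' = a * inner A A'"
    by transfer (simp add: infsum_cmult_right hs_inner_summable)
  show "0 \<le> inner A A" by transfer (simp add: infsum_nonneg)
  show "inner A A = 0 \<longleftrightarrow> A = 0"
  proof transfer
    fix A :: "'a \<Rightarrow> 'a" assume A: "hilbert_schmidt A"
    show "((\<Sum>\<^sub>\<infinity>e\<in>onb. inner (A e) (A e)) = 0) = (A = (\<lambda>x. 0))"
    proof
      assume "(\<Sum>\<^sub>\<infinity>e\<in>onb. inner (A e) (A e)) = 0"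
      then show "A = (\<lambda>x. 0)"
        using hs_norm_bound[OF A] by (auto simp: fun_eq_iff power2_norm_eq_inner)
    qed simp
  qed
qed (fact dist_hs_op_def sgn_hs_op_def uniformity_hs_op_def open_hs_op_def norm_hs_op_def)+

end

lemma norm_hs_op: "norm A = sqrt (\<Sum>\<^sub>\<infinity>e\<in>onb. (norm (hs_apply A e))\<^sup>2)"
  by (simp add: norm_hs_op_def inner_hs_op.rep_eq power2_norm_eq_inner)

lemma norm_hs_apply_le: "norm (hs_apply A x) \<le> norm A * norm x"
  unfolding norm_hs_op by (rule hs_norm_bound[OF hs_apply])

lemma norm_hs_op_le:
  assumes "\<And>F. finite F \<Longrightarrow> F \<subseteq> onb \<Longrightarrow> (\<Sum>e\<in>F. (norm (hs_apply A e))\<^sup>2) \<le> K\<^sup>2" "K \<ge> 0"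
  shows "norm A \<le> K"
  unfolding norm_hs_op
  by (rule real_le_lsqrt[OF assms(2) infsum_le_finite_sums[OF hs_summable[OF hs_apply] assms(1)]])

lemma hilbert_schmidtI:
  assumes "bounded_linear A" "\<And>F. finite F \<Longrightarrow> F \<subseteq> onb \<Longrightarrow> (\<Sum>e\<in>F. (norm (A e))\<^sup>2) \<le> K"
  shows "hilbert_schmidt A"
  unfolding hilbert_schmidt_def
proof
  show "(\<lambda>e. (norm (A e))\<^sup>2) summable_on onb"
    by (intro nonneg_bdd_above_summable_on bdd_aboveI2[where M = K] assms(2)) auto
qed fact

instance hs_op :: (separable_hilbert_space) complete_space
proof
  fix X :: "nat \<Rightarrow> 'a hs_op"
  assume X: "Cauchy X"
  define a where "a n = Blinfun (hs_apply (X n))" for n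
  have bl: "bounded_linear (hs_apply (X n))" for n
    using hs_apply[of "X n"] by (simp add: hilbert_schmidt_def)
  have a: "blinfun_apply (a n) = hs_apply (X n)" for n
    unfolding a_def by (rule bounded_linear_Blinfun_apply[OF bl])
  have le: "norm (a m - a n) \<le> norm (X m - X n)" for m n
  proof (rule norm_blinfun_bound)
    show "norm (blinfun_apply (a m - a n) x) \<le> norm (X m - X n) * norm x" for x
      using norm_hs_apply_le[of "X m - X n" x] by (simp add: minus_blinfun.rep_eq a minus_hs_op.rep_eq)
  qed simp
  have "Cauchy a"
  proof (rule CauchyI)
    fix r :: real assume "r > 0"
    from CauchyD[OF X this] obtain N where "\<forall>m\<ge>N. \<forall>n\<ge>N. norm (X m - X n) < r" ..
    then have "\<forall>m\<ge>N. \<forall>n\<ge>N. norm (a m - a n) < r"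
      by (intro allI impI le_less_trans[OF le]) simp
    then show "\<exists>N. \<forall>m\<ge>N. \<forall>n\<ge>N. norm (a m - a n) < r" ..
  qed
  then obtain L where L: "a \<longlonglongrightarrow> L"
    using Cauchy_convergent_iff convergent_def by blast
  have lim: "(\<lambda>n. hs_apply (X n) x) \<longlonglongrightarrow> blinfun_apply L x" for x
    using bounded_bilinear.tendsto[OF bounded_bilinear_blinfun_apply L tendsto_const, of x] by (simp add: a)
  have part: "(\<Sum>e\<in>F. (norm (blinfun_apply L e - hs_apply (X n) e))\<^sup>2) \<le> \<epsilon>\<^sup>2"
    if "\<And>m. m \<ge> N \<Longrightarrow> norm (X m - X n) \<le> \<epsilon>" "finite F" "F \<subseteq> onb" for F N n \<epsilon>
  proof (rule LIMSEQ_le_const2)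
    show "(\<lambda>m. \<Sum>e\<in>F. (norm (hs_apply (X m) e - hs_apply (X n) e))\<^sup>2) \<longlonglongrightarrow>
        (\<Sum>e\<in>F. (norm (blinfun_apply L e - hs_apply (X n) e))\<^sup>2)"
      by (intro tendsto_intros lim)
    have "(\<Sum>e\<in>F. (norm (hs_apply (X m) e - hs_apply (X n) e))\<^sup>2) \<le> \<epsilon>\<^sup>2" if m: "m \<ge> N" for m
    proof -
      have "(\<Sum>e\<in>F. (norm (hs_apply (X m) e - hs_apply (X n) e))\<^sup>2) =
          (\<Sum>e\<in>F. (norm (hs_apply (X m - X n) e))\<^sup>2)"
        by (simp add: minus_hs_op.rep_eq)
      also have "\<dots> \<le> (\<Sum>\<^sub>\<infinity>e\<in>onb. (norm (hs_apply (X m - X n) e))\<^sup>2)"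
        using that by (intro finite_sum_le_infsum hs_summable hs_apply \<open>finite F\<close> \<open>F \<subseteq> onb\<close>) simp
      also have "\<dots> = (norm (X m - X n))\<^sup>2"
        by (simp add: norm_hs_op infsum_nonneg)
      also have "\<dots> \<le> \<epsilon>\<^sup>2"
        using \<open>\<And>m. m \<ge> N \<Longrightarrow> norm (X m - X n) \<le> \<epsilon>\<close>[OF m] by (intro power_mono) auto
      finally show ?thesis .
    qed
    then show "\<exists>N. \<forall>m\<ge>N. (\<Sum>e\<in>F. (norm (hs_apply (X m) e - hs_apply (X n) e))\<^sup>2) \<le> \<epsilon>\<^sup>2"
      by blast
  qed
  have ex: "\<exists>N. \<forall>m\<ge>N. \<forall>n\<ge>N. norm (X m - X n) < \<epsilon>" if "\<epsilon> > 0" for \<epsilon>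
    using CauchyD[OF X that] .
  have hs: "hilbert_schmidt (blinfun_apply L)"
  proof -
    obtain N where N: "\<And>m n. m \<ge> N \<Longrightarrow> n \<ge> N \<Longrightarrow> norm (X m - X n) < 1"
      using ex[of 1] by auto
    have "hilbert_schmidt (\<lambda>x. blinfun_apply L x - hs_apply (X N) x)"
    proof (rule hilbert_schmidtI)
      show "bounded_linear (\<lambda>x. blinfun_apply L x - hs_apply (X N) x)"
        by (intro bounded_linear_sub bl blinfun.bounded_linear_right)
      show "(\<Sum>e\<in>F. (norm (blinfun_apply L e - hs_apply (X N) e))\<^sup>2) \<le> 1\<^sup>2"
        if "finite F" "F \<subseteq> onb" for F
        using that by (intro part[of N "N" 1 F, OF less_imp_le[OF N]]) auto
    qed
    from hs_add[OF this hs_apply[of "X N"]] show ?thesis by simp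
  qed
  have ap: "hs_apply (Abs_hs_op (blinfun_apply L)) = blinfun_apply L"
    by (rule Abs_hs_op_inverse) (simp add: hs)
  have "X \<longlonglongrightarrow> Abs_hs_op (blinfun_apply L)"
  proof (rule LIMSEQ_I)
    fix r :: real assume "r > 0"
    then obtain N where N: "\<And>m n. m \<ge> N \<Longrightarrow> n \<ge> N \<Longrightarrow> norm (X m - X n) < r / 2"
      using ex[of "r / 2"] by auto
    have half: "norm (Abs_hs_op (blinfun_apply L) - X n) \<le> r / 2" if n: "n \<ge> N" for n
    proof (rule norm_hs_op_le)
      show "(\<Sum>e\<in>F. (norm (hs_apply (Abs_hs_op (blinfun_apply L) - X n) e))\<^sup>2) \<le> (r / 2)\<^sup>2"
        if "finite F" "F \<subseteq> onb" for F
        unfolding minus_hs_op.rep_eq ap by (rule part[OF less_imp_le[OF N[OF _ n]] that])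
    qed (use \<open>r > 0\<close> in simp)
    have "norm (X n - Abs_hs_op (blinfun_apply L)) < r" if "n \<ge> N" for n
      using half[OF that] \<open>r > 0\<close> by (simp add: norm_minus_commute)
    then show "\<exists>N. \<forall>n\<ge>N. norm (X n - Abs_hs_op (blinfun_apply L)) < r" by blast
  qed
  then show "convergent X" by (auto simp: convergent_def)
qed

instance hs_op :: (separable_hilbert_space) banach ..

text \<open>The operator \<open>x \<mapsto> \<langle>y, x\<rangle> z\<close>; the first factor is the one paired with the argument.\<close>

lift_definition tensor :: "'a::separable_hilbert_space \<Rightarrow> 'a \<Rightarrow> 'a hs_op" (infixr "\<otimes>" 70)
  is "\<lambda>y z x. inner y x *\<^sub>R z"
proof (rule hilbert_schmidtI)
  fix y z :: 'a
  show "bounded_linear (\<lambda>x. inner y x *\<^sub>R z)"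
    by (intro bounded_linear_scaleR_const bounded_linear_inner_right)
  show "(\<Sum>e\<in>F. (norm (inner y e *\<^sub>R z))\<^sup>2) \<le> (norm y)\<^sup>2 * (norm z)\<^sup>2"
    if "finite F" "F \<subseteq> onb" for F
    using bessel[OF onb_set that, of y]
    by (simp add: power_mult_distrib sum_distrib_right[symmetric] mult_right_mono)
qed


lemma norm_tensor_le: "norm (y \<otimes> z) \<le> norm y * norm z"
proof (rule norm_hs_op_le)
  show "(\<Sum>e\<in>F. (norm (hs_apply (y \<otimes> z) e))\<^sup>2) \<le> (norm y * norm z)\<^sup>2"
    if "finite F" "F \<subseteq> onb" for F
    using bessel[OF onb_set that, of y]
    by (simp add: tensor.rep_eq power_mult_distrib sum_distrib_right[symmetric] mult_right_mono)
qed simp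

lemma bounded_bilinear_tensor: "bounded_bilinear (\<otimes>)"
proof
  fix y y' z z' :: 'a and r :: real
  show "(y + y') \<otimes> z = y \<otimes> z + y' \<otimes> z"
    by transfer (simp add: inner_add_left scaleR_add_left)
  show "y \<otimes> (z + z') = y \<otimes> z + y \<otimes> z'"
    by transfer (simp add: scaleR_add_right)
  show "(r *\<^sub>R y) \<otimes> z = r *\<^sub>R (y \<otimes> z)"
    by transfer simp
  show "y \<otimes> (r *\<^sub>R z) = r *\<^sub>R (y \<otimes> z)"
    by transfer (simp add: mult.commute)
  show "\<exists>K. \<forall>y z :: 'a. norm (y \<otimes> z) \<le> norm y * norm z * K"
    by (intro exI[of _ 1]) (simp add: norm_tensor_le)
qed

lemma hs_apply_sum: "hs_apply (\<Sum>i\<in>I. A i) x = (\<Sum>i\<in>I. hs_apply (A i) x)"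
  by (induction I rule: infinite_finite_induct) (auto simp: zero_hs_op.rep_eq plus_hs_op.rep_eq)

instance hs_op :: (separable_hilbert_space) second_countable_topology
proof
  obtain D :: "'a set" where D: "countable D" "\<And>X. open X \<Longrightarrow> X \<noteq> {} \<Longrightarrow> \<exists>d\<in>D. d \<in> X"
    using countable_dense_exists by blast
  have "closure D = UNIV"
    using D(2) by (rule closure_eq_UNIV_if_dense)
  then have seq: "\<exists>s. (\<forall>n. s n \<in> D) \<and> s \<longlonglongrightarrow> x" for x
    using closure_sequential by blast
  define S where "S = (\<lambda>(y, z). y \<otimes> z) ` (D \<times> D)"
  define V where "V = closure (span S)"
  have V: "subspace V" unfolding V_def by (intro subspace_closure subspace_span)
  have S_V: "S \<subseteq> V"
    unfolding V_def by (rule order_trans[OF span_superset closure_subset])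
  have tensor_V: "y \<otimes> z \<in> V" for y z
  proof -
    obtain s t where st: "\<And>n. s n \<in> D" "s \<longlonglongrightarrow> y" "\<And>n. t n \<in> D" "t \<longlonglongrightarrow> z"
      using seq by metis
    have "(\<lambda>n. s n \<otimes> t n) \<longlonglongrightarrow> y \<otimes> z"
      by (rule bounded_bilinear.tendsto[OF bounded_bilinear_tensor st(2,4)])
    moreover have "s n \<otimes> t n \<in> V" for n
      using S_V st by (auto simp: S_def)
    moreover have "closed V" by (simp add: V_def)
    ultimately show ?thesis using closed_sequentially[of V "\<lambda>n. s n \<otimes> t n" "y \<otimes> z"] by simp
  qed
  have "A \<in> V" for A
  proof -
    have "A \<in> closure V"
      unfolding closure_approachable
    proof safe
      fix r :: real assume r: "r > 0"
      let ?f = "\<lambda>e. (norm (hs_apply A e))\<^sup>2"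
      have sm: "?f summable_on onb" by (rule hs_summable[OF hs_apply])
      have "\<forall>\<^sub>F F in finite_subsets_at_top onb. dist (sum ?f F) (infsum ?f onb) < (r / 2)\<^sup>2"
        using infsum_tendsto[OF sm] r by (intro tendstoD) auto
      then obtain F where F: "finite F" "F \<subseteq> onb" "dist (sum ?f F) (infsum ?f onb) < (r / 2)\<^sup>2"
        unfolding eventually_finite_subsets_at_top by blast
      define A' where "A' = (\<Sum>e\<in>F. e \<otimes> hs_apply A e)"
      have "A' \<in> V" unfolding A'_def by (intro subspace_sum V tensor_V)
      have app: "hs_apply (A' - A) e = (if e \<in> F then 0 else - hs_apply A e)" if e: "e \<in> onb" for e
      proof -
        have "hs_apply A' e = (\<Sum>e'\<in>F. if e' = e then hs_apply A e' else 0)"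
          unfolding A'_def hs_apply_sum tensor.rep_eq
          using F(2) e onb_set
          by (intro sum.cong) (auto simp: orthonormal_set_def pairwise_def orthogonal_def norm_eq_1)
        then show ?thesis using F(1) by (simp add: minus_hs_op.rep_eq)
      qed
      have "norm (A' - A) \<le> r / 2"
      proof (rule norm_hs_op_le)
        fix G :: "'a set" assume G: "finite G" "G \<subseteq> onb"
        have "(\<Sum>e\<in>G. (norm (hs_apply (A' - A) e))\<^sup>2) = (\<Sum>e\<in>G. if e \<in> F then 0 else ?f e)"
          using G app by (intro sum.cong) auto
        also have "\<dots> = sum ?f (G - F)"
          using G by (intro sum.mono_neutral_cong_right) auto
        also have "\<dots> = sum ?f (G \<union> F) - sum ?f F"
        proof -
          have "G \<union> F = (G - F) \<union> F" by blast
          then have "sum ?f (G \<union> F) = sum ?f (G - F) + sum ?f F"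
            using F G sum.union_disjoint[of "G - F" F ?f] by auto
          then show ?thesis by simp
        qed
        also have "\<dots> \<le> infsum ?f onb - sum ?f F"
          using F G sm by (intro diff_right_mono finite_sum_le_infsum) auto
        also have "\<dots> \<le> (r / 2)\<^sup>2"
          using F(3) by (simp add: dist_real_def)
        finally show "(\<Sum>e\<in>G. (norm (hs_apply (A' - A) e))\<^sup>2) \<le> (r / 2)\<^sup>2" .
      qed (use r in simp)
      then show "\<exists>A'\<in>V. dist A' A < r"
        using r \<open>A' \<in> V\<close> by (intro bexI[of _ A']) (auto simp: dist_norm)
    qed
    then show ?thesis by (simp add: V_def)
  qed
  then have "closure (span S) = UNIV" by (auto simp: V_def)
  moreover have "countable S"
    unfolding S_def using D(1) by auto
  ultimately show "\<exists>B::'a hs_op set set. countable B \<and> open = generate_topology B"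
    by (rule second_countable_of_total[rotated])
qed

instance hs_op :: (separable_hilbert_space) separable_hilbert_space ..

section \<open>Eigenvalues and eigenfunctions\<close>

text \<open>
  The sequences are indexed from 1, the value at 0 being irrelevant.  The last clause says that
  every nonzero eigenvalue occurs, repeated according to its multiplicity.  The eigenvalue 0 is
  treated differently because it need not fit into a decreasing sequence: for an operator of
  infinite rank the positive eigenvalues already exhaust the indices, and for an operator of
  finite rank the sequence is padded by zeros with eigenfunctions from the kernel.
\<close>

definition eigensystem ::
  "'h::separable_hilbert_space hs_op \<Rightarrow> (nat \<Rightarrow> real) \<Rightarrow> (nat \<Rightarrow> 'h) \<Rightarrow> bool" where
  "eigensystem A \<mu> e \<longleftrightarrow>
     (\<forall>i\<ge>1. \<forall>j\<ge>i. \<mu> j \<le> \<mu> i) \<and>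
     (\<forall>i\<ge>1. \<forall>j\<ge>1. inner (e i) (e j) = (if i = j then 1 else 0)) \<and>
     (\<forall>j\<ge>1. hs_apply A (e j) = \<mu> j *\<^sub>R e j) \<and>
     (\<forall>c. c \<noteq> 0 \<longrightarrow> {x. hs_apply A x = c *\<^sub>R x} = span (e ` {j. 1 \<le> j \<and> \<mu> j = c}))"

section \<open>Covariance operators\<close>

definition cov_op :: "'w measure \<Rightarrow> ('w \<Rightarrow> 'h::separable_hilbert_space) \<Rightarrow> 'h hs_op" where
  "cov_op M X = (\<integral>\<omega>. X \<omega> \<otimes> X \<omega> \<partial>M)"

definition sample_cov_op ::
  "(nat \<Rightarrow> 'w \<Rightarrow> 'h::separable_hilbert_space) \<Rightarrow> nat \<Rightarrow> 'w \<Rightarrow> 'h hs_op" where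
  "sample_cov_op X N \<omega> = (1 / real N) *\<^sub>R (\<Sum>n=1..N. X n \<omega> \<otimes> X n \<omega>)"

section \<open>Regular variation\<close>

definition slowly_varying :: "(real \<Rightarrow> real) \<Rightarrow> bool" where
  "slowly_varying L \<longleftrightarrow>
     L \<in> borel_measurable (restrict_space borel {0<..}) \<and>
     eventually (\<lambda>u. L u > 0) at_top \<and>
     (\<forall>c>0. ((\<lambda>u. L (c * u) / L u) \<longlongrightarrow> 1) at_top)"

definition weakly_converges ::
  "('i \<Rightarrow> 'b::topological_space measure) \<Rightarrow> 'b measure \<Rightarrow> 'i filter \<Rightarrow> bool" where
  "weakly_converges \<mu> \<nu> F \<longleftrightarrow>
     (\<forall>f :: 'b \<Rightarrow> real. continuous_on UNIV f \<and> bounded (range f) \<longrightarrow>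
        ((\<lambda>i. \<integral>x. f x \<partial>\<mu> i) \<longlongrightarrow> (\<integral>x. f x \<partial>\<nu>)) F)"

text \<open>
  Probability measures on the unit sphere are taken as Borel measures on the whole space giving
  mass 1 to the sphere.  As the sphere is closed, weak convergence is the same in both settings,
  by Tietze's theorem.  The measures \<open>uniform_measure M {\<omega>. norm (X \<omega>) > u}\<close> are the
  conditional probabilities given \<open>norm X > u\<close>.
\<close>

definition regularly_varying ::
  "'w measure \<Rightarrow> ('w \<Rightarrow> 'b::{banach, second_countable_topology}) \<Rightarrow> real \<Rightarrow> bool" where
  "regularly_varying M X \<alpha> \<longleftrightarrow>
     \<alpha> > 0 \<and> X \<in> borel_measurable M \<and>
     (\<exists>L. slowly_varying L \<and>
        (\<forall>u>0. measure M {\<omega> \<in> space M. norm (X \<omega>) > u} = u powr (- \<alpha>) * L u)) \<and>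
     (\<exists>\<Gamma>. prob_space \<Gamma> \<and> sets \<Gamma> = sets borel \<and> measure \<Gamma> (sphere 0 1) = 1 \<and>
        weakly_converges
          (\<lambda>u. distr (uniform_measure M {\<omega> \<in> space M. norm (X \<omega>) > u}) borel
             (\<lambda>\<omega>. X \<omega> /\<^sub>R norm (X \<omega>)))
          \<Gamma> at_top)"

end

theory Submission
  imports Defs
begin

text \<open>
  The eigenvalues and, across a spectral gap and with the right choice of sign, the eigenvectors of
  a positive Hilbert--Schmidt operator are Lipschitz functions of the operator
  (\<open>eigenvalue_perturbation\<close>, \<open>eigenvector_perturbation\<close>).  Since these bounds hold pointwise in
  \<open>\<omega>\<close>, all three claims follow from the first one, with the same slowly varying function, and
  the first one is about the mean of i.i.d. elements \<open>Y\<^sub>n = X\<^sub>n \<otimes> X\<^sub>n\<close> of a Hilbert space.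

  As \<open>\<parallel>Y\<^sub>n\<parallel> = \<parallel>X\<^sub>n\<parallel>\<^sup>2\<close>, the tail \<open>H u = P(\<parallel>Y\<^sub>0\<parallel> > u)\<close> is regularly varying with index
  \<open>\<beta> = \<alpha> / 2 \<in> (1, 2)\<close>: the mean exists, the variance does not.  The natural size of the centered
  sum \<open>S\<^sub>N = \<Sum>n\<le>N. Y\<^sub>n - E Y\<^sub>0\<close> is therefore that of its largest term, the quantile \<open>q N\<close> with
  \<open>H (q N) \<approx> 1 / N\<close>, and the main estimate is \<open>E \<parallel>S\<^sub>N\<parallel>\<^sup>\<gamma> \<le> C (q N)\<^sup>\<gamma>\<close> for every \<open>\<gamma> < \<beta>\<close>
  and all large \<open>N\<close>.  The generalized inverse \<open>q\<close> of \<open>H\<close> is regularly varying with index \<open>1 / \<beta>\<close>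
  (\<open>quantile_ratio\<close>), so \<open>L x = (x\<^bsup>1/\<beta>\<^esup> / q x)\<^sup>\<gamma>\<close> is slowly varying, and it turns the estimate
  into the rate \<open>N\<^bsup>\<gamma>(1 - 1/\<beta>)\<^esup>\<close> for \<open>S\<^sub>N / N\<close>.

  For the main estimate (\<open>truncation_moment_bound\<close>) it suffices to take \<open>\<gamma> = p \<in> (1, \<beta>)\<close>.
  Cut each \<open>Y\<^sub>n\<close> at the level \<open>b = 2 q N\<close>.  The bounded parts are controlled by their variance.
  The parts above \<open>b\<close> are so rare that the expected sum of their norms is at most of order \<open>b\<close>,
  and an elementary inequality (\<open>powr_sum_le\<close>) bounds the \<open>p\<close>-th moment of such a sum using only
  pairwise independence.  The moments that enter are those of a truncated regularly varying
  variable: \<open>E[Z\<^sup>2; Z \<le> b]\<close> is of order \<open>b\<^sup>2 H b\<close> because \<open>\<beta> < 2\<close>, and \<open>E[Z\<^sup>q; Z > b]\<close> is of order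
  \<open>b\<^sup>q H b\<close> for \<open>q < \<beta>\<close>.  Both come from comparing \<open>H (2 u)\<close> with \<open>H u\<close>.
\<close>

section \<open>Regularly varying tails and their quantiles\<close>

text \<open>
  The tail of a nonnegative random variable, with the slowly varying factor eliminated: regular
  variation only enters through the limits of \<open>H (c * u) / H u\<close>.
\<close>

locale regularly_varying_tail =
  fixes H :: "real \<Rightarrow> real" and \<beta> :: real
  assumes index_pos: "0 < \<beta>"
    and antimono: "\<And>u v. u \<le> v \<Longrightarrow> H v \<le> H u"
    and pos: "\<And>u. 0 < H u"
    and vanishes: "(H \<longlongrightarrow> 0) at_top"
    and ratio: "\<And>c. 0 < c \<Longrightarrow> ((\<lambda>u. H (c * u) / H u) \<longlongrightarrow> c powr - \<beta>) at_top"
begin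

text \<open>
  The generalized inverse of \<open>H\<close> at \<open>1 / x\<close>.  As \<open>H\<close> need not be right-continuous here, the infimum
  may fail to be attained, which is why a factor greater than 1 is kept in front of \<open>quantile x\<close>
  wherever \<open>H\<close> is evaluated there.
\<close>

definition quantile :: "real \<Rightarrow> real" where
  "quantile x = Inf {u. 0 \<le> u \<and> H u \<le> 1 / x}"

lemma level_attained:
  assumes "0 < x"
  shows "\<exists>u. 0 \<le> u \<and> H u \<le> 1 / x"
proof -
  have "\<forall>\<^sub>F u in at_top. H u < 1 / x"
    using order_tendstoD(2)[OF vanishes, of "1 / x"] assms by simp
  then have "\<forall>\<^sub>F u in at_top. 0 \<le> u \<and> H u \<le> 1 / x"
    using eventually_ge_at_top[of 0] by eventually_elim auto
  then show ?thesis
    using eventually_happens[of _ "at_top :: real filter"] by fastforce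
qed

lemma quantile_le: "0 \<le> u \<Longrightarrow> H u \<le> 1 / x \<Longrightarrow> quantile x \<le> u"
  unfolding quantile_def by (rule cInf_lower) (auto intro: bdd_belowI[of _ 0])

lemma le_quantile: "0 < x \<Longrightarrow> (\<And>u. 0 \<le> u \<Longrightarrow> H u \<le> 1 / x \<Longrightarrow> K \<le> u) \<Longrightarrow> K \<le> quantile x"
  unfolding quantile_def using level_attained[of x] by (intro cInf_greatest) auto

lemma tail_above_quantile:
  assumes "0 < x" "quantile x < v"
  shows "H v \<le> 1 / x"
proof -
  have "\<exists>u\<in>{u. 0 \<le> u \<and> H u \<le> 1 / x}. u < v"
    using assms level_attained[of x] unfolding quantile_def
    by (subst (asm) cInf_less_iff) (auto intro: bdd_belowI[of _ 0])
  then obtain u where "H u \<le> 1 / x" "u < v" by blast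
  then show ?thesis using antimono[of u v] by linarith
qed

lemma quantile_mono: "mono_on {0<..} quantile"
proof (rule mono_onI)
  fix x y :: real assume *: "x \<in> {0<..}" "y \<in> {0<..}" "x \<le> y"
  show "quantile x \<le> quantile y"
  proof (rule le_quantile)
    fix u assume u: "0 \<le> u" "H u \<le> 1 / y"
    have "1 / y \<le> 1 / x" using * by (simp add: frac_le)
    with u show "quantile x \<le> u" by (intro quantile_le) linarith+
  qed (use * in auto)
qed

lemma quantile_at_top: "filterlim quantile at_top at_top"
  unfolding filterlim_at_top
proof
  fix K :: real
  show "\<forall>\<^sub>F x in at_top. K \<le> quantile x"
    using eventually_gt_at_top[of "1 / H K"] eventually_gt_at_top[of 0]
  proof eventually_elim
    case (elim x)
    show ?case
    proof (rule le_quantile[OF elim(2)])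
      fix u assume "H u \<le> 1 / x"
      also have "1 / x < H K" using elim pos[of K] by (simp add: field_simps)
      finally show "K \<le> u" using antimono[of u K] by linarith
    qed
  qed
qed

text \<open>
  One half of the regular variation of the quantile.  If \<open>u\<close> is large and slightly above \<open>quantile x\<close>, then
  \<open>H u \<le> 1 / x\<close>, and multiplying \<open>u\<close> by \<open>s > c\<^bsup>1/\<beta>\<^esup>\<close> lowers \<open>H\<close> by a factor below \<open>1 / c\<close>.  So
  \<open>s * u\<close> is already beyond the level \<open>1 / (c * x)\<close>.
\<close>

lemma quantile_scale_le:
  assumes c: "0 < c" and r: "c powr (1 / \<beta>) < r"
  shows "\<forall>\<^sub>F x in at_top. quantile (c * x) \<le> r * quantile x"
proof -
  obtain s where s: "c powr (1 / \<beta>) < s" "s < r" using dense[OF r] by auto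
  have s0: "0 < s" using s(1) by (meson le_less_trans powr_ge_zero)
  define t where "t = r / s"
  have t: "1 < t" "r = s * t" using s s0 by (auto simp: t_def)
  have "c = (c powr (1 / \<beta>)) powr \<beta>" using c index_pos by (simp add: powr_powr)
  also have "\<dots> < s powr \<beta>" using s index_pos by (intro powr_less_mono2) auto
  finally have "s powr - \<beta> < 1 / c" using c s0 by (simp add: powr_minus field_simps)
  from order_tendstoD(2)[OF ratio[OF s0] this]
  have ev: "\<forall>\<^sub>F u in at_top. H (s * u) / H u < 1 / c" .
  have "filterlim (\<lambda>x. t * quantile x) at_top at_top"
    using t by (intro filterlim_tendsto_pos_mult_at_top[OF tendsto_const _ quantile_at_top]) auto
  from eventually_compose_filterlim[OF ev this]
  have "\<forall>\<^sub>F x in at_top. H (s * (t * quantile x)) / H (t * quantile x) < 1 / c" .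
  moreover have "\<forall>\<^sub>F x in at_top. 0 < quantile x"
    using quantile_at_top by (simp add: filterlim_at_top_dense)
  ultimately show ?thesis using eventually_gt_at_top[of 0]
  proof eventually_elim
    case (elim x)
    have "H (t * quantile x) \<le> 1 / x"
      using elim t by (intro tail_above_quantile) auto
    then have "H (s * (t * quantile x)) \<le> 1 / (c * x)"
      using elim pos[of "t * quantile x"] c
      by (simp add: field_simps) (smt (verit) mult_left_mono mult.commute mult.left_commute)
    then show ?case
      using elim s0 t by (intro quantile_le) (auto simp: mult.assoc)
  qed
qed

text \<open>
  The lower bound is the upper bound of \<open>quantile_scale_le\<close> for \<open>1 / c\<close> at the point \<open>c * x\<close>.
\<close>

lemma quantile_ratio:
  assumes c: "0 < c"
  shows "((\<lambda>x. quantile (c * x) / quantile x) \<longlongrightarrow> c powr (1 / \<beta>)) at_top"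
proof (rule order_tendstoI)
  have q0: "\<forall>\<^sub>F x in at_top. 0 < quantile x"
    using quantile_at_top by (simp add: filterlim_at_top_dense)
  {
    fix a assume "c powr (1 / \<beta>) < a"
    then obtain r where r: "c powr (1 / \<beta>) < r" "r < a" using dense by blast
    show "\<forall>\<^sub>F x in at_top. quantile (c * x) / quantile x < a"
      using quantile_scale_le[OF c r(1)] q0
    proof eventually_elim
      case (elim x)
      then have "quantile (c * x) / quantile x \<le> r" by (simp add: field_simps)
      then show ?case using r by simp
    qed
  }
  fix a assume "a < c powr (1 / \<beta>)"
  then have "max a 0 < c powr (1 / \<beta>)" using c by simp
  then obtain r where r: "max a 0 < r" "r < c powr (1 / \<beta>)" using dense by blast
  have "(1 / c) powr (1 / \<beta>) < 1 / r"
    using r c by (simp add: powr_divide field_simps)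
  then have "\<forall>\<^sub>F x in at_top. quantile (1 / c * x) \<le> 1 / r * quantile x"
    using c by (intro quantile_scale_le) auto
  moreover have "filterlim (\<lambda>x. c * x) at_top at_top"
    using c by (intro filterlim_tendsto_pos_mult_at_top[OF tendsto_const _ filterlim_ident]) auto
  ultimately have "\<forall>\<^sub>F x in at_top. quantile (1 / c * (c * x)) \<le> 1 / r * quantile (c * x)"
    by (rule eventually_compose_filterlim)
  then show "\<forall>\<^sub>F x in at_top. a < quantile (c * x) / quantile x"
    using q0
  proof eventually_elim
    case (elim x)
    then have "r \<le> quantile (c * x) / quantile x" using c r by (simp add: field_simps)
    then show ?case using r by simp
  qed
qed

lemma quantile_slowly_varying:
  "slowly_varying (\<lambda>x. (x powr (1 / \<beta>) / quantile x) powr \<gamma>)"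
  unfolding slowly_varying_def
proof (intro conjI allI impI)
  have "quantile \<in> borel_measurable (restrict_space borel {0<..})"
    by (rule borel_measurable_mono_on_fnc[OF quantile_mono])
  moreover have "(\<lambda>x. x) \<in> borel_measurable (restrict_space borel {(0::real)<..})"
    by (rule measurable_restrict_space1) simp
  ultimately show "(\<lambda>x. (x powr (1 / \<beta>) / quantile x) powr \<gamma>) \<in> borel_measurable (restrict_space borel {0<..})"
    by (intro powr_real_measurable borel_measurable_divide borel_measurable_const)
  have q0: "\<forall>\<^sub>F x in at_top. 0 < quantile x"
    using quantile_at_top by (simp add: filterlim_at_top_dense)
  show "\<forall>\<^sub>F x in at_top. 0 < (x powr (1 / \<beta>) / quantile x) powr \<gamma>"
    using q0 eventually_gt_at_top[of 0] by eventually_elim simp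
  fix c :: real assume c: "0 < c"
  have qc: "\<forall>\<^sub>F x in at_top. 0 < quantile (c * x)"
    using c by (intro eventually_compose_filterlim[OF q0]
      filterlim_tendsto_pos_mult_at_top[OF tendsto_const _ filterlim_ident]) auto
  have "((\<lambda>x. (c powr (1 / \<beta>) / (quantile (c * x) / quantile x)) powr \<gamma>) \<longlongrightarrow>
      (c powr (1 / \<beta>) / c powr (1 / \<beta>)) powr \<gamma>) at_top"
    using c by (intro tendsto_intros quantile_ratio) auto
  also have "(c powr (1 / \<beta>) / c powr (1 / \<beta>)) powr \<gamma> = 1" using c by simp
  finally show "((\<lambda>u. ((c * u) powr (1 / \<beta>) / quantile (c * u)) powr \<gamma> /
      (u powr (1 / \<beta>) / quantile u) powr \<gamma>) \<longlongrightarrow> 1) at_top"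
  proof (rule Lim_transform_eventually)
    show "\<forall>\<^sub>F x in at_top. (c powr (1 / \<beta>) / (quantile (c * x) / quantile x)) powr \<gamma> =
      ((c * x) powr (1 / \<beta>) / quantile (c * x)) powr \<gamma> / (x powr (1 / \<beta>) / quantile x) powr \<gamma>"
      using q0 qc eventually_gt_at_top[of 0]
    proof eventually_elim
      case (elim x)
      have "(c * x) powr (1 / \<beta>) / quantile (c * x) =
          c powr (1 / \<beta>) / (quantile (c * x) / quantile x) * (x powr (1 / \<beta>) / quantile x)"
        using elim c by (simp add: powr_mult)
      then show ?case
        using elim c by (simp only: powr_mult) simp
    qed
  qed
qed

end

section \<open>Truncated moments of a regularly varying variable\<close>

locale regularly_varying_variable = prob_space M + regularly_varying_tail H \<beta>
  for M :: "'w measure" and Z :: "'w \<Rightarrow> real" and H :: "real \<Rightarrow> real" and \<beta> :: real +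
  assumes measurable_Z [measurable]: "Z \<in> borel_measurable M"
    and nonneg: "\<And>\<omega>. 0 \<le> Z \<omega>"
    and tail: "\<And>u. H u = measure M {\<omega> \<in> space M. u < Z \<omega>}"
begin

text \<open>
  The following two bounds are all that the moment estimates use of regular variation: along
  \<open>u, 2 * u, 4 * u, \<dots>\<close> the tail decays geometrically, with a ratio as close to \<open>2\<^bsup>-\<beta>\<^esup>\<close> as desired.
\<close>

lemma doubling_upper:
  assumes "2 powr - \<beta> < \<rho>"
  shows "\<exists>u0>0. \<forall>u\<ge>u0. H (2 * u) \<le> \<rho> * H u"
proof -
  have "\<forall>\<^sub>F u in at_top. H (2 * u) / H u < \<rho>"
    using order_tendstoD(2)[OF ratio[of 2] assms] by simp
  then obtain u1 where u1: "\<And>u. u1 \<le> u \<Longrightarrow> H (2 * u) / H u < \<rho>"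
    by (auto simp: eventually_at_top_linorder)
  have "H (2 * u) \<le> \<rho> * H u" if "max u1 1 \<le> u" for u
    using u1[of u] that pos[of u] by (simp add: field_simps less_imp_le)
  then show ?thesis by (intro exI[of _ "max u1 1"]) auto
qed

lemma doubling_lower:
  assumes "2 powr \<beta> < \<sigma>"
  shows "\<exists>u0>0. \<forall>u\<ge>u0. H u \<le> \<sigma> * H (2 * u)"
proof -
  have \<sigma>: "0 < \<sigma>" using assms by (meson le_less_trans powr_ge_zero)
  then have "1 / \<sigma> < 2 powr - \<beta>" using assms by (simp add: powr_minus field_simps)
  then have "\<forall>\<^sub>F u in at_top. 1 / \<sigma> < H (2 * u) / H u"
    using order_tendstoD(1)[OF ratio[of 2]] by simp
  then obtain u1 where u1: "\<And>u. u1 \<le> u \<Longrightarrow> 1 / \<sigma> < H (2 * u) / H u"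
    by (auto simp: eventually_at_top_linorder)
  have "H u \<le> \<sigma> * H (2 * u)" if "max u1 1 \<le> u" for u
    using u1[of u] that pos[of u] \<sigma> by (simp add: field_simps less_imp_le)
  then show ?thesis by (intro exI[of _ "max u1 1"]) auto
qed

text \<open>
  Going from \<open>b\<close> to \<open>2 * b\<close> costs at most \<open>(2 * b)\<^sup>q H b\<close>, while the bound assumed at \<open>2 * b\<close> is
  at most \<open>2\<^sup>q \<rho> < 1\<close> times the one claimed at \<open>b\<close>.  The constant is the fixed point
  \<open>K = 2\<^sup>q + K * 2\<^sup>q \<rho>\<close> of this recursion, so that it does not grow with \<open>n\<close>.
\<close>

lemma dyadic_moment_le:
  assumes q: "0 < q" and \<rho>: "0 \<le> \<rho>" "2 powr q * \<rho> < 1"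
    and u0: "0 < u0" "\<And>u. u0 \<le> u \<Longrightarrow> H (2 * u) \<le> \<rho> * H u" and b: "u0 \<le> b"
  shows "(\<integral>\<^sup>+\<omega>. ennreal (Z \<omega> powr q * indicator {b<..2 ^ n * b} (Z \<omega>)) \<partial>M)
    \<le> ennreal (2 powr q / (1 - 2 powr q * \<rho>) * (b powr q * H b))"
  using b
proof (induction n arbitrary: b)
  case 0
  then show ?case by simp
next
  case (Suc n)
  define K where "K = 2 powr q / (1 - 2 powr q * \<rho>)"
  have K: "0 < K" "2 powr q + K * (2 powr q * \<rho>) = K"
    using \<rho> by (simp_all add: K_def field_simps)
  have b: "0 < b" "u0 \<le> 2 * b" using Suc.prems u0 by auto
  have "(\<integral>\<^sup>+\<omega>. ennreal (Z \<omega> powr q * indicator {b<..2 ^ Suc n * b} (Z \<omega>)) \<partial>M) \<le>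
      (\<integral>\<^sup>+\<omega>. ennreal ((2 * b) powr q) * indicator {\<omega> \<in> space M. b < Z \<omega>} \<omega> +
        ennreal (Z \<omega> powr q * indicator {2 * b<..2 ^ n * (2 * b)} (Z \<omega>)) \<partial>M)"
  proof (rule nn_integral_mono)
    fix \<omega> assume \<omega>: "\<omega> \<in> space M"
    have "Z \<omega> powr q \<le> (2 * b) powr q" if "Z \<omega> \<le> 2 * b"
      using that nonneg q by (intro powr_mono2) auto
    then show "ennreal (Z \<omega> powr q * indicator {b<..2 ^ Suc n * b} (Z \<omega>)) \<le>
        ennreal ((2 * b) powr q) * indicator {\<omega> \<in> space M. b < Z \<omega>} \<omega> +
        ennreal (Z \<omega> powr q * indicator {2 * b<..2 ^ n * (2 * b)} (Z \<omega>))"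
      using \<omega> by (auto simp: indicator_def mult.assoc mult.left_commute intro!: ennreal_leI)
  qed
  also have "\<dots> = ennreal ((2 * b) powr q) * ennreal (H b) +
      (\<integral>\<^sup>+\<omega>. ennreal (Z \<omega> powr q * indicator {2 * b<..2 ^ n * (2 * b)} (Z \<omega>)) \<partial>M)"
    by (subst nn_integral_add) (auto simp: nn_integral_cmult_indicator tail emeasure_eq_measure)
  also have "\<dots> \<le> ennreal ((2 * b) powr q) * ennreal (H b) + ennreal (K * ((2 * b) powr q * H (2 * b)))"
    using Suc.IH[OF b(2)] by (intro add_left_mono) (simp add: K_def)
  also have "\<dots> = ennreal ((2 * b) powr q * H b + K * ((2 * b) powr q * H (2 * b)))"
    using K pos less_imp_le[OF pos] by (simp add: ennreal_mult ennreal_plus)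
  also have "\<dots> \<le> ennreal ((2 * b) powr q * H b + K * ((2 * b) powr q * (\<rho> * H b)))"
    using u0(2)[OF Suc.prems] K by (intro ennreal_leI add_left_mono mult_left_mono) auto
  also have "(2 * b) powr q * H b + K * ((2 * b) powr q * (\<rho> * H b)) =
      (2 powr q + K * (2 powr q * \<rho>)) * (b powr q * H b)"
    using b by (simp add: powr_mult algebra_simps)
  finally show ?case unfolding K(2) by (simp add: K_def)
qed

lemma tail_moment_le:
  assumes q: "0 < q" "q < \<beta>"
  shows "\<exists>K\<ge>0. \<exists>u0>0. \<forall>b\<ge>u0.
    (\<integral>\<^sup>+\<omega>. ennreal (Z \<omega> powr q * indicator {b<..} (Z \<omega>)) \<partial>M) \<le> ennreal (K * (b powr q * H b))"
proof -
  obtain \<rho> where \<rho>: "2 powr - \<beta> < \<rho>" "\<rho> < 2 powr - q"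
    using dense[of "2 powr - \<beta>" "2 powr - q"] q by auto
  have \<rho>0: "0 \<le> \<rho>" using \<rho>(1) by (meson less_imp_le le_less_trans powr_ge_zero)
  have \<rho>1: "2 powr q * \<rho> < 1" using \<rho>(2) by (simp add: powr_minus field_simps)
  obtain u0 where u0: "0 < u0" "\<And>u. u0 \<le> u \<Longrightarrow> H (2 * u) \<le> \<rho> * H u"
    using doubling_upper[OF \<rho>(1)] by blast
  define K where "K = 2 powr q / (1 - 2 powr q * \<rho>)"
  have "(\<integral>\<^sup>+\<omega>. ennreal (Z \<omega> powr q * indicator {b<..} (Z \<omega>)) \<partial>M) \<le> ennreal (K * (b powr q * H b))"
    if b: "u0 \<le> b" for b
  proof -
    define f where "f n \<omega> = ennreal (Z \<omega> powr q * indicator {b<..2 ^ n * b} (Z \<omega>))" for n and \<omega>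
    have b0: "0 < b" using b u0 by simp
    have "2 ^ m * b \<le> 2 ^ n * b" if "m \<le> n" for m n :: nat
      using that b0 by (simp add: power_increasing)
    then have inc: "incseq f"
      by (auto simp: f_def incseq_def le_fun_def indicator_def intro!: ennreal_leI)
        (meson order_trans)
    have "(\<integral>\<^sup>+\<omega>. ennreal (Z \<omega> powr q * indicator {b<..} (Z \<omega>)) \<partial>M) \<le> (\<integral>\<^sup>+\<omega>. (SUP n. f n \<omega>) \<partial>M)"
    proof (rule nn_integral_mono)
      fix \<omega>
      obtain n where "Z \<omega> / b < 2 ^ n" using real_arch_pow[of 2 "Z \<omega> / b"] by auto
      then have "Z \<omega> \<le> 2 ^ n * b" using b0 by (simp add: field_simps)
      then have "ennreal (Z \<omega> powr q * indicator {b<..} (Z \<omega>)) = f n \<omega>"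
        by (simp add: f_def indicator_def)
      also have "\<dots> \<le> (SUP n. f n \<omega>)" by (rule SUP_upper) simp
      finally show "ennreal (Z \<omega> powr q * indicator {b<..} (Z \<omega>)) \<le> (SUP n. f n \<omega>)" .
    qed
    also have "\<dots> = (SUP n. \<integral>\<^sup>+\<omega>. f n \<omega> \<partial>M)"
      by (rule nn_integral_monotone_convergence_SUP[OF inc]) (simp add: f_def[abs_def])
    also have "\<dots> \<le> ennreal (K * (b powr q * H b))"
      unfolding f_def K_def
      by (intro SUP_least dyadic_moment_le[OF q(1) \<rho>0 \<rho>1 u0 b])
    finally show ?thesis .
  qed
  moreover have "0 \<le> K" using \<rho>1 by (simp add: K_def)
  ultimately show ?thesis using u0(1) by blast
qed

text \<open>
  The recursion now runs upwards: going from \<open>b / 2\<close> to \<open>b\<close> adds at most \<open>b\<^sup>2 H (b / 2)\<close>, and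
  \<open>H (b / 2) \<le> \<sigma> H b\<close> with \<open>\<sigma> < 4\<close>, so that \<open>b\<^sup>2 H b\<close> grows by at least the factor \<open>4 / \<sigma> > 1\<close> at each
  doubling and dominates what was there before.
\<close>

lemma truncated_second_moment_le:
  assumes "\<beta> < 2"
  shows "\<exists>K\<ge>0. \<exists>u0>0. \<forall>b\<ge>u0. (\<integral>\<omega>. (Z \<omega>)\<^sup>2 * indicator {..b} (Z \<omega>) \<partial>M) \<le> K * (b\<^sup>2 * H b)"
proof -
  define m where "m b = (\<integral>\<omega>. (Z \<omega>)\<^sup>2 * indicator {..b} (Z \<omega>) \<partial>M)" for b
  have "2 powr \<beta> < (2::real) powr 2" using assms by (intro powr_less_mono) auto
  then have "2 powr \<beta> < 4" by simp
  then obtain \<sigma> where \<sigma>: "2 powr \<beta> < \<sigma>" "\<sigma> < 4" using dense by blast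
  have \<sigma>0: "0 < \<sigma>" using \<sigma>(1) by (meson le_less_trans powr_ge_zero)
  obtain u0 where u0: "0 < u0" "\<And>u. u0 \<le> u \<Longrightarrow> H u \<le> \<sigma> * H (2 * u)"
    using doubling_lower[OF \<sigma>(1)] by blast
  have sq: "(Z \<omega>)\<^sup>2 * indicator {..b} (Z \<omega>) \<le> b\<^sup>2" for \<omega> b
    using nonneg[of \<omega>] by (auto simp: indicator_def intro!: power_mono)
  have int: "integrable M (\<lambda>\<omega>. (Z \<omega>)\<^sup>2 * indicator {..b} (Z \<omega>))" for b
    by (rule integrable_const_bound[of _ "b\<^sup>2"]) (use sq in auto)
  have m_le: "m b \<le> b\<^sup>2" for b
    unfolding m_def using integral_mono[OF int integrable_const sq] by (simp add: prob_space)
  \<comment> \<open>The first entry makes the recursion close, the second one covers the initial range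
    \<open>u0 \<le> b \<le> 2 * u0\<close>, where the moment is at most \<open>b\<^sup>2\<close>.\<close>
  define K where "K = max (4 * \<sigma> / (4 - \<sigma>)) (1 / H (2 * u0))"
  have K: "0 \<le> K" "1 \<le> K * H (2 * u0)" "(K / 4 + 1) * \<sigma> \<le> K"
  proof -
    show "0 \<le> K" unfolding K_def using pos[of "2 * u0"] by (intro max.coboundedI2) simp
    have "1 / H (2 * u0) \<le> K" by (simp add: K_def)
    then show "1 \<le> K * H (2 * u0)" using pos[of "2 * u0"] by (simp add: field_simps)
    have "4 * \<sigma> / (4 - \<sigma>) \<le> K" by (simp add: K_def)
    then have "4 * \<sigma> \<le> K * (4 - \<sigma>)" using \<sigma> by (simp add: field_simps)
    then show "(K / 4 + 1) * \<sigma> \<le> K" by (simp add: algebra_simps)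
  qed
  have step: "m b \<le> m (b / 2) + b\<^sup>2 * H (b / 2)" if "0 < b" for b
  proof -
    have "m b \<le> (\<integral>\<omega>. (Z \<omega>)\<^sup>2 * indicator {..b / 2} (Z \<omega>) + b\<^sup>2 * indicator {\<omega> \<in> space M. b / 2 < Z \<omega>} \<omega> \<partial>M)"
      unfolding m_def
    proof (intro integral_mono Bochner_Integration.integrable_add int)
      fix \<omega> assume "\<omega> \<in> space M"
      then show "(Z \<omega>)\<^sup>2 * indicator {..b} (Z \<omega>) \<le>
          (Z \<omega>)\<^sup>2 * indicator {..b / 2} (Z \<omega>) + b\<^sup>2 * indicator {\<omega> \<in> space M. b / 2 < Z \<omega>} \<omega>"
        using nonneg[of \<omega>] that by (auto simp: indicator_def intro!: power_mono)
    qed (auto intro!: integrable_mult_right integrable_real_indicator simp: emeasure_eq_measure)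
    also have "\<dots> = m (b / 2) + b\<^sup>2 * H (b / 2)"
      unfolding m_def by (subst Bochner_Integration.integral_add[OF int])
        (auto simp: tail emeasure_eq_measure)
    finally show ?thesis .
  qed
  have main: "m b \<le> K * (b\<^sup>2 * H b)" if "u0 \<le> b" "b \<le> 2 ^ n * (2 * u0)" for n b
    using that
  proof (induction n arbitrary: b)
    case 0
    have "m b \<le> b\<^sup>2 * 1" using m_le[of b] by simp
    also have "\<dots> \<le> b\<^sup>2 * (K * H (2 * u0))" by (intro mult_left_mono K) simp
    also have "\<dots> \<le> b\<^sup>2 * (K * H b)"
      using 0 K antimono[of b "2 * u0"] by (intro mult_left_mono) auto
    finally show ?case by (simp add: algebra_simps)
  next
    case (Suc n)
    show ?case
    proof (cases "b \<le> 2 * u0")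
      case True
      then have "b \<le> 2 ^ n * (2 * u0)"
        using u0 by (intro order_trans[OF True]) simp
      then show ?thesis using Suc by simp
    next
      case False
      then have b: "u0 \<le> b / 2" "b / 2 \<le> 2 ^ n * (2 * u0)" "0 < b" using Suc.prems u0 by auto
      have "m b \<le> K * ((b / 2)\<^sup>2 * H (b / 2)) + b\<^sup>2 * H (b / 2)"
        using step[OF b(3)] Suc.IH[OF b(1,2)] by simp
      also have "\<dots> = (K / 4 + 1) * b\<^sup>2 * H (b / 2)"
        by (simp add: power_divide algebra_simps)
      also have "\<dots> \<le> (K / 4 + 1) * b\<^sup>2 * (\<sigma> * H b)"
        using u0(2)[OF b(1)] K by (intro mult_left_mono) auto
      also have "\<dots> = ((K / 4 + 1) * \<sigma>) * (b\<^sup>2 * H b)" by simp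
      also have "\<dots> \<le> K * (b\<^sup>2 * H b)"
        using K less_imp_le[OF pos] by (intro mult_right_mono) auto
      finally show ?thesis .
    qed
  qed
  have "m b \<le> K * (b\<^sup>2 * H b)" if b: "u0 \<le> b" for b
  proof -
    obtain n where "b / (2 * u0) < 2 ^ n" using real_arch_pow[of 2 "b / (2 * u0)"] by auto
    then have "b \<le> 2 ^ n * (2 * u0)" using u0 by (simp add: field_simps)
    with b show ?thesis by (rule main)
  qed
  then show ?thesis unfolding m_def using K u0 by blast
qed

lemma integrable_powr:
  assumes q: "0 < q" "q < \<beta>"
  shows "integrable M (\<lambda>\<omega>. Z \<omega> powr q)"
proof -
  obtain K u0 where K: "0 \<le> K" "0 < u0"
    "(\<integral>\<^sup>+\<omega>. ennreal (Z \<omega> powr q * indicator {u0<..} (Z \<omega>)) \<partial>M) \<le> ennreal (K * (u0 powr q * H u0))"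
    using tail_moment_le[OF q] by blast
  have "(\<integral>\<^sup>+\<omega>. ennreal (Z \<omega> powr q) \<partial>M) \<le>
      (\<integral>\<^sup>+\<omega>. ennreal (u0 powr q) + ennreal (Z \<omega> powr q * indicator {u0<..} (Z \<omega>)) \<partial>M)"
  proof (rule nn_integral_mono)
    fix \<omega>
    have "Z \<omega> powr q \<le> u0 powr q" if "Z \<omega> \<le> u0"
      using that nonneg q by (intro powr_mono2) auto
    then show "ennreal (Z \<omega> powr q) \<le> ennreal (u0 powr q) + ennreal (Z \<omega> powr q * indicator {u0<..} (Z \<omega>))"
      by (auto simp: indicator_def intro!: ennreal_leI)
  qed
  also have "\<dots> = ennreal (u0 powr q) + (\<integral>\<^sup>+\<omega>. ennreal (Z \<omega> powr q * indicator {u0<..} (Z \<omega>)) \<partial>M)"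
    by (subst nn_integral_add) (auto simp: emeasure_space_1)
  also have "\<dots> < \<infinity>" using le_less_trans[OF K(3) ennreal_less_top] by (simp add: less_top[symmetric])
  finally show ?thesis by (intro integrableI_nonneg) auto
qed

text \<open>
  At the level \<open>2 * quantile N\<close> the factor \<open>H b\<close> of the truncated moments is at most \<open>1 / N\<close>.
\<close>

lemma eventually_quantile_moments:
  shows "\<And>q. 0 < q \<Longrightarrow> q < \<beta> \<Longrightarrow> \<exists>K\<ge>0. \<forall>\<^sub>F N in sequentially.
      real N * (\<integral>\<omega>. Z \<omega> powr q * indicator {2 * quantile (real N)<..} (Z \<omega>) \<partial>M)
        \<le> K * (2 * quantile (real N)) powr q"
    and "\<beta> < 2 \<Longrightarrow> \<exists>K\<ge>0. \<forall>\<^sub>F N in sequentially.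
      real N * (\<integral>\<omega>. (Z \<omega>)\<^sup>2 * indicator {..2 * quantile (real N)} (Z \<omega>) \<partial>M)
        \<le> K * (2 * quantile (real N))\<^sup>2"
proof -
  define b where "b N = 2 * quantile (real N)" for N :: nat
  have q: "filterlim (\<lambda>N::nat. quantile (real N)) at_top sequentially"
    by (rule filterlim_compose[OF quantile_at_top filterlim_real_sequentially])
  have b: "\<forall>\<^sub>F N in sequentially. 0 < N \<and> u0 \<le> b N \<and> N * H (b N) \<le> 1" if "0 < u0" for u0
    using filterlim_at_top[THEN iffD1, OF q, rule_format, of u0] eventually_gt_at_top[of 0]
  proof eventually_elim
    case (elim N)
    then have "H (b N) \<le> 1 / N" using that by (intro tail_above_quantile) (auto simp: b_def)
    then show ?case using elim that by (auto simp: b_def field_simps)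
  qed
  have scale: "real N * I \<le> K * y"
    if "0 < N" "real N * h \<le> 1" "I \<le> K * (y * h)" "0 \<le> K" "0 \<le> y" for N :: nat and h I K y :: real
  proof -
    have "real N * I \<le> real N * (K * (y * h))" using that by (intro mult_left_mono) auto
    also have "\<dots> = K * y * (real N * h)" by simp
    also have "\<dots> \<le> K * y * 1" using that by (intro mult_left_mono) auto
    finally show ?thesis by simp
  qed
  {
    fix q assume q: "0 < q" "q < \<beta>"
    obtain K u0 where K: "0 \<le> K" "0 < u0" "\<And>b. u0 \<le> b \<Longrightarrow>
        (\<integral>\<^sup>+\<omega>. ennreal (Z \<omega> powr q * indicator {b<..} (Z \<omega>)) \<partial>M) \<le> ennreal (K * (b powr q * H b))"
      using tail_moment_le[OF q] by blast
    have int: "integrable M (\<lambda>\<omega>. Z \<omega> powr q * indicator {u<..} (Z \<omega>))" for u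
      by (rule Bochner_Integration.integrable_bound[OF integrable_powr[OF q]]) (auto simp: indicator_def)
    have le: "(\<integral>\<omega>. Z \<omega> powr q * indicator {u<..} (Z \<omega>) \<partial>M) \<le> K * (u powr q * H u)" if "u0 \<le> u" for u
      using K(3)[OF that] K(1) less_imp_le[OF pos] int[of u]
      by (subst (asm) nn_integral_eq_integral) auto
    have "\<forall>\<^sub>F N in sequentially. real N * (\<integral>\<omega>. Z \<omega> powr q * indicator {b N<..} (Z \<omega>) \<partial>M) \<le> K * b N powr q"
      using b[OF K(2)]
    proof eventually_elim
      case (elim N)
      then show ?case using le[of "b N"] K(1) by (intro scale[of N "H (b N)"]) auto
    qed
    then show "\<exists>K\<ge>0. \<forall>\<^sub>F N in sequentially.
      real N * (\<integral>\<omega>. Z \<omega> powr q * indicator {2 * quantile (real N)<..} (Z \<omega>) \<partial>M)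
        \<le> K * (2 * quantile (real N)) powr q"
      using K(1) unfolding b_def by blast
  }
  assume "\<beta> < 2"
  then obtain K u0 where K: "0 \<le> K" "0 < u0" "\<And>b. u0 \<le> b \<Longrightarrow>
      (\<integral>\<omega>. (Z \<omega>)\<^sup>2 * indicator {..b} (Z \<omega>) \<partial>M) \<le> K * (b\<^sup>2 * H b)"
    using truncated_second_moment_le by blast
  have "\<forall>\<^sub>F N in sequentially. real N * (\<integral>\<omega>. (Z \<omega>)\<^sup>2 * indicator {..b N} (Z \<omega>) \<partial>M) \<le> K * (b N)\<^sup>2"
    using b[OF K(2)]
  proof eventually_elim
    case (elim N)
    then show ?case using K(3)[of "b N"] K(1) by (intro scale[of N "H (b N)"]) auto
  qed
  then show "\<exists>K\<ge>0. \<forall>\<^sub>F N in sequentially.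
      real N * (\<integral>\<omega>. (Z \<omega>)\<^sup>2 * indicator {..2 * quantile (real N)} (Z \<omega>) \<partial>M)
        \<le> K * (2 * quantile (real N))\<^sup>2"
    using K(1) unfolding b_def by blast
qed

end

section \<open>Independent elements of a Hilbert space\<close>

lemma (in prob_space) indep_vars_imp_indep_var:
  assumes X: "indep_vars N X I" and ij: "i \<in> I" "j \<in> I" "i \<noteq> j"
  shows "indep_var (N i) (X i) (N j) (X j)"
  unfolding indep_var_eq indep_sets2_eq
proof (intro conjI ballI)
  have "\<And>k. k \<in> I \<Longrightarrow> random_variable (N k) (X k)"
    and *: "indep_sets (\<lambda>k. sigma_sets (space M) {X k -` A \<inter> space M |A. A \<in> sets (N k)}) I"
    using X by (auto simp: indep_vars_def)
  then show "random_variable (N i) (X i)" "random_variable (N j) (X j)"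
    using ij by auto
  show "sigma_sets (space M) {X i -` A \<inter> space M |A. A \<in> sets (N i)} \<subseteq> events"
    "sigma_sets (space M) {X j -` A \<inter> space M |A. A \<in> sets (N j)} \<subseteq> events"
    using * ij by (auto simp: indep_sets_def)
  fix a b
  assume "a \<in> sigma_sets (space M) {X i -` A \<inter> space M |A. A \<in> sets (N i)}"
    "b \<in> sigma_sets (space M) {X j -` A \<inter> space M |A. A \<in> sets (N j)}"
  then show "prob (a \<inter> b) = prob a * prob b"
    using indep_setsD[OF *, of "{i, j}" "\<lambda>k. if k = i then a else b"] ij by (simp add: Int_commute)
qed

text \<open>
  By independence the joint law is a product measure, and the inner product can be integrated in
  each argument separately.
\<close>

lemma (in prob_space) indep_var_integral_inner:
  fixes A B :: "'a \<Rightarrow> 'h::separable_hilbert_space"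
  assumes ind: "indep_var borel A borel B" and int: "integrable M A" "integrable M B"
  shows "integrable M (\<lambda>\<omega>. inner (A \<omega>) (B \<omega>))"
    and "(\<integral>\<omega>. inner (A \<omega>) (B \<omega>) \<partial>M) = inner (\<integral>\<omega>. A \<omega> \<partial>M) (\<integral>\<omega>. B \<omega> \<partial>M)"
proof -
  have [measurable]: "A \<in> borel_measurable M" "B \<in> borel_measurable M"
    using int by auto
  have "indep_var borel (norm \<circ> A) borel (norm \<circ> B)"
    by (rule indep_var_compose[OF ind]) auto
  then have "integrable M (\<lambda>\<omega>. (norm \<circ> A) \<omega> * (norm \<circ> B) \<omega>)"
    using int by (intro indep_var_integrable) (auto simp: o_def)
  then show "integrable M (\<lambda>\<omega>. inner (A \<omega>) (B \<omega>))"
    by (rule Bochner_Integration.integrable_bound) (auto simp: Cauchy_Schwarz_ineq2)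
  interpret A: prob_space "distr M borel A" by (rule prob_space_distr) simp
  interpret B: prob_space "distr M borel B" by (rule prob_space_distr) simp
  interpret P: pair_prob_space "distr M borel A" "distr M borel B" ..
  have dist: "distr M borel A \<Otimes>\<^sub>M distr M borel B = distr M (borel \<Otimes>\<^sub>M borel) (\<lambda>\<omega>. (A \<omega>, B \<omega>))"
    using ind by (simp add: indep_var_distribution_eq)
  have meas: "(\<lambda>p :: 'h \<times> 'h. inner (fst p) (snd p)) \<in> borel_measurable (borel \<Otimes>\<^sub>M borel)"
    by measurable
  have intA: "integrable (distr M borel A) (\<lambda>x. x)" and intB: "integrable (distr M borel B) (\<lambda>x. x)"
    using int by (simp_all add: integrable_distr_eq)
  have pint: "integrable (distr M borel A \<Otimes>\<^sub>M distr M borel B) (\<lambda>p. inner (fst p) (snd p))"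
    unfolding dist using \<open>integrable M (\<lambda>\<omega>. inner (A \<omega>) (B \<omega>))\<close> meas
    by (subst integrable_distr_eq) auto
  have "(\<integral>\<omega>. inner (A \<omega>) (B \<omega>) \<partial>M) =
      (\<integral>p. inner (fst p) (snd p) \<partial>(distr M borel A \<Otimes>\<^sub>M distr M borel B))"
    unfolding dist by (subst integral_distr[OF _ meas]) auto
  also have "\<dots> = (\<integral>x. (\<integral>y. inner x y \<partial>distr M borel B) \<partial>distr M borel A)"
    using P.integral_fst'[OF pint] by simp
  also have "\<dots> = (\<integral>x. inner x (\<integral>y. y \<partial>distr M borel B) \<partial>distr M borel A)"
    using intB by simp
  also have "\<dots> = inner (\<integral>x. x \<partial>distr M borel A) (\<integral>y. y \<partial>distr M borel B)"
    using intA by simp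
  also have "\<dots> = inner (\<integral>\<omega>. A \<omega> \<partial>M) (\<integral>\<omega>. B \<omega> \<partial>M)"
    by (simp add: integral_distr)
  finally show "(\<integral>\<omega>. inner (A \<omega>) (B \<omega>) \<partial>M) = inner (\<integral>\<omega>. A \<omega> \<partial>M) (\<integral>\<omega>. B \<omega> \<partial>M)" .
qed

lemma (in prob_space) second_moment_centered_sum:
  fixes A :: "'i \<Rightarrow> 'a \<Rightarrow> 'h::separable_hilbert_space"
  assumes I: "finite I" and int: "\<And>i. i \<in> I \<Longrightarrow> integrable M (A i)"
    and sq: "\<And>i. i \<in> I \<Longrightarrow> integrable M (\<lambda>\<omega>. (norm (A i \<omega>))\<^sup>2)"
    and zero: "\<And>i. i \<in> I \<Longrightarrow> (\<integral>\<omega>. A i \<omega> \<partial>M) = 0"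
    and ind: "\<And>i j. i \<in> I \<Longrightarrow> j \<in> I \<Longrightarrow> i \<noteq> j \<Longrightarrow> indep_var borel (A i) borel (A j)"
  shows "integrable M (\<lambda>\<omega>. (norm (\<Sum>i\<in>I. A i \<omega>))\<^sup>2)"
    and "(\<integral>\<omega>. (norm (\<Sum>i\<in>I. A i \<omega>))\<^sup>2 \<partial>M) = (\<Sum>i\<in>I. \<integral>\<omega>. (norm (A i \<omega>))\<^sup>2 \<partial>M)"
proof -
  have expand: "(norm (\<Sum>i\<in>I. A i \<omega>))\<^sup>2 = (\<Sum>i\<in>I. \<Sum>j\<in>I. inner (A i \<omega>) (A j \<omega>))" for \<omega>
    unfolding power2_norm_eq_inner inner_sum_left by (simp add: inner_sum_right)
  have ij: "integrable M (\<lambda>\<omega>. inner (A i \<omega>) (A j \<omega>)) \<and>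
      (\<integral>\<omega>. inner (A i \<omega>) (A j \<omega>) \<partial>M) = (if i = j then \<integral>\<omega>. (norm (A i \<omega>))\<^sup>2 \<partial>M else 0)"
    if "i \<in> I" "j \<in> I" for i j
    using indep_var_integral_inner[OF ind[OF that] int int] that sq zero
    by (auto simp: power2_norm_eq_inner)
  show "integrable M (\<lambda>\<omega>. (norm (\<Sum>i\<in>I. A i \<omega>))\<^sup>2)"
    unfolding expand using ij by (intro Bochner_Integration.integrable_sum) auto
  have "(\<integral>\<omega>. (norm (\<Sum>i\<in>I. A i \<omega>))\<^sup>2 \<partial>M) = (\<Sum>i\<in>I. \<Sum>j\<in>I. \<integral>\<omega>. inner (A i \<omega>) (A j \<omega>) \<partial>M)"
    unfolding expand using ij
    by (subst Bochner_Integration.integral_sum)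
      (auto intro!: sum.cong Bochner_Integration.integral_sum Bochner_Integration.integrable_sum)
  also have "\<dots> = (\<Sum>i\<in>I. \<Sum>j\<in>I. if i = j then \<integral>\<omega>. (norm (A i \<omega>))\<^sup>2 \<partial>M else 0)"
    using ij by (intro sum.cong) auto
  also have "\<dots> = (\<Sum>i\<in>I. \<integral>\<omega>. (norm (A i \<omega>))\<^sup>2 \<partial>M)"
    using I by simp
  finally show "(\<integral>\<omega>. (norm (\<Sum>i\<in>I. A i \<omega>))\<^sup>2 \<partial>M) = (\<Sum>i\<in>I. \<integral>\<omega>. (norm (A i \<omega>))\<^sup>2 \<partial>M)" .
qed

section \<open>Moments of sums of truncated variables\<close>

text \<open>
  This replaces Jensen's inequality throughout: at the scale \<open>b\<close> a lower moment is bounded by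
  \<open>b\<^sup>p\<close> and a normalized higher moment, according to whether \<open>x\<close> is below or above \<open>b\<close>.
\<close>

lemma powr_le_interpolate:
  fixes b x p r :: real
  assumes "0 < b" "0 \<le> x" "0 \<le> p" "p \<le> r"
  shows "x powr p \<le> b powr p + b powr (p - r) * x powr r"
proof (cases "x \<le> b")
  case True
  then have "x powr p \<le> b powr p" using assms by (intro powr_mono2) auto
  then show ?thesis by (simp add: add_increasing2)
next
  case False
  have "x powr p = x powr (p - r) * x powr r" by (simp add: powr_add[symmetric])
  also have "\<dots> \<le> b powr (p - r) * x powr r"
    using False assms by (intro mult_right_mono powr_mono2') auto
  finally show ?thesis by (simp add: add_increasing)
qed

lemma powr_subadditive:
  fixes x y p :: real
  assumes "0 \<le> x" "0 \<le> y" "0 \<le> p" "p \<le> 1"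
  shows "(x + y) powr p \<le> x powr p + y powr p"
proof (cases "x + y = 0")
  case False
  define s where "s = x + y"
  have s: "0 < s" using False assms by (simp add: s_def)
  have *: "z / s * s powr p \<le> z powr p" if "0 \<le> z" "z \<le> s" for z
  proof (cases "z = 0")
    case False
    have "z / s = (z / s) powr 1" using that s by simp
    also have "\<dots> \<le> (z / s) powr p" using that s False assms by (intro powr_mono') auto
    finally have "z / s * s powr p \<le> (z / s) powr p * s powr p" by (rule mult_right_mono) simp
    also have "\<dots> = z powr p" using that s False by (simp add: powr_divide)
    finally show ?thesis .
  qed simp
  have "s powr p = (x / s + y / s) * s powr p" using s by (simp add: s_def add_divide_distrib[symmetric])
  also have "\<dots> = x / s * s powr p + y / s * s powr p" by (rule distrib_right)
  also have "\<dots> \<le> x powr p + y powr p"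
    using assms by (intro add_mono *) (auto simp: s_def)
  finally show ?thesis by (simp add: s_def)
qed (use assms in simp)

text \<open>
  Write \<open>S\<^sup>p = \<Sum> w\<^sub>i S\<^bsup>p-1\<^esup>\<close> and \<open>S = w\<^sub>i + s\<^sub>i\<close>.  The exponent \<open>p - 1\<close> is at most 1, hence
  \<open>S\<^bsup>p-1\<^esup> \<le> w\<^sub>i\<^bsup>p-1\<^esup> + s\<^sub>i\<^bsup>p-1\<^esup>\<close>, and \<open>s\<^sub>i\<^bsup>p-1\<^esup>\<close> is replaced by a linear function of \<open>s\<^sub>i\<close> at the scale
  \<open>b\<close>.  For random \<open>w\<^sub>i\<close> this leaves nothing but moments of single terms and of products of pairs,
  for which pairwise independence is enough.
\<close>

lemma powr_sum_le:
  fixes w :: "'i \<Rightarrow> real"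
  assumes I: "finite I" and w: "\<And>i. i \<in> I \<Longrightarrow> 0 \<le> w i" and p: "1 < p" "p \<le> 2" and b: "0 < b"
  shows "(\<Sum>i\<in>I. w i) powr p \<le> (\<Sum>i\<in>I. w i powr p) + b powr (p - 1) * (\<Sum>i\<in>I. w i)
    + b powr (p - 2) * (\<Sum>i\<in>I. \<Sum>j\<in>I - {i}. w i * w j)"
proof -
  define S where "S = (\<Sum>i\<in>I. w i)"
  have S: "0 \<le> S" unfolding S_def by (intro sum_nonneg w)
  have "S powr p = S * S powr (p - 1)"
  proof (cases "S = 0")
    case False
    then show ?thesis using S powr_add[of S 1 "p - 1"] by simp
  qed (use p in simp)
  also have "\<dots> = (\<Sum>i\<in>I. w i * S powr (p - 1))" by (simp add: S_def sum_distrib_right)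
  also have "\<dots> \<le> (\<Sum>i\<in>I. w i powr p + b powr (p - 1) * w i + b powr (p - 2) * (\<Sum>j\<in>I - {i}. w i * w j))"
  proof (rule sum_mono)
    fix i assume i: "i \<in> I"
    define s where "s = (\<Sum>j\<in>I - {i}. w j)"
    have s: "0 \<le> s" unfolding s_def using w by (intro sum_nonneg) auto
    have "S = w i + s" unfolding S_def s_def using I i by (rule sum.remove)
    then have "S powr (p - 1) \<le> w i powr (p - 1) + s powr (p - 1)"
      using powr_subadditive[of "w i" s "p - 1"] w[OF i] s p by simp
    also have "s powr (p - 1) \<le> b powr (p - 1) + b powr (p - 1 - 1) * s powr 1"
      using s p b by (intro powr_le_interpolate) auto
    finally have "S powr (p - 1) \<le> w i powr (p - 1) + (b powr (p - 1) + b powr (p - 2) * s)"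
      using s by simp
    then have "w i * S powr (p - 1) \<le> w i * (w i powr (p - 1) + (b powr (p - 1) + b powr (p - 2) * s))"
      using w[OF i] by (rule mult_left_mono)
    also have "\<dots> = w i * w i powr (p - 1) + b powr (p - 1) * w i + b powr (p - 2) * (w i * s)"
      by (simp add: algebra_simps)
    also have "w i * w i powr (p - 1) = w i powr p"
    proof (cases "w i = 0")
      case False
      then show ?thesis using w[OF i] powr_add[of "w i" 1 "p - 1"] by simp
    qed (use p in simp)
    also have "w i * s = (\<Sum>j\<in>I - {i}. w i * w j)" by (simp add: s_def sum_distrib_left)
    finally show "w i * S powr (p - 1) \<le>
      w i powr p + b powr (p - 1) * w i + b powr (p - 2) * (\<Sum>j\<in>I - {i}. w i * w j)" .
  qed
  also have "\<dots> = (\<Sum>i\<in>I. w i powr p) + b powr (p - 1) * S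
      + b powr (p - 2) * (\<Sum>i\<in>I. \<Sum>j\<in>I - {i}. w i * w j)"
    by (simp add: sum.distrib sum_distrib_left S_def)
  finally show ?thesis by (simp add: S_def)
qed

lemma powr_add3_le:
  fixes x y z p :: real
  assumes "0 \<le> x" "0 \<le> y" "0 \<le> z" "0 \<le> p"
  shows "(x + y + z) powr p \<le> 3 powr p * (x powr p + y powr p + z powr p)"
proof -
  have "(x + y + z) powr p \<le> (3 * max x (max y z)) powr p"
    using assms by (intro powr_mono2) auto
  also have "\<dots> = 3 powr p * max x (max y z) powr p" using assms by (simp add: powr_mult)
  also have "max x (max y z) powr p \<le> x powr p + y powr p + z powr p"
    by (auto simp: max_def add_increasing add_increasing2)
  finally show ?thesis by simp
qed

text \<open>
  The three hypotheses on the moments say that \<open>b\<close> is a correct scale for a sum of \<open>N\<close> terms: the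
  variance of the bounded parts is at most of order \<open>b\<^sup>2\<close>, and the parts above \<open>b\<close> contribute at most
  order \<open>b\<close> in the mean and order \<open>b\<^sup>p\<close> to the \<open>p\<close>-th moment.
\<close>

lemma (in prob_space) truncation_moment_bound:
  fixes Y :: "nat \<Rightarrow> 'a \<Rightarrow> 'h::separable_hilbert_space"
  assumes ind: "indep_vars (\<lambda>_. borel) Y UNIV"
    and ident: "\<And>n. distr M borel (Y n) = distr M borel (Y 0)"
    and p: "1 < p" "p \<le> 2"
    and intp: "integrable M (\<lambda>\<omega>. norm (Y 0 \<omega>) powr p)"
    and b: "0 < b" and K: "0 \<le> K"
    and small: "real N * (\<integral>\<omega>. (norm (Y 0 \<omega>))\<^sup>2 * indicator {..b} (norm (Y 0 \<omega>)) \<partial>M) \<le> K * b\<^sup>2"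
    and large1: "real N * (\<integral>\<omega>. norm (Y 0 \<omega>) * indicator {b<..} (norm (Y 0 \<omega>)) \<partial>M) \<le> K * b"
    and largep: "real N * (\<integral>\<omega>. norm (Y 0 \<omega>) powr p * indicator {b<..} (norm (Y 0 \<omega>)) \<partial>M) \<le> K * b powr p"
  shows "(\<integral>\<^sup>+\<omega>. ennreal (norm (\<Sum>n=1..N. Y n \<omega> - (\<integral>\<omega>. Y 0 \<omega> \<partial>M)) powr p) \<partial>M)
    \<le> ennreal (3 powr p * (1 + 3 * K + K\<^sup>2 + K powr p) * b powr p)"
proof -
  define t :: "'h \<Rightarrow> 'h" where "t y = indicator {..b} (norm y) *\<^sub>R y" for y
  define w :: "'h \<Rightarrow> real" where "w y = norm y * indicator {b<..} (norm y)" for y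
  have Y [measurable]: "Y n \<in> borel_measurable M" for n
    using ind by (auto simp: indep_vars_def)
  have t [measurable]: "t \<in> borel_measurable borel" unfolding t_def[abs_def] by measurable
  have w [measurable]: "w \<in> borel_measurable borel" unfolding w_def[abs_def] by measurable
  have transport: "integrable M (\<lambda>\<omega>. f (Y n \<omega>)) \<longleftrightarrow> integrable M (\<lambda>\<omega>. f (Y 0 \<omega>))"
    "(\<integral>\<omega>. f (Y n \<omega>) \<partial>M) = (\<integral>\<omega>. f (Y 0 \<omega>) \<partial>M)"
    if "f \<in> borel_measurable borel" for f :: "'h \<Rightarrow> 'b::{banach, second_countable_topology}" and n
    using that integrable_distr_eq[of "Y n" M borel f] integrable_distr_eq[of "Y 0" M borel f]
      integral_distr[of "Y n" M borel f] integral_distr[of "Y 0" M borel f] ident[of n] by auto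
  have le1: "x \<le> 1 + x powr p" if "0 \<le> x" for x :: real
    using powr_le_interpolate[of 1 x 1 p] that p by simp
  have intZ: "integrable M (\<lambda>\<omega>. norm (Y 0 \<omega>))"
    by (rule Bochner_Integration.integrable_bound[OF Bochner_Integration.integrable_add[OF integrable_const[of 1] intp]])
      (use le1 in auto)
  then have intY: "integrable M (Y 0)" by (simp add: integrable_norm_iff)
  have intw: "integrable M (\<lambda>\<omega>. w (Y 0 \<omega>))"
    by (rule Bochner_Integration.integrable_bound[OF intZ]) (auto simp: w_def indicator_def)
  have intwp: "integrable M (\<lambda>\<omega>. w (Y 0 \<omega>) powr p)"
    by (rule Bochner_Integration.integrable_bound[OF intp]) (auto simp: w_def indicator_def)
  have norm_t: "norm (t y) \<le> b" for y using b by (simp add: t_def indicator_def)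
  have intt: "integrable M (\<lambda>\<omega>. t (Y n \<omega>))" for n
    by (rule integrable_const_bound[of _ b]) (use norm_t in auto)
  \<comment> \<open>\<open>A\<close> is the fluctuation of the truncated sum, \<open>B\<close> the sum of the norms above the level, and \<open>D\<close>
    bounds the change of the mean of the sum caused by truncation.\<close>
  define c where "c = (\<integral>\<omega>. t (Y 0 \<omega>) \<partial>M)"
  define D where "D = real N * (\<integral>\<omega>. w (Y 0 \<omega>) \<partial>M)"
  define A where "A \<omega> = norm (\<Sum>n=1..N. t (Y n \<omega>) - c)" for \<omega>
  define B where "B \<omega> = (\<Sum>n=1..N. w (Y n \<omega>))" for \<omega>
  have w0: "0 \<le> w y" for y by (simp add: w_def)
  have D0: "0 \<le> D" unfolding D_def using w0 by (intro mult_nonneg_nonneg integral_nonneg_AE) auto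
  have D_le: "D \<le> K * b" using large1 by (simp add: D_def w_def)
  have pair: "indep_var borel (\<lambda>\<omega>. f (Y i \<omega>)) borel (\<lambda>\<omega>. f (Y j \<omega>))"
    if "i \<noteq> j" and [measurable]: "f \<in> borel_measurable borel"
    for i j and f :: "'h \<Rightarrow> 'b::{banach, second_countable_topology}"
    using indep_vars_imp_indep_var[OF indep_vars_compose2[OF ind, of "\<lambda>_. f" "\<lambda>_. borel"]] that by simp
  have sqt: "(norm (t y))\<^sup>2 = (norm y)\<^sup>2 * indicator {..b} (norm y)" for y
    by (simp add: t_def indicator_def)
  have intt2: "integrable M (\<lambda>\<omega>. (norm (t (Y n \<omega>)))\<^sup>2)" for n
    by (rule integrable_const_bound[of _ "b\<^sup>2"]) (use norm_t in \<open>auto intro!: power_mono\<close>)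
  have ct: "(\<integral>\<omega>. t (Y n \<omega>) \<partial>M) = c" for n unfolding c_def by (rule transport(2)) simp
  have expand: "(norm (t (Y n \<omega>) - c))\<^sup>2 = (norm (t (Y n \<omega>)))\<^sup>2 - 2 * inner (t (Y n \<omega>)) c + (norm c)\<^sup>2" for n \<omega>
    by (simp add: power2_norm_eq_inner inner_diff_left inner_diff_right inner_commute)
  have var: "integrable M (\<lambda>\<omega>. (norm (t (Y n \<omega>) - c))\<^sup>2)"
    "(\<integral>\<omega>. (norm (t (Y n \<omega>) - c))\<^sup>2 \<partial>M) \<le> (\<integral>\<omega>. (norm (t (Y 0 \<omega>)))\<^sup>2 \<partial>M)" for n
  proof -
    show "integrable M (\<lambda>\<omega>. (norm (t (Y n \<omega>) - c))\<^sup>2)"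
      unfolding expand using intt[of n] intt2[of n] by simp
    have "(\<integral>\<omega>. (norm (t (Y n \<omega>) - c))\<^sup>2 \<partial>M) = (\<integral>\<omega>. (norm (t (Y n \<omega>)))\<^sup>2 \<partial>M) - 2 * inner c c + (norm c)\<^sup>2"
      unfolding expand using intt[of n] intt2[of n] by (simp add: ct prob_space)
    also have "\<dots> \<le> (\<integral>\<omega>. (norm (t (Y n \<omega>)))\<^sup>2 \<partial>M)" by (simp add: power2_norm_eq_inner)
    also have "\<dots> = (\<integral>\<omega>. (norm (t (Y 0 \<omega>)))\<^sup>2 \<partial>M)" by (rule transport(2)) simp
    finally show "(\<integral>\<omega>. (norm (t (Y n \<omega>) - c))\<^sup>2 \<partial>M) \<le> (\<integral>\<omega>. (norm (t (Y 0 \<omega>)))\<^sup>2 \<partial>M)" .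
  qed
  have indt: "indep_var borel (\<lambda>\<omega>. t (Y i \<omega>) - c) borel (\<lambda>\<omega>. t (Y j \<omega>) - c)" if "i \<noteq> j" for i j
    using pair[OF that, of "\<lambda>y. t y - c"] by simp
  have zt: "(\<integral>\<omega>. t (Y n \<omega>) - c \<partial>M) = 0" for n using intt[of n] by (simp add: ct prob_space)
  have intA: "integrable M (\<lambda>\<omega>. (A \<omega>)\<^sup>2)" and EA: "(\<integral>\<omega>. (A \<omega>)\<^sup>2 \<partial>M) \<le> K * b\<^sup>2"
  proof -
    note sm = second_moment_centered_sum[of "{1..N}" "\<lambda>n \<omega>. t (Y n \<omega>) - c"]
    show "integrable M (\<lambda>\<omega>. (A \<omega>)\<^sup>2)"
      unfolding A_def using intt var(1) zt indt by (intro sm(1)) auto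
    have "(\<integral>\<omega>. (A \<omega>)\<^sup>2 \<partial>M) = (\<Sum>n=1..N. \<integral>\<omega>. (norm (t (Y n \<omega>) - c))\<^sup>2 \<partial>M)"
      unfolding A_def using intt var(1) zt indt by (intro sm(2)) auto
    also have "\<dots> \<le> (\<Sum>n=1..N. \<integral>\<omega>. (norm (t (Y 0 \<omega>)))\<^sup>2 \<partial>M)" by (intro sum_mono var)
    also have "\<dots> \<le> K * b\<^sup>2" using small by (simp add: sqt)
    finally show "(\<integral>\<omega>. (A \<omega>)\<^sup>2 \<partial>M) \<le> K * b\<^sup>2" .
  qed
  \<comment> \<open>The integrable majorant of \<open>B \<omega> powr p\<close> supplied by \<open>powr_sum_le\<close>.\<close>
  define G where "G \<omega> = (\<Sum>n=1..N. w (Y n \<omega>) powr p) + b powr (p - 1) * B \<omega>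
    + b powr (p - 2) * (\<Sum>i=1..N. \<Sum>j\<in>{1..N} - {i}. w (Y i \<omega>) * w (Y j \<omega>))" for \<omega>
  have intwn: "integrable M (\<lambda>\<omega>. w (Y n \<omega>))" "(\<integral>\<omega>. w (Y n \<omega>) \<partial>M) = (\<integral>\<omega>. w (Y 0 \<omega>) \<partial>M)"
    "integrable M (\<lambda>\<omega>. w (Y n \<omega>) powr p)" "(\<integral>\<omega>. w (Y n \<omega>) powr p \<partial>M) = (\<integral>\<omega>. w (Y 0 \<omega>) powr p \<partial>M)" for n
    using transport[of w n] transport[of "\<lambda>y. w y powr p" n] intw intwp by auto
  have ww: "integrable M (\<lambda>\<omega>. w (Y i \<omega>) * w (Y j \<omega>))"
    "(\<integral>\<omega>. w (Y i \<omega>) * w (Y j \<omega>) \<partial>M) = (\<integral>\<omega>. w (Y 0 \<omega>) \<partial>M)\<^sup>2" if "i \<noteq> j" for i j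
    using indep_var_integrable[OF pair[OF that w] intwn(1) intwn(1)]
      indep_var_lebesgue_integral[OF pair[OF that w] intwn(1) intwn(1)] intwn(2)[of i] intwn(2)[of j]
    by (simp_all add: power2_eq_square)
  have intG: "integrable M G"
    unfolding G_def[abs_def] B_def using intwn ww
    by (intro Bochner_Integration.integrable_add Bochner_Integration.integrable_sum integrable_mult_right) auto
  have EG: "(\<integral>\<omega>. G \<omega> \<partial>M) \<le> (2 * K + K\<^sup>2) * b powr p"
  proof -
    have 1: "(\<integral>\<omega>. (\<Sum>n=1..N. w (Y n \<omega>) powr p) \<partial>M) \<le> K * b powr p"
    proof -
      have "(\<integral>\<omega>. (\<Sum>n=1..N. w (Y n \<omega>) powr p) \<partial>M) = (\<Sum>n=1..N. \<integral>\<omega>. w (Y n \<omega>) powr p \<partial>M)"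
        by (intro Bochner_Integration.integral_sum intwn)
      also have "\<dots> = (\<Sum>n=1..N. \<integral>\<omega>. w (Y 0 \<omega>) powr p \<partial>M)" by (intro sum.cong refl intwn)
      also have "\<dots> = real N * (\<integral>\<omega>. w (Y 0 \<omega>) powr p \<partial>M)" by simp
      also have "(\<lambda>\<omega>. w (Y 0 \<omega>) powr p) = (\<lambda>\<omega>. norm (Y 0 \<omega>) powr p * indicator {b<..} (norm (Y 0 \<omega>)))"
        by (auto simp: w_def indicator_def)
      finally show ?thesis using largep by simp
    qed
    have 2: "(\<integral>\<omega>. b powr (p - 1) * B \<omega> \<partial>M) \<le> K * b powr p"
    proof -
      have "(\<integral>\<omega>. B \<omega> \<partial>M) = (\<Sum>n=1..N. \<integral>\<omega>. w (Y n \<omega>) \<partial>M)"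
        unfolding B_def by (intro Bochner_Integration.integral_sum intwn)
      also have "\<dots> = (\<Sum>n=1..N. \<integral>\<omega>. w (Y 0 \<omega>) \<partial>M)" by (intro sum.cong refl intwn)
      also have "\<dots> = D" by (simp add: D_def)
      finally have "(\<integral>\<omega>. b powr (p - 1) * B \<omega> \<partial>M) = b powr (p - 1) * D" by simp
      also have "\<dots> \<le> b powr (p - 1) * (K * b)" using D_le by (intro mult_left_mono) auto
      also have "\<dots> = K * b powr p" using b by (simp add: powr_diff)
      finally show ?thesis .
    qed
    have 3: "(\<integral>\<omega>. b powr (p - 2) * (\<Sum>i=1..N. \<Sum>j\<in>{1..N} - {i}. w (Y i \<omega>) * w (Y j \<omega>)) \<partial>M) \<le> K\<^sup>2 * b powr p"
    proof -
      have "(\<integral>\<omega>. (\<Sum>i=1..N. \<Sum>j\<in>{1..N} - {i}. w (Y i \<omega>) * w (Y j \<omega>)) \<partial>M) =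
          (\<Sum>i=1..N. \<integral>\<omega>. (\<Sum>j\<in>{1..N} - {i}. w (Y i \<omega>) * w (Y j \<omega>)) \<partial>M)"
        by (intro Bochner_Integration.integral_sum Bochner_Integration.integrable_sum ww) auto
      also have "\<dots> = (\<Sum>i=1..N. \<Sum>j\<in>{1..N} - {i}. \<integral>\<omega>. w (Y i \<omega>) * w (Y j \<omega>) \<partial>M)"
        by (intro sum.cong refl Bochner_Integration.integral_sum ww) auto
      also have "\<dots> = (\<Sum>i=1..N. \<Sum>j\<in>{1..N} - {i}. (\<integral>\<omega>. w (Y 0 \<omega>) \<partial>M)\<^sup>2)"
        by (intro sum.cong refl ww) auto
      also have "\<dots> \<le> (\<Sum>i=1..N. \<Sum>j=1..N. (\<integral>\<omega>. w (Y 0 \<omega>) \<partial>M)\<^sup>2)"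
        by (intro sum_mono sum_mono2) auto
      also have "\<dots> = D\<^sup>2" by (simp add: D_def power2_eq_square)
      also have "\<dots> \<le> (K * b)\<^sup>2" using D0 D_le by (intro power_mono) auto
      finally have "(\<integral>\<omega>. b powr (p - 2) * (\<Sum>i=1..N. \<Sum>j\<in>{1..N} - {i}. w (Y i \<omega>) * w (Y j \<omega>)) \<partial>M)
          \<le> b powr (p - 2) * (K * b)\<^sup>2"
        by (simp add: mult_left_mono)
      also have "\<dots> = K\<^sup>2 * b powr p" using b by (simp add: powr_diff power_mult_distrib)
      finally show ?thesis .
    qed
    have "(\<integral>\<omega>. G \<omega> \<partial>M) = (\<integral>\<omega>. (\<Sum>n=1..N. w (Y n \<omega>) powr p) \<partial>M) + (\<integral>\<omega>. b powr (p - 1) * B \<omega> \<partial>M)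
        + (\<integral>\<omega>. b powr (p - 2) * (\<Sum>i=1..N. \<Sum>j\<in>{1..N} - {i}. w (Y i \<omega>) * w (Y j \<omega>)) \<partial>M)"
      unfolding G_def[abs_def] B_def using intwn ww
      by (subst Bochner_Integration.integral_add, (intro Bochner_Integration.integrable_add
        Bochner_Integration.integrable_sum integrable_mult_right; auto)+)+ simp
    also have "\<dots> \<le> K * b powr p + K * b powr p + K\<^sup>2 * b powr p" using 1 2 3 by (intro add_mono)
    finally show ?thesis by (simp add: algebra_simps)
  qed
  have decomp: "norm (\<Sum>n=1..N. Y n \<omega> - (\<integral>\<omega>. Y 0 \<omega> \<partial>M)) \<le> A \<omega> + B \<omega> + D" for \<omega>
  proof -
    have yt: "norm (y - t y) = w y" for y by (simp add: t_def w_def indicator_def)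
    define d where "d = (\<integral>\<omega>. Y 0 \<omega> - t (Y 0 \<omega>) \<partial>M)"
    have d: "(\<integral>\<omega>. Y 0 \<omega> \<partial>M) = c + d"
      unfolding d_def c_def using intY intt[of 0] by simp
    have "norm d \<le> (\<integral>\<omega>. w (Y 0 \<omega>) \<partial>M)"
      unfolding d_def yt[symmetric] by (rule integral_norm_bound)
    then have dD: "norm (real N *\<^sub>R d) \<le> D" by (simp add: D_def mult_left_mono)
    have eq: "(\<Sum>n=1..N. Y n \<omega> - (\<integral>\<omega>. Y 0 \<omega> \<partial>M)) =
        (\<Sum>n=1..N. t (Y n \<omega>) - c) + (\<Sum>n=1..N. Y n \<omega> - t (Y n \<omega>)) - real N *\<^sub>R d"
      by (simp add: d sum_subtractf sum.distrib scaleR_add_right sum_constant_scaleR)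
    have "norm (\<Sum>n=1..N. Y n \<omega> - t (Y n \<omega>)) \<le> B \<omega>"
      unfolding B_def by (rule sum_norm_le) (simp add: yt)
    then show ?thesis
      unfolding eq A_def using dD
      by (intro order_trans[OF norm_triangle_ineq4] add_mono order_trans[OF norm_triangle_ineq] order_refl)
  qed
  have B0: "0 \<le> B \<omega>" for \<omega> unfolding B_def by (intro sum_nonneg w0)
  define F where "F \<omega> = 3 powr p * (b powr p + b powr (p - 2) * (A \<omega>)\<^sup>2 + G \<omega> + D powr p)" for \<omega>
  have bound: "norm (\<Sum>n=1..N. Y n \<omega> - (\<integral>\<omega>. Y 0 \<omega> \<partial>M)) powr p \<le> F \<omega>" for \<omega>
  proof -
    have A0: "0 \<le> A \<omega>" by (simp add: A_def)
    have "norm (\<Sum>n=1..N. Y n \<omega> - (\<integral>\<omega>. Y 0 \<omega> \<partial>M)) powr p \<le> (A \<omega> + B \<omega> + D) powr p"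
      using decomp p by (intro powr_mono2) auto
    also have "\<dots> \<le> 3 powr p * (A \<omega> powr p + B \<omega> powr p + D powr p)"
      using A0 B0 D0 p by (intro powr_add3_le) auto
    also have "\<dots> \<le> 3 powr p * ((b powr p + b powr (p - 2) * (A \<omega>) powr 2) + G \<omega> + D powr p)"
    proof (intro mult_left_mono add_mono order_refl)
      show "A \<omega> powr p \<le> b powr p + b powr (p - 2) * (A \<omega>) powr 2"
        using p b A0 by (intro powr_le_interpolate) auto
      show "B \<omega> powr p \<le> G \<omega>"
        unfolding G_def B_def by (intro powr_sum_le) (use p b w0 in auto)
    qed simp
    finally show ?thesis using A0 by (simp add: F_def)
  qed
  have intF: "integrable M F"
    unfolding F_def[abs_def] using intA intG by simp
  have "(\<integral>\<omega>. F \<omega> \<partial>M) = 3 powr p * (b powr p + b powr (p - 2) * (\<integral>\<omega>. (A \<omega>)\<^sup>2 \<partial>M) + (\<integral>\<omega>. G \<omega> \<partial>M) + D powr p)"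
    unfolding F_def using intA intG by (simp add: prob_space)
  also have "\<dots> \<le> 3 powr p * (b powr p + b powr (p - 2) * (K * b\<^sup>2) + (2 * K + K\<^sup>2) * b powr p + (K * b) powr p)"
    using EA EG D0 D_le p by (intro mult_left_mono add_mono order_refl powr_mono2) auto
  also have "\<dots> = 3 powr p * (1 + 3 * K + K\<^sup>2 + K powr p) * b powr p"
    using b K by (simp add: powr_diff powr_mult algebra_simps)
  finally have EF: "(\<integral>\<omega>. F \<omega> \<partial>M) \<le> 3 powr p * (1 + 3 * K + K\<^sup>2 + K powr p) * b powr p" .
  have F0: "0 \<le> F \<omega>" for \<omega> using order_trans[OF powr_ge_zero bound] .
  have "(\<integral>\<^sup>+\<omega>. ennreal (norm (\<Sum>n=1..N. Y n \<omega> - (\<integral>\<omega>. Y 0 \<omega> \<partial>M)) powr p) \<partial>M) \<le> (\<integral>\<^sup>+\<omega>. ennreal (F \<omega>) \<partial>M)"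
    using bound by (intro nn_integral_mono ennreal_leI)
  also have "\<dots> = ennreal (\<integral>\<omega>. F \<omega> \<partial>M)"
    using intF F0 by (intro nn_integral_eq_integral) auto
  finally show ?thesis using EF by (meson ennreal_leI order_trans)
qed

section \<open>The rate of convergence of the mean\<close>

text \<open>
  The truncation argument needs an exponent \<open>p\<close> strictly between 1 and \<open>\<beta>\<close>.  A smaller \<open>\<gamma>\<close> is reached
  from such a \<open>p\<close> by interpolation at the scale \<open>b N\<close>.
\<close>

lemma (in prob_space) mean_deviation_rate:
  fixes Y :: "nat \<Rightarrow> 'a \<Rightarrow> 'h::separable_hilbert_space"
  assumes ind: "indep_vars (\<lambda>_. borel) Y UNIV"
    and ident: "\<And>n. distr M borel (Y n) = distr M borel (Y 0)"
    and H: "regularly_varying_tail (\<lambda>u. prob {\<omega> \<in> space M. u < norm (Y 0 \<omega>)}) \<beta>"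
    and \<beta>: "1 < \<beta>" "\<beta> < 2" and \<gamma>: "0 < \<gamma>" "\<gamma> < \<beta>"
  shows "\<exists>L C. slowly_varying L \<and> 0 \<le> C \<and> (\<forall>\<^sub>F N in sequentially.
    ennreal (real N powr (\<gamma> * (1 - 1 / \<beta>)) * L (real N)) *
      (\<integral>\<^sup>+\<omega>. ennreal (norm ((1 / real N) *\<^sub>R (\<Sum>n=1..N. Y n \<omega>) - (\<integral>\<omega>. Y 0 \<omega> \<partial>M)) powr \<gamma>) \<partial>M) \<le> ennreal C)"
proof -
  define H where "H u = prob {\<omega> \<in> space M. u < norm (Y 0 \<omega>)}" for u
  have Y [measurable]: "Y n \<in> borel_measurable M" for n
    using ind by (auto simp: indep_vars_def)
  interpret regularly_varying_tail H \<beta> using H unfolding H_def[abs_def] .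
  interpret regularly_varying_variable M "\<lambda>\<omega>. norm (Y 0 \<omega>)" H \<beta>
    by unfold_locales (auto simp: H_def)
  obtain p where p: "max 1 \<gamma> < p" "p < \<beta>" using dense[of "max 1 \<gamma>" \<beta>] \<beta> \<gamma> by auto
  define b where "b N = 2 * quantile (real N)" for N :: nat
  obtain K1 where K1: "0 \<le> K1" "\<forall>\<^sub>F N in sequentially.
      real N * (\<integral>\<omega>. norm (Y 0 \<omega>) powr 1 * indicator {b N<..} (norm (Y 0 \<omega>)) \<partial>M) \<le> K1 * b N powr 1"
    using eventually_quantile_moments(1)[of 1] \<beta> unfolding b_def by auto
  obtain K2 where K2: "0 \<le> K2" "\<forall>\<^sub>F N in sequentially.
      real N * (\<integral>\<omega>. norm (Y 0 \<omega>) powr p * indicator {b N<..} (norm (Y 0 \<omega>)) \<partial>M) \<le> K2 * b N powr p"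
    using eventually_quantile_moments(1)[of p] p unfolding b_def by auto
  obtain K3 where K3: "0 \<le> K3" "\<forall>\<^sub>F N in sequentially.
      real N * (\<integral>\<omega>. (norm (Y 0 \<omega>))\<^sup>2 * indicator {..b N} (norm (Y 0 \<omega>)) \<partial>M) \<le> K3 * (b N)\<^sup>2"
    using eventually_quantile_moments(2) \<beta> unfolding b_def by auto
  define K where "K = max K1 (max K2 K3)"
  have K: "0 \<le> K" "K1 \<le> K" "K2 \<le> K" "K3 \<le> K" using K1 by (auto simp: K_def)
  define C where "C = 3 powr p * (1 + 3 * K + K\<^sup>2 + K powr p)"
  have C: "0 \<le> C" using K by (auto simp: C_def)
  define S where "S N \<omega> = norm (\<Sum>n=1..N. Y n \<omega> - (\<integral>\<omega>. Y 0 \<omega> \<partial>M))" for N \<omega>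
  \<comment> \<open>The \<open>\<gamma>\<close>-th power of the ratio of \<open>x\<^bsup>1/\<beta>\<^esup>\<close> to the true scale \<open>quantile x\<close>, so that the powers of \<open>N\<close> and of
    \<open>quantile N\<close> in the final estimate cancel exactly.\<close>
  define L where "L x = (x powr (1 / \<beta>) / quantile x) powr \<gamma>" for x
  have sums: "(\<integral>\<^sup>+\<omega>. ennreal (S N \<omega> powr \<gamma>) \<partial>M) \<le> ennreal ((1 + C) * b N powr \<gamma>)"
    if b0: "0 < b N"
      and m1: "real N * (\<integral>\<omega>. norm (Y 0 \<omega>) powr 1 * indicator {b N<..} (norm (Y 0 \<omega>)) \<partial>M) \<le> K1 * b N powr 1"
      and m2: "real N * (\<integral>\<omega>. norm (Y 0 \<omega>) powr p * indicator {b N<..} (norm (Y 0 \<omega>)) \<partial>M) \<le> K2 * b N powr p"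
      and m3: "real N * (\<integral>\<omega>. (norm (Y 0 \<omega>))\<^sup>2 * indicator {..b N} (norm (Y 0 \<omega>)) \<partial>M) \<le> K3 * (b N)\<^sup>2"
    for N
  proof -
    have [measurable]: "S N \<in> borel_measurable M" unfolding S_def[abs_def] by measurable
    have "(\<integral>\<^sup>+\<omega>. ennreal (S N \<omega> powr p) \<partial>M) \<le> ennreal (C * b N powr p)"
      unfolding S_def C_def
    proof (rule truncation_moment_bound[OF ind ident])
      show "real N * (\<integral>\<omega>. norm (Y 0 \<omega>) * indicator {b N<..} (norm (Y 0 \<omega>)) \<partial>M) \<le> K * b N"
        by (rule order_trans[OF _ mult_right_mono[OF K(2)]]) (use m1 b0 in auto)
      show "real N * (\<integral>\<omega>. norm (Y 0 \<omega>) powr p * indicator {b N<..} (norm (Y 0 \<omega>)) \<partial>M) \<le> K * b N powr p"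
        by (rule order_trans[OF m2 mult_right_mono[OF K(3)]]) simp
      show "real N * (\<integral>\<omega>. (norm (Y 0 \<omega>))\<^sup>2 * indicator {..b N} (norm (Y 0 \<omega>)) \<partial>M) \<le> K * (b N)\<^sup>2"
        by (rule order_trans[OF m3 mult_right_mono[OF K(4)]]) simp
      show "integrable M (\<lambda>\<omega>. norm (Y 0 \<omega>) powr p)" using p by (intro integrable_powr) auto
    qed (use p \<beta> b0 K in auto)
    note moment_p = this
    have "(\<integral>\<^sup>+\<omega>. ennreal (S N \<omega> powr \<gamma>) \<partial>M) \<le>
        (\<integral>\<^sup>+\<omega>. ennreal (b N powr \<gamma>) + ennreal (b N powr (\<gamma> - p)) * ennreal (S N \<omega> powr p) \<partial>M)"
      using powr_le_interpolate[OF b0, of "S N _" \<gamma> p] p \<gamma>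
      by (intro nn_integral_mono)
        (auto simp: S_def ennreal_mult[symmetric] ennreal_plus[symmetric] simp del: ennreal_plus intro!: ennreal_leI)
    also have "\<dots> = ennreal (b N powr \<gamma>) + ennreal (b N powr (\<gamma> - p)) * (\<integral>\<^sup>+\<omega>. ennreal (S N \<omega> powr p) \<partial>M)"
      by (subst nn_integral_add) (auto simp: nn_integral_cmult emeasure_space_1)
    also have "\<dots> \<le> ennreal (b N powr \<gamma>) + ennreal (b N powr (\<gamma> - p)) * ennreal (C * b N powr p)"
      by (intro add_left_mono mult_left_mono moment_p) simp
    also have "\<dots> = ennreal (b N powr \<gamma> + b N powr (\<gamma> - p) * (C * b N powr p))"
      using C by (simp add: ennreal_mult)
    also have "b N powr \<gamma> + b N powr (\<gamma> - p) * (C * b N powr p) = (1 + C) * b N powr \<gamma>"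
      using b0 by (simp add: powr_diff field_simps)
    finally show ?thesis .
  qed
  have "filterlim (\<lambda>N::nat. quantile (real N)) at_top sequentially"
    by (rule filterlim_compose[OF quantile_at_top filterlim_real_sequentially])
  then have "\<forall>\<^sub>F N in sequentially. 0 < quantile (real N)" by (simp add: filterlim_at_top_dense)
  then have "\<forall>\<^sub>F N in sequentially. ennreal (real N powr (\<gamma> * (1 - 1 / \<beta>)) * L (real N)) *
      (\<integral>\<^sup>+\<omega>. ennreal (norm ((1 / real N) *\<^sub>R (\<Sum>n=1..N. Y n \<omega>) - (\<integral>\<omega>. Y 0 \<omega> \<partial>M)) powr \<gamma>) \<partial>M)
      \<le> ennreal ((1 + C) * 2 powr \<gamma>)"
    using K1(2) K2(2) K3(2) eventually_gt_at_top[of 0]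
  proof eventually_elim
    case (elim N)
    define q where "q = quantile (real N)"
    have q: "0 < q" "b N = 2 * q" and N: "0 < real N" using elim by (auto simp: q_def b_def)
    have [measurable]: "S N \<in> borel_measurable M" unfolding S_def[abs_def] by measurable
    have norm_eq: "norm ((1 / real N) *\<^sub>R (\<Sum>n=1..N. Y n \<omega>) - (\<integral>\<omega>. Y 0 \<omega> \<partial>M)) = 1 / real N * S N \<omega>" for \<omega>
    proof -
      have "(1 / real N) *\<^sub>R (\<Sum>n=1..N. Y n \<omega>) - (\<integral>\<omega>. Y 0 \<omega> \<partial>M) =
          (1 / real N) *\<^sub>R (\<Sum>n=1..N. Y n \<omega> - (\<integral>\<omega>. Y 0 \<omega> \<partial>M))"
        using N by (simp add: sum_subtractf sum_constant_scaleR scaleR_diff_right)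
      then show ?thesis by (simp add: S_def)
    qed
    have "(\<integral>\<^sup>+\<omega>. ennreal (norm ((1 / real N) *\<^sub>R (\<Sum>n=1..N. Y n \<omega>) - (\<integral>\<omega>. Y 0 \<omega> \<partial>M)) powr \<gamma>) \<partial>M) =
        (\<integral>\<^sup>+\<omega>. ennreal ((1 / real N) powr \<gamma>) * ennreal (S N \<omega> powr \<gamma>) \<partial>M)"
      unfolding norm_eq by (simp only: powr_mult ennreal_mult powr_ge_zero)
    also have "\<dots> = ennreal ((1 / real N) powr \<gamma>) * (\<integral>\<^sup>+\<omega>. ennreal (S N \<omega> powr \<gamma>) \<partial>M)"
      by (rule nn_integral_cmult) simp
    also have "\<dots> \<le> ennreal ((1 / real N) powr \<gamma>) * ennreal ((1 + C) * b N powr \<gamma>)"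
      using q elim by (intro mult_left_mono sums) auto
    finally have "ennreal (real N powr (\<gamma> * (1 - 1 / \<beta>)) * L (real N)) *
        (\<integral>\<^sup>+\<omega>. ennreal (norm ((1 / real N) *\<^sub>R (\<Sum>n=1..N. Y n \<omega>) - (\<integral>\<omega>. Y 0 \<omega> \<partial>M)) powr \<gamma>) \<partial>M)
        \<le> ennreal (real N powr (\<gamma> * (1 - 1 / \<beta>)) * L (real N)) *
          (ennreal ((1 / real N) powr \<gamma>) * ennreal ((1 + C) * b N powr \<gamma>))"
      by (rule mult_left_mono) simp
    also have "\<dots> = ennreal (real N powr (\<gamma> * (1 - 1 / \<beta>)) * L (real N) *
        ((1 / real N) powr \<gamma> * ((1 + C) * b N powr \<gamma>)))"
      using C by (simp add: ennreal_mult L_def)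
    also have "real N powr (\<gamma> * (1 - 1 / \<beta>)) * L (real N) * ((1 / real N) powr \<gamma> * ((1 + C) * b N powr \<gamma>)) =
        (1 + C) * 2 powr \<gamma>"
    proof -
      have "L (real N) = real N powr (\<gamma> / \<beta>) / q powr \<gamma>"
        using q N by (simp add: L_def q_def[symmetric] powr_divide powr_powr)
      moreover have "real N powr (\<gamma> * (1 - 1 / \<beta>)) = real N powr \<gamma> / real N powr (\<gamma> / \<beta>)"
        by (simp add: right_diff_distrib powr_diff)
      moreover have "b N powr \<gamma> = 2 powr \<gamma> * q powr \<gamma>" using q by (simp add: powr_mult)
      moreover have "(1 / real N) powr \<gamma> = 1 / real N powr \<gamma>" using N by (simp add: powr_divide)
      ultimately show ?thesis using q N by simp
    qed
    finally show ?case .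
  qed
  moreover have "slowly_varying L" unfolding L_def[abs_def] by (rule quantile_slowly_varying)
  ultimately show ?thesis using C by (intro exI[of _ L] exI[of _ "(1 + C) * 2 powr \<gamma>"]) simp
qed

section \<open>Compactness of Hilbert--Schmidt operators\<close>

lemma bounded_linear_hs_apply: "bounded_linear (hs_apply A)"
  using hs_apply[of A] by (simp add: hilbert_schmidt_def)

lemma linear_hs_apply: "linear (hs_apply A)"
  by (rule bounded_linear.linear[OF bounded_linear_hs_apply])

lemmas hs_apply_add = linear_add[OF linear_hs_apply]
  and hs_apply_diff = linear_diff[OF linear_hs_apply]
  and hs_apply_scaleR = linear_scale[OF linear_hs_apply]

text \<open>
  The error of restricting \<open>A\<close> to finitely many basis vectors is a tail of the convergent series
  that defines the Hilbert--Schmidt norm.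
\<close>

lemma hs_op_finite_rank_approx:
  fixes A :: "'h::separable_hilbert_space hs_op"
  assumes r: "0 < r"
  obtains F where "finite F" "norm (A - (\<Sum>e\<in>F. e \<otimes> hs_apply A e)) \<le> r"
proof -
  let ?f = "\<lambda>e. (norm (hs_apply A e))\<^sup>2"
  have sm: "?f summable_on onb" by (rule hs_summable[OF hs_apply])
  have "\<forall>\<^sub>F F in finite_subsets_at_top onb. dist (sum ?f F) (infsum ?f onb) < r\<^sup>2"
    using infsum_tendsto[OF sm] r by (intro tendstoD) auto
  then obtain F where F: "finite F" "F \<subseteq> onb" "dist (sum ?f F) (infsum ?f onb) < r\<^sup>2"
    unfolding eventually_finite_subsets_at_top by blast
  define R where "R = A - (\<Sum>e\<in>F. e \<otimes> hs_apply A e)"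
  have R: "hs_apply R e = (if e \<in> F then 0 else hs_apply A e)" if e: "e \<in> onb" for e
  proof -
    have "hs_apply (\<Sum>e\<in>F. e \<otimes> hs_apply A e) e = (\<Sum>e'\<in>F. if e' = e then hs_apply A e' else 0)"
      unfolding hs_apply_sum tensor.rep_eq
      using F(2) e onb_set
      by (intro sum.cong) (auto simp: orthonormal_set_def pairwise_def orthogonal_def norm_eq_1)
    then show ?thesis using F(1) by (simp add: R_def minus_hs_op.rep_eq)
  qed
  have "norm R \<le> r"
  proof (rule norm_hs_op_le)
    fix G :: "'h set" assume G: "finite G" "G \<subseteq> onb"
    have "(\<Sum>e\<in>G. (norm (hs_apply R e))\<^sup>2) = (\<Sum>e\<in>G. if e \<in> F then 0 else ?f e)"
      using G R by (intro sum.cong) auto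
    also have "\<dots> = sum ?f (G - F)" using G by (intro sum.mono_neutral_cong_right) auto
    also have "\<dots> = sum ?f (G \<union> F) - sum ?f F"
    proof -
      have "sum ?f (G \<union> F) = sum ?f (G - F) + sum ?f F"
        using sum.union_disjoint[of "G - F" F ?f] F G by auto
      then show ?thesis by simp
    qed
    also have "\<dots> \<le> infsum ?f onb - sum ?f F"
      using F G sm by (intro diff_right_mono finite_sum_le_infsum) auto
    also have "\<dots> \<le> r\<^sup>2" using F(3) by (simp add: dist_real_def)
    finally show "(\<Sum>e\<in>G. (norm (hs_apply R e))\<^sup>2) \<le> r\<^sup>2" .
  qed (use r in simp)
  then show ?thesis using that F(1) by (simp add: R_def)
qed

lemma compact_sum_scaled:
  fixes a :: "'i \<Rightarrow> 'h::real_normed_vector"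
  assumes "finite F"
  shows "compact {\<Sum>e\<in>F. c e *\<^sub>R a e |c. \<forall>e\<in>F. \<bar>c e\<bar> \<le> r}"
  using assms
proof induction
  case (insert f F)
  have c: "compact ((\<lambda>t. t *\<^sub>R a f) ` {-r..r})"
    by (intro compact_continuous_image continuous_intros) auto
  have "{\<Sum>e\<in>insert f F. c e *\<^sub>R a e |c. \<forall>e\<in>insert f F. \<bar>c e\<bar> \<le> r} =
      {x + y |x y. x \<in> (\<lambda>t. t *\<^sub>R a f) ` {-r..r} \<and> y \<in> {\<Sum>e\<in>F. c e *\<^sub>R a e |c. \<forall>e\<in>F. \<bar>c e\<bar> \<le> r}}"
    (is "?L = ?R")
  proof (intro subset_antisym subsetI)
    fix z assume "z \<in> ?L"
    then obtain c where c: "z = (\<Sum>e\<in>insert f F. c e *\<^sub>R a e)" "\<forall>e\<in>insert f F. \<bar>c e\<bar> \<le> r" by blast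
    have "z = c f *\<^sub>R a f + (\<Sum>e\<in>F. c e *\<^sub>R a e)" using c insert by simp
    moreover have "c f *\<^sub>R a f \<in> (\<lambda>t. t *\<^sub>R a f) ` {-r..r}"
      using c(2) by (intro image_eqI[of _ _ "c f"]) (auto simp: abs_le_iff)
    ultimately show "z \<in> ?R" using c(2) by blast
  next
    fix z assume "z \<in> ?R"
    then obtain t c where tc: "z = t *\<^sub>R a f + (\<Sum>e\<in>F. c e *\<^sub>R a e)" "t \<in> {-r..r}" "\<forall>e\<in>F. \<bar>c e\<bar> \<le> r"
      by blast
    have "(\<Sum>e\<in>F. c e *\<^sub>R a e) = (\<Sum>e\<in>F. (c(f := t)) e *\<^sub>R a e)"
      using insert by (intro sum.cong) auto
    then have "z = (\<Sum>e\<in>insert f F. (c(f := t)) e *\<^sub>R a e)" using tc insert by simp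
    moreover have "\<forall>e\<in>insert f F. \<bar>(c(f := t)) e\<bar> \<le> r" using tc by auto
    ultimately show "z \<in> ?L" by blast
  qed
  then show ?case using compact_sums[OF c insert.IH] by (simp only:)
qed simp

text \<open>
  Up to \<open>r / 4\<close>, the image of the unit ball lies in the compact set of combinations of finitely many
  fixed vectors with bounded coefficients, so it is totally bounded.
\<close>

lemma hs_op_compact:
  fixes A :: "'h::separable_hilbert_space hs_op"
  shows "compact (closure (hs_apply A ` cball 0 1))"
  unfolding compact_eq_totally_bounded
proof (intro conjI allI impI)
  show "uniform_space_class.complete (closure (hs_apply A ` cball 0 1))" by (simp add: complete_eq_closed)
  fix r :: real assume r: "0 < r"
  obtain F where F: "finite F" "norm (A - (\<Sum>e\<in>F. e \<otimes> hs_apply A e)) \<le> r / 4"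
    using hs_op_finite_rank_approx[of "r / 4" A] r by auto
  define m where "m = Max (insert 0 (norm ` F))"
  define C where "C = {\<Sum>e\<in>F. c e *\<^sub>R hs_apply A e |c. \<forall>e\<in>F. \<bar>c e\<bar> \<le> m}"
  have "compact C" unfolding C_def by (rule compact_sum_scaled[OF F(1)])
  then obtain k where k: "finite k" "C \<subseteq> (\<Union>y\<in>k. ball y (r / 4))"
    unfolding compact_eq_totally_bounded using r by (meson zero_less_divide_iff zero_less_numeral)
  have "hs_apply A ` cball 0 1 \<subseteq> (\<Union>y\<in>k. cball y (r / 2))"
  proof
    fix z assume "z \<in> hs_apply A ` cball 0 1"
    then obtain x where x: "z = hs_apply A x" "norm x \<le> 1" by auto
    define y where "y = (\<Sum>e\<in>F. inner e x *\<^sub>R hs_apply A e)"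
    have "\<bar>inner e x\<bar> \<le> m" if "e \<in> F" for e
    proof -
      have "\<bar>inner e x\<bar> \<le> norm e * norm x" by (rule Cauchy_Schwarz_ineq2)
      also have "\<dots> \<le> norm e * 1" using x by (intro mult_left_mono) auto
      also have "norm e * 1 \<le> m" using that F(1) by (auto simp: m_def intro!: Max_ge)
      finally show ?thesis .
    qed
    then have "y \<in> C" by (auto simp: y_def C_def)
    then obtain u where u: "u \<in> k" "dist u y < r / 4" using k by auto
    have "z - y = hs_apply (A - (\<Sum>e\<in>F. e \<otimes> hs_apply A e)) x"
      by (simp add: x y_def minus_hs_op.rep_eq hs_apply_sum tensor.rep_eq)
    also have "norm \<dots> \<le> norm (A - (\<Sum>e\<in>F. e \<otimes> hs_apply A e)) * norm x" by (rule norm_hs_apply_le)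
    also have "\<dots> \<le> r / 4 * 1" using F x r by (intro mult_mono) auto
    finally have "dist y z \<le> r / 4" by (simp add: dist_norm norm_minus_commute)
    with u have "dist u z \<le> r / 2" using dist_triangle[of u z y] by linarith
    with u show "z \<in> (\<Union>y\<in>k. cball y (r / 2))" by auto
  qed
  then have "closure (hs_apply A ` cball 0 1) \<subseteq> (\<Union>y\<in>k. cball y (r / 2))"
    by (rule closure_minimal) (use k in auto)
  also have "\<dots> \<subseteq> (\<Union>y\<in>k. ball y r)" using r by auto
  finally show "\<exists>k. finite k \<and> closure (hs_apply A ` cball 0 1) \<subseteq> (\<Union>x\<in>k. ball x r)"
    using k(1) by blast
qed

section \<open>Eigenvalues as maxima of the quadratic form\<close>

definition positive_op :: "'h::separable_hilbert_space hs_op \<Rightarrow> bool" where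
  "positive_op A \<longleftrightarrow>
     (\<forall>x y. inner (hs_apply A x) y = inner x (hs_apply A y)) \<and> (\<forall>x. 0 \<le> inner (hs_apply A x) x)"

lemma positive_opD:
  assumes "positive_op A"
  shows "inner (hs_apply A x) y = inner x (hs_apply A y)" "0 \<le> inner (hs_apply A x) x"
  using assms by (auto simp: positive_op_def)

lemma inner_hs_apply_le: "inner (hs_apply A x) x \<le> norm A * (norm x)\<^sup>2"
proof -
  have "inner (hs_apply A x) x \<le> norm (hs_apply A x) * norm x" by (rule norm_cauchy_schwarz)
  also have "\<dots> \<le> norm A * norm x * norm x" by (intro mult_right_mono norm_hs_apply_le) simp
  finally show ?thesis by (simp add: power2_eq_square mult.assoc)
qed

text \<open>
  The eigenvalue is the supremum \<open>s\<close> of the quadratic form on the unit ball of \<open>V\<close>.  For a maximizing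
  sequence \<open>x\<^sub>n\<close> positivity gives \<open>\<parallel>A x\<^sub>n - s x\<^sub>n\<parallel>\<^sup>2 \<le> s (s - \<langle>A x\<^sub>n, x\<^sub>n\<rangle>) \<rightarrow> 0\<close>; by compactness a
  subsequence of \<open>A x\<^sub>n\<close> converges, and then so does \<open>x\<^sub>n\<close>, because \<open>s > 0\<close>.
\<close>

lemma positive_op_max_eigenvector:
  fixes A :: "'h::separable_hilbert_space hs_op"
  assumes A: "positive_op A" and V: "subspace V" "closed V"
    and inv: "\<And>x. x \<in> V \<Longrightarrow> hs_apply A x \<in> V"
    and y: "y \<in> V" "norm y \<le> 1" "0 \<le> m" "m < inner (hs_apply A y) y"
  obtains s x where "m < s" "x \<in> V" "x \<noteq> 0" "hs_apply A x = s *\<^sub>R x"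
proof -
  define q where "q x = inner (hs_apply A x) x" for x
  define S where "S = q ` (V \<inter> cball 0 1)"
  define s where "s = Sup S"
  have bdd: "bdd_above S"
  proof (rule bdd_aboveI)
    fix z assume "z \<in> S"
    then obtain x where x: "z = q x" "norm x \<le> 1" by (auto simp: S_def)
    have "z \<le> norm A * (norm x)\<^sup>2" unfolding x q_def by (rule inner_hs_apply_le)
    also have "\<dots> \<le> norm A * 1" using x by (intro mult_left_mono) (auto simp: power_le_one)
    finally show "z \<le> norm A" by simp
  qed
  have q_le_s: "q x \<le> s" if "x \<in> V" "norm x \<le> 1" for x
    unfolding s_def using that by (intro cSup_upper bdd) (auto simp: S_def)
  have ms: "m < s" using y q_le_s[of y] by (auto simp: q_def)
  have s0: "0 < s" using ms y by simp
  have q_scale: "q (c *\<^sub>R x) = c\<^sup>2 * q x" for c x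
    by (simp add: q_def hs_apply_scaleR power2_eq_square)
  have q_le: "q x \<le> s * (norm x)\<^sup>2" if "x \<in> V" for x
  proof (cases "x = 0")
    case True
    then show ?thesis by (simp add: q_def)
  next
    case False
    have "q ((1 / norm x) *\<^sub>R x) \<le> s"
      using that V False by (intro q_le_s subspace_scale) auto
    then show ?thesis using False by (simp add: q_scale power_divide field_simps)
  qed
  have norm_le: "(norm (hs_apply A x))\<^sup>2 \<le> s * q x" if x: "x \<in> V" for x
  proof -
    define z where "z = hs_apply A x"
    have z: "inner (hs_apply A z) x = inner z z"
      by (simp add: z_def positive_opD(1)[OF A])
    \<comment> \<open>The step \<open>1 / s\<close> minimizes the bound \<open>q x - 2 t \<parallel>z\<parallel>\<^sup>2 + t\<^sup>2 s \<parallel>z\<parallel>\<^sup>2\<close> of \<open>q (x - t z)\<close>.\<close>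
    have "0 \<le> q (x - (1 / s) *\<^sub>R z)" unfolding q_def by (rule positive_opD(2)[OF A])
    also have "\<dots> = q x - 2 / s * inner z z + (1 / s)\<^sup>2 * q z"
      unfolding q_def hs_apply_diff hs_apply_scaleR z_def[symmetric]
      by (simp add: inner_diff_left inner_diff_right z inner_commute[of z x] power2_eq_square)
        (simp add: z_def positive_opD(1)[OF A] inner_commute diff_divide_distrib)
    also have "(1 / s)\<^sup>2 * q z \<le> (1 / s)\<^sup>2 * (s * (norm z)\<^sup>2)"
      using q_le[OF inv[OF x]] by (intro mult_left_mono) (auto simp: z_def)
    also have "(1 / s)\<^sup>2 * (s * (norm z)\<^sup>2) = 1 / s * inner z z"
      using s0 by (simp add: power2_eq_square power2_norm_eq_inner[symmetric])
    finally have "1 / s * inner z z \<le> q x" by simp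
    then show ?thesis using s0 by (simp add: field_simps z_def power2_norm_eq_inner)
  qed
  have "\<exists>x. x \<in> V \<and> norm x \<le> 1 \<and> s - 1 / Suc n < q x" for n
  proof -
    have "S \<noteq> {}" using y by (auto simp: S_def)
    then have "\<exists>z\<in>S. s - 1 / Suc n < z"
      unfolding s_def using bdd by (subst less_cSup_iff[symmetric]) auto
    then show ?thesis by (auto simp: S_def)
  qed
  then obtain x where x: "\<And>n. x n \<in> V" "\<And>n. norm (x n) \<le> 1" "\<And>n. s - 1 / Suc n < q (x n)" by metis
  have "hs_apply A (x n) \<in> closure (hs_apply A ` cball 0 1)" for n
    using x(2)[of n] by (intro set_mp[OF closure_subset]) auto
  then obtain l r where r: "strict_mono (r :: nat \<Rightarrow> nat)" "(\<lambda>n. hs_apply A (x (r n))) \<longlonglongrightarrow> l"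
    using hs_op_compact[of A] unfolding compact_def by (fastforce simp: o_def)
  have dist_le: "(norm (hs_apply A (x n) - s *\<^sub>R x n))\<^sup>2 \<le> s * (1 / Suc n)" for n
  proof -
    have "(norm (hs_apply A (x n) - s *\<^sub>R x n))\<^sup>2 =
        (norm (hs_apply A (x n)))\<^sup>2 - 2 * s * q (x n) + s\<^sup>2 * (norm (x n))\<^sup>2"
      unfolding power2_norm_eq_inner q_def
      by (simp add: inner_diff_left inner_diff_right inner_commute power2_eq_square)
    also have "\<dots> \<le> s * q (x n) - 2 * s * q (x n) + s\<^sup>2 * 1"
      using norm_le[OF x(1)[of n]] x(2)[of n] s0
      by (intro add_mono diff_mono mult_left_mono) (auto simp: power_le_one)
    also have "\<dots> = s * (s - q (x n))" by (simp add: algebra_simps power2_eq_square)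
    also have "\<dots> \<le> s * (1 / Suc n)" using s0 x(3)[of n] by (intro mult_left_mono) auto
    finally show ?thesis .
  qed
  have "(\<lambda>n. (norm (hs_apply A (x n) - s *\<^sub>R x n))\<^sup>2) \<longlonglongrightarrow> 0"
  proof (rule tendsto_sandwich[OF _ _ tendsto_const])
    have "(\<lambda>n. 1 / real (Suc n)) \<longlonglongrightarrow> 0"
      using LIMSEQ_inverse_real_of_nat by (simp add: inverse_eq_divide)
    then show "(\<lambda>n. s * (1 / Suc n)) \<longlonglongrightarrow> 0" by (rule tendsto_mult_right_zero)
  qed (use dist_le in auto)
  from tendsto_real_sqrt[OF this] have "(\<lambda>n. hs_apply A (x n) - s *\<^sub>R x n) \<longlonglongrightarrow> 0"
    by (simp add: tendsto_norm_zero_iff)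
  from tendsto_diff[OF r(2) LIMSEQ_subseq_LIMSEQ[OF this r(1)]]
  have "(\<lambda>n. (1 / s) *\<^sub>R (s *\<^sub>R x (r n))) \<longlonglongrightarrow> (1 / s) *\<^sub>R l"
    by (intro tendsto_scaleR tendsto_const) (simp add: o_def)
  then have lim: "(\<lambda>n. x (r n)) \<longlonglongrightarrow> (1 / s) *\<^sub>R l" using s0 by simp
  define z where "z = (1 / s) *\<^sub>R l"
  have "z \<in> V" using closed_sequentially[OF V(2), of "\<lambda>n. x (r n)"] lim x(1) by (simp add: z_def)
  moreover have limA: "(\<lambda>n. hs_apply A (x (r n))) \<longlonglongrightarrow> hs_apply A z"
    unfolding z_def by (rule bounded_linear.tendsto[OF bounded_linear_hs_apply lim])
  then have "hs_apply A z = l" using r(2) LIMSEQ_unique by blast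
  then have "hs_apply A z = s *\<^sub>R z" using s0 by (simp add: z_def)
  moreover have "z \<noteq> 0"
  proof
    assume "z = 0"
    then have "(\<lambda>n. hs_apply A (x (r n))) \<longlonglongrightarrow> 0" "(\<lambda>n. x (r n)) \<longlonglongrightarrow> 0"
      using limA lim unfolding z_def[symmetric] by (simp_all add: linear_0[OF linear_hs_apply])
    then have "(\<lambda>n. q (x (r n))) \<longlonglongrightarrow> inner 0 (0::'h)" unfolding q_def by (rule tendsto_inner)
    then have "(\<lambda>n. q (x (r n)) + 1 / real (Suc (r n))) \<longlonglongrightarrow> 0 + 0"
      using LIMSEQ_subseq_LIMSEQ[OF LIMSEQ_inverse_real_of_nat r(1)]
      by (intro tendsto_add) (simp_all add: o_def inverse_eq_divide)
    moreover have "s \<le> q (x (r n)) + 1 / real (Suc (r n))" for n using x(3)[of "r n"] by simp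
    ultimately have "s \<le> 0 + 0" by (intro LIMSEQ_le_const) auto
    then show False using s0 by simp
  qed
  ultimately show ?thesis using that ms by blast
qed

lemma eigensystemD:
  assumes "eigensystem A \<mu> e"
  shows "\<And>i j. 1 \<le> i \<Longrightarrow> i \<le> j \<Longrightarrow> \<mu> j \<le> \<mu> i"
    and "\<And>i j. 1 \<le> i \<Longrightarrow> 1 \<le> j \<Longrightarrow> inner (e i) (e j) = (if i = j then 1 else 0)"
    and "\<And>j. 1 \<le> j \<Longrightarrow> hs_apply A (e j) = \<mu> j *\<^sub>R e j"
    and "\<And>c x. c \<noteq> 0 \<Longrightarrow> hs_apply A x = c *\<^sub>R x \<Longrightarrow> x \<in> span (e ` {j. 1 \<le> j \<and> \<mu> j = c})"
  using assms unfolding eigensystem_def by blast+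

text \<open>
  The half of the variational characterization that uses the completeness of the eigensystem.
  A larger value of the form at a unit vector of the orthogonal complement of \<open>e\<^sub>1, \<dots>, e\<^sub>j\<^sub>-\<^sub>1\<close> would produce
  there an eigenvector with an eigenvalue \<open>s > \<mu>\<^sub>j\<close>; but \<open>s\<close> is nonzero, so its eigenspace is spanned
  by vectors \<open>e\<^sub>i\<close> with \<open>i < j\<close>.
\<close>

lemma rayleigh_le_eigenvalue:
  fixes A :: "'h::separable_hilbert_space hs_op"
  assumes A: "positive_op A" and eig: "eigensystem A \<mu> e" and j: "1 \<le> j"
    and x: "\<And>i. 1 \<le> i \<Longrightarrow> i < j \<Longrightarrow> inner x (e i) = 0"
  shows "inner (hs_apply A x) x \<le> \<mu> j * (norm x)\<^sup>2"
proof (rule ccontr)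
  assume gt: "\<not> ?thesis"
  note eD = eigensystemD[OF eig]
  define V where "V = {x. \<forall>i. 1 \<le> i \<and> i < j \<longrightarrow> inner x (e i) = 0}"
  have \<mu>0: "0 \<le> \<mu> j"
    using positive_opD(2)[OF A, of "e j"] eD(2)[OF j j] eD(3)[OF j] by simp
  have x0: "x \<noteq> 0" using gt by auto
  define y where "y = (1 / norm x) *\<^sub>R x"
  have V: "subspace V" unfolding V_def by (rule subspaceI) (auto simp: inner_add_left)
  have "V = (\<Inter>i\<in>{1..<j}. {x. inner x (e i) = 0})" by (auto simp: V_def)
  also have "closed \<dots>" by (intro closed_INT ballI closed_Collect_eq continuous_intros)
  finally have cV: "closed V" .
  have inv: "hs_apply A z \<in> V" if "z \<in> V" for z
    using that eD(3) by (auto simp: V_def positive_opD(1)[OF A])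
  have "inner (hs_apply A y) y = inner (hs_apply A x) x / (norm x)\<^sup>2"
    by (simp add: y_def hs_apply_scaleR power2_eq_square)
  also have "\<mu> j < \<dots>" using gt x0 by (simp add: field_simps)
  finally have y: "y \<in> V" "norm y \<le> 1" "\<mu> j < inner (hs_apply A y) y"
    using x x0 by (auto simp: V_def y_def)
  obtain s z where z: "\<mu> j < s" "z \<in> V" "z \<noteq> 0" "hs_apply A z = s *\<^sub>R z"
    by (rule positive_op_max_eigenvector[OF A V cV inv y(1,2) \<mu>0 y(3)])
  have "z \<in> span (e ` {i. 1 \<le> i \<and> \<mu> i = s})" using z \<mu>0 by (intro eD(4)) auto
  moreover have "i < j" if "1 \<le> i" "\<mu> i = s" for i
    using eD(1)[OF j, of i] that z(1) by (meson leD not_le_imp_less)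
  then have "orthogonal z u" if "u \<in> e ` {i. 1 \<le> i \<and> \<mu> i = s}" for u
    using that z(2) by (auto simp: V_def orthogonal_def)
  ultimately have "orthogonal z z" by (rule orthogonal_to_span)
  then show False using z by (simp add: orthogonal_def)
qed

section \<open>Perturbation of eigenvalues and eigenvectors\<close>

lemma inner_orthonormal_sums:
  assumes "finite I" "\<And>i j. i \<in> I \<Longrightarrow> j \<in> I \<Longrightarrow> inner (e i) (e j) = (if i = j then 1 else 0)"
  shows "inner (\<Sum>i\<in>I. a i *\<^sub>R e i) (\<Sum>i\<in>I. b i *\<^sub>R e i) = (\<Sum>i\<in>I. a i * b i)"
proof -
  have "inner (\<Sum>i\<in>I. a i *\<^sub>R e i) (\<Sum>i\<in>I. b i *\<^sub>R e i) =
      (\<Sum>i\<in>I. \<Sum>j\<in>I. if i = j then a i * b i else 0)"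
    unfolding inner_sum_left inner_sum_right using assms(2) by (intro sum.cong) auto
  then show ?thesis using assms(1) by simp
qed

text \<open>
  Fewer conditions than unknowns: the projection onto the span of \<open>f\<^sub>1, \<dots>, f\<^sub>j\<^sub>-\<^sub>1\<close> cannot be
  injective on the \<open>j\<close>-dimensional span of \<open>e\<^sub>1, \<dots>, e\<^sub>j\<close>.
\<close>

lemma exists_combination_orthogonal:
  fixes e f :: "nat \<Rightarrow> 'h::real_inner"
  assumes e: "\<And>i j. 1 \<le> i \<Longrightarrow> 1 \<le> j \<Longrightarrow> inner (e i) (e j) = (if i = j then 1 else 0)"
    and f: "\<And>i j. 1 \<le> i \<Longrightarrow> 1 \<le> j \<Longrightarrow> inner (f i) (f j) = (if i = j then 1 else 0)"
    and j: "1 \<le> j"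
  obtains c where "(\<Sum>i=1..j. c i *\<^sub>R e i) \<noteq> 0"
    "\<And>k. 1 \<le> k \<Longrightarrow> k < j \<Longrightarrow> inner (\<Sum>i=1..j. c i *\<^sub>R e i) (f k) = 0"
proof -
  define E where "E = e ` {1..j}"
  define T where "T x = (\<Sum>k\<in>{1..<j}. inner x (f k) *\<^sub>R f k)" for x
  have T: "linear T"
    by (rule linearI) (auto simp: T_def inner_add_left scaleR_add_left sum.distrib scaleR_sum_right)
  have inj: "inj_on e {1..j}"
  proof (rule inj_onI)
    fix i k assume "i \<in> {1..j}" "k \<in> {1..j}" "e i = e k"
    then show "i = k" using e[of i k] e[of k k] by (auto split: if_splits)
  qed
  have "0 \<notin> E" using e by (force simp: E_def)
  moreover have "pairwise orthogonal E" using e by (auto simp: E_def pairwise_def orthogonal_def)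
  ultimately have indE: "independent E" by (intro pairwise_orthogonal_independent)
  have "\<not> inj_on T (span E)"
  proof
    assume "inj_on T (span E)"
    then have "independent (T ` E)" by (intro linear_independent_injective_image T indE)
    moreover have "T ` E \<subseteq> span (f ` {1..<j})"
      unfolding T_def by (intro image_subsetI span_sum span_scale span_base) auto
    ultimately have "card (T ` E) \<le> card (f ` {1..<j})"
      by (intro independent_span_bound[THEN conjunct2]) auto
    moreover have "card (f ` {1..<j}) \<le> j - 1" using card_image_le[of "{1..<j}" f] by simp
    moreover have "card (T ` E) = j"
      using \<open>inj_on T (span E)\<close> inj span_superset[of E]
      by (subst card_image) (auto intro: inj_on_subset simp: E_def card_image)
    ultimately show False using j by simp
  qed
  then obtain x where x: "x \<in> span E" "T x = 0" "x \<noteq> 0"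
    using linear_injective_on_subspace_0[OF T subspace_span] by blast
  then obtain u where "x = (\<Sum>v\<in>E. u v *\<^sub>R v)" using span_finite[of E] by (auto simp: E_def)
  then have xc: "x = (\<Sum>i=1..j. (u \<circ> e) i *\<^sub>R e i)" by (simp only: E_def sum.reindex[OF inj] o_def)
  have "inner x (f k) = 0" if "1 \<le> k" "k < j" for k
  proof -
    have "0 = inner (T x) (f k)" by (simp add: x)
    also have "\<dots> = (\<Sum>i\<in>{1..<j}. if i = k then inner x (f i) else 0)"
      unfolding T_def inner_sum_left using f that by (intro sum.cong) auto
    also have "\<dots> = inner x (f k)" using that by simp
    finally show ?thesis by simp
  qed
  then show ?thesis using that[of "u \<circ> e"] x xc by simp
qed

text \<open>
  Weyl's inequality.  A unit vector in the span of \<open>e\<^sub>1, \<dots>, e\<^sub>j\<close> that is orthogonal to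
  \<open>f\<^sub>1, \<dots>, f\<^sub>j\<^sub>-\<^sub>1\<close> sees at least \<open>\<mu>\<^sub>j\<close> in the form of \<open>A\<close> and at most \<open>\<nu>\<^sub>j\<close> in that of \<open>B\<close>.
\<close>

lemma eigenvalue_le:
  fixes A B :: "'h::separable_hilbert_space hs_op"
  assumes A: "eigensystem A \<mu> e" and B: "positive_op B" "eigensystem B \<nu> f" and j: "1 \<le> j"
  shows "\<mu> j \<le> \<nu> j + norm (A - B)"
proof -
  note eA = eigensystemD[OF A] and eB = eigensystemD[OF B(2)]
  obtain c where c: "(\<Sum>i=1..j. c i *\<^sub>R e i) \<noteq> 0"
    "\<And>k. 1 \<le> k \<Longrightarrow> k < j \<Longrightarrow> inner (\<Sum>i=1..j. c i *\<^sub>R e i) (f k) = 0"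
    using exists_combination_orthogonal[OF eA(2) eB(2) j] by blast
  define x where "x = (\<Sum>i=1..j. c i *\<^sub>R e i)"
  have nx: "(norm x)\<^sup>2 = (\<Sum>i=1..j. c i * c i)"
    unfolding power2_norm_eq_inner x_def by (rule inner_orthonormal_sums) (auto simp: eA(2))
  have "hs_apply A x = (\<Sum>i=1..j. (c i * \<mu> i) *\<^sub>R e i)"
    unfolding x_def linear_sum[OF linear_hs_apply] using eA(3) by (intro sum.cong) (auto simp: hs_apply_scaleR)
  then have "inner (hs_apply A x) x = (\<Sum>i=1..j. (c i * \<mu> i) * c i)"
    unfolding x_def by (simp only:) (rule inner_orthonormal_sums, auto simp: eA(2))
  also have "\<dots> \<ge> (\<Sum>i=1..j. \<mu> j * (c i * c i))"
  proof (rule sum_mono)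
    fix i assume "i \<in> {1..j}"
    then have "\<mu> j * (c i * c i) \<le> \<mu> i * (c i * c i)" using eA(1) by (intro mult_right_mono) auto
    then show "\<mu> j * (c i * c i) \<le> c i * \<mu> i * c i" by (simp add: mult_ac)
  qed
  finally have "\<mu> j * (norm x)\<^sup>2 \<le> inner (hs_apply A x) x" by (simp add: nx sum_distrib_left)
  also have "\<dots> = inner (hs_apply B x) x + inner (hs_apply (A - B) x) x"
    by (simp add: minus_hs_op.rep_eq inner_diff_left)
  also have "\<dots> \<le> \<nu> j * (norm x)\<^sup>2 + norm (A - B) * (norm x)\<^sup>2"
    using c(2) by (intro add_mono rayleigh_le_eigenvalue[OF B j] inner_hs_apply_le) (auto simp: x_def)
  finally have "\<mu> j * (norm x)\<^sup>2 \<le> (\<nu> j + norm (A - B)) * (norm x)\<^sup>2" by (simp add: distrib_right)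
  then show ?thesis using c(1) by (simp add: x_def)
qed

lemma eigenvalue_perturbation:
  fixes A B :: "'h::separable_hilbert_space hs_op"
  assumes "positive_op A" "eigensystem A \<mu> e" "positive_op B" "eigensystem B \<nu> f" "1 \<le> j"
  shows "\<bar>\<mu> j - \<nu> j\<bar> \<le> norm (A - B)"
  using eigenvalue_le[of A \<mu> e B \<nu> f j] eigenvalue_le[of B \<nu> f A \<mu> e j] assms
  by (simp add: norm_minus_commute abs_le_iff)

text \<open>
  With \<open>u = f\<^sub>j\<close> and \<open>D = A - \<mu>\<^sub>j\<close>, the vector \<open>D u = (A - B) u + (\<nu>\<^sub>j - \<mu>\<^sub>j) u\<close> has norm at most
  \<open>2 \<parallel>A - B\<parallel>\<close>, and it only depends on the component \<open>w\<close> of \<open>u\<close> orthogonal to \<open>e\<^sub>j\<close>.  The form of \<open>D\<close> is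
  at least \<open>g\<close> on the span of the earlier eigenvectors and at most \<open>-g\<close> on the orthogonal complement of
  \<open>e\<^sub>1, \<dots>, e\<^sub>j\<close>.  Testing \<open>D w\<close> against the difference \<open>w1 - w2\<close> of the two corresponding components,
  which has the same norm as \<open>w\<close>, makes both contributions positive.  Finally the sign condition makes
  \<open>\<parallel>u - e\<^sub>j\<parallel>\<close> comparable to \<open>\<parallel>w\<parallel>\<close>.
\<close>

lemma eigenvector_perturbation:
  fixes A B :: "'h::separable_hilbert_space hs_op"
  assumes A: "positive_op A" "eigensystem A \<mu> e" and B: "positive_op B" "eigensystem B \<nu> f"
    and j: "1 \<le> j" and g: "0 < g"
    and above: "\<And>i. 1 \<le> i \<Longrightarrow> i < j \<Longrightarrow> g \<le> \<mu> i - \<mu> j" and below: "g \<le> \<mu> j - \<mu> (j + 1)"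
    and sign: "0 \<le> inner (f j) (e j)"
  shows "norm (f j - e j) \<le> 2 * sqrt 2 / g * norm (B - A)"
proof -
  note eA = eigensystemD[OF A(2)] and eB = eigensystemD[OF B(2)]
  define u where "u = f j"
  define t where "t = inner u (e j)"
  define w where "w = u - t *\<^sub>R e j"
  define w1 where "w1 = (\<Sum>i\<in>{1..<j}. inner u (e i) *\<^sub>R e i)"
  define w2 where "w2 = w - w1"
  define D where "D x = hs_apply A x - \<mu> j *\<^sub>R x" for x
  have D_diff: "D (x - y) = D x - D y" and D_add: "D (x + y) = D x + D y"
    and D_scale: "D (r *\<^sub>R x) = r *\<^sub>R D x" for x y r
    by (simp_all add: D_def hs_apply_diff hs_apply_add hs_apply_scaleR algebra_simps)
  have D_sym: "inner (D x) y = inner x (D y)" for x y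
    by (simp add: D_def inner_diff_left inner_diff_right positive_opD(1)[OF A(1)])
  have D_e: "D (e i) = (\<mu> i - \<mu> j) *\<^sub>R e i" if "1 \<le> i" for i
    using eA(3)[OF that] by (simp add: D_def scaleR_diff_left)
  have uu: "inner u u = 1" and ee: "inner (e j) (e j) = 1" using eA(2)[OF j j] eB(2)[OF j j] by (simp_all add: u_def)
  have w1e: "inner w1 (e i) = (if i < j then inner u (e i) else 0)" if "1 \<le> i" for i
  proof -
    have "inner w1 (e i) = (\<Sum>k\<in>{1..<j}. if k = i then inner u (e k) else 0)"
      unfolding w1_def inner_sum_left using eA(2) that by (intro sum.cong) auto
    then show ?thesis using that by auto
  qed
  have w2e: "inner w2 (e i) = 0" if "1 \<le> i" "i < j + 1" for i
    using that w1e[OF that(1)] eA(2)[OF j that(1)]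
    by (cases "i = j") (auto simp: w2_def w_def inner_diff_left t_def)
  have orth: "inner w1 w2 = 0"
    unfolding w1_def inner_sum_left
    by (intro sum.neutral ballI) (use w2e in \<open>auto simp: inner_commute[of "e _" w2]\<close>)
  have Dw1: "D w1 = (\<Sum>i\<in>{1..<j}. ((\<mu> i - \<mu> j) * inner u (e i)) *\<^sub>R e i)"
  proof -
    have "linear D" by (rule linearI) (auto simp: D_add D_scale)
    then show ?thesis unfolding w1_def using D_e
      by (simp add: linear_sum D_scale) (intro sum.cong, auto simp: mult.commute)
  qed
  have 1: "g * (norm w1)\<^sup>2 \<le> inner (D w1) w1"
  proof -
    have "g * (norm w1)\<^sup>2 = (\<Sum>i\<in>{1..<j}. g * (inner u (e i) * inner u (e i)))"
      unfolding power2_norm_eq_inner w1_def sum_distrib_left[symmetric]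
      by (subst inner_orthonormal_sums) (auto simp: eA(2))
    also have "\<dots> \<le> (\<Sum>i\<in>{1..<j}. (\<mu> i - \<mu> j) * (inner u (e i) * inner u (e i)))"
      using above by (intro sum_mono mult_right_mono) auto
    also have "\<dots> = inner (D w1) w1"
      unfolding Dw1 unfolding w1_def by (subst inner_orthonormal_sums) (auto simp: eA(2) mult_ac)
    finally show ?thesis .
  qed
  have "inner (hs_apply A w2) w2 \<le> \<mu> (j + 1) * (norm w2)\<^sup>2"
    using w2e by (intro rayleigh_le_eigenvalue[OF A]) auto
  moreover have "g * (norm w2)\<^sup>2 \<le> (\<mu> j - \<mu> (j + 1)) * (norm w2)\<^sup>2"
    using below by (rule mult_right_mono) simp
  ultimately have 2: "g * (norm w2)\<^sup>2 \<le> - inner (D w2) w2"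
    by (simp add: D_def inner_diff_left power2_norm_eq_inner algebra_simps)
  have w: "w = w1 + w2" by (simp add: w2_def)
  have nw: "(norm w)\<^sup>2 = (norm w1)\<^sup>2 + (norm w2)\<^sup>2" "(norm (w1 - w2))\<^sup>2 = (norm w1)\<^sup>2 + (norm w2)\<^sup>2"
    unfolding w power2_norm_eq_inner using orth
    by (simp_all add: inner_add_left inner_add_right inner_diff_left inner_diff_right inner_commute)
  then have nw': "norm (w1 - w2) = norm w" by (metis norm_ge_zero power2_eq_iff_nonneg)
  have "g * (norm w)\<^sup>2 \<le> inner (D w1) w1 - inner (D w2) w2"
    unfolding nw(1) using 1 2 by (simp add: distrib_left)
  also have "\<dots> = inner (D w) (w1 - w2)"
    using D_sym[of w1 w2] inner_commute[of w1 "D w2"]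
    by (simp add: w D_add inner_add_left inner_diff_right)
  also have "\<dots> \<le> norm (D w) * norm (w1 - w2)" by (rule norm_cauchy_schwarz)
  finally have *: "g * (norm w)\<^sup>2 \<le> norm (D w) * norm w" by (simp add: nw')
  have "g * norm w \<le> norm (D w)"
  proof (cases "w = 0")
    case False
    then show ?thesis using * by (simp add: power2_eq_square)
  qed (use * in \<open>simp add: D_def\<close>)
  also have "D w = D u" unfolding w_def D_diff D_scale by (simp add: D_e[OF j])
  also have "D u = (\<nu> j - \<mu> j) *\<^sub>R u - hs_apply (B - A) u"
    using eB(3)[OF j] by (simp add: D_def u_def minus_hs_op.rep_eq algebra_simps)
  also have "norm \<dots> \<le> \<bar>\<nu> j - \<mu> j\<bar> * norm u + norm (B - A) * norm u"
    by (rule order_trans[OF norm_triangle_ineq4]) (simp add: norm_hs_apply_le)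
  also have "\<dots> \<le> 2 * norm (B - A)"
    using eigenvalue_perturbation[OF B A j] uu by (simp add: norm_eq_sqrt_inner)
  finally have gw: "g * norm w \<le> 2 * norm (B - A)" .
  have t: "0 \<le> t" "t \<le> 1"
  proof -
    show "0 \<le> t" using sign by (simp add: t_def u_def)
    have "t \<le> norm u * norm (e j)" unfolding t_def by (rule norm_cauchy_schwarz)
    then show "t \<le> 1" using uu ee by (simp add: norm_eq_sqrt_inner)
  qed
  \<comment> \<open>For \<open>0 \<le> t \<le> 1\<close> the squared distance \<open>2 (1 - t)\<close> is at most twice \<open>\<parallel>w\<parallel>\<^sup>2 = (1 - t) (1 + t)\<close>.\<close>
  have "(norm (u - e j))\<^sup>2 = 2 - 2 * t"
    unfolding power2_norm_eq_inner using uu ee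
    by (simp add: inner_diff_left inner_diff_right inner_commute t_def)
  also have "\<dots> \<le> 2 * (1 - t\<^sup>2)"
    using t mult_left_mono[of t 1 t] by (simp add: power2_eq_square)
  also have "1 - t\<^sup>2 = (norm w)\<^sup>2"
    unfolding power2_norm_eq_inner w_def using uu ee
    by (simp add: inner_diff_left inner_diff_right inner_commute t_def[symmetric] power2_eq_square)
  also have "2 * (norm w)\<^sup>2 = (sqrt 2 * norm w)\<^sup>2" by (simp add: power_mult_distrib)
  finally have "norm (u - e j) \<le> sqrt 2 * norm w" by (rule power2_le_imp_le) simp
  also have "\<dots> \<le> sqrt 2 * (2 * norm (B - A) / g)"
    using gw g by (intro mult_left_mono) (auto simp: field_simps)
  finally show ?thesis by (simp add: u_def mult_ac)
qed

section \<open>Covariance operators of regularly varying elements\<close>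

lemma norm_tensor_self: "norm (x \<otimes> x) = (norm x)\<^sup>2"
proof (cases "x = 0")
  case True
  then show ?thesis using norm_tensor_le[of x x] by simp
next
  case False
  have "norm (hs_apply (x \<otimes> x) x) \<le> norm (x \<otimes> x) * norm x" by (rule norm_hs_apply_le)
  then have "(norm x)\<^sup>2 \<le> norm (x \<otimes> x)"
    using False by (simp add: tensor.rep_eq power2_norm_eq_inner[symmetric])
  then show ?thesis using norm_tensor_le[of x x] by (simp add: power2_eq_square)
qed

lemma borel_measurable_tensor_self [measurable]:
  "(\<lambda>x :: 'h::separable_hilbert_space. x \<otimes> x) \<in> borel_measurable borel"
  by (intro borel_measurable_continuous_onI bounded_bilinear.continuous_on[OF bounded_bilinear_tensor]
    continuous_on_id)

lemma positive_op_cov_op: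
  fixes X :: "'w \<Rightarrow> 'h::separable_hilbert_space"
  assumes int: "integrable M (\<lambda>\<omega>. X \<omega> \<otimes> X \<omega>)"
  shows "positive_op (cov_op M X)"
proof -
  have form: "inner (hs_apply (cov_op M X) x) y = (\<integral>\<omega>. inner (X \<omega>) x * inner (X \<omega>) y \<partial>M)" for x y
  proof -
    have "bounded_linear (\<lambda>A :: 'h hs_op. inner (hs_apply A x) y)"
    proof (rule bounded_linear_intro)
      fix A :: "'h hs_op"
      have "norm (inner (hs_apply A x) y) \<le> norm (hs_apply A x) * norm y"
        using Cauchy_Schwarz_ineq2[of "hs_apply A x" y] by simp
      also have "\<dots> \<le> norm A * norm x * norm y" by (intro mult_right_mono norm_hs_apply_le) simp
      finally show "norm (inner (hs_apply A x) y) \<le> norm A * (norm x * norm y)" by (simp add: mult.assoc)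
    qed (simp_all add: plus_hs_op.rep_eq scaleR_hs_op.rep_eq inner_add_left)
    from integral_bounded_linear[OF this int] show ?thesis
      by (simp add: cov_op_def tensor.rep_eq)
  qed
  show ?thesis
    unfolding positive_op_def
    by (auto simp: form inner_commute[of _ "hs_apply (cov_op M X) _"] mult.commute)
qed

lemma positive_op_sample_cov_op: "positive_op (sample_cov_op X N \<omega>)"
  unfolding positive_op_def sample_cov_op_def
  by (auto simp: scaleR_hs_op.rep_eq hs_apply_sum tensor.rep_eq inner_sum_left inner_sum_right
      inner_commute mult.commute intro!: sum.cong sum_nonneg divide_nonneg_nonneg)

text \<open>
  Squaring the norm halves the index: the tail at \<open>u\<close> is that of \<open>norm (X \<omega>)\<close> at \<open>sqrt u\<close>.
\<close>

lemma (in prob_space) regularly_varying_tail_norm_square: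
  assumes rv: "regularly_varying M X \<alpha>"
  shows "regularly_varying_tail (\<lambda>u. prob {\<omega> \<in> space M. u < (norm (X \<omega>))\<^sup>2}) (\<alpha> / 2)"
proof -
  define H where "H u = prob {\<omega> \<in> space M. u < (norm (X \<omega>))\<^sup>2}" for u
  have \<alpha>: "0 < \<alpha>" and X [measurable]: "X \<in> borel_measurable M"
    using rv by (auto simp: regularly_varying_def)
  obtain L where L: "slowly_varying L"
    "\<And>u. 0 < u \<Longrightarrow> prob {\<omega> \<in> space M. u < norm (X \<omega>)} = u powr (- \<alpha>) * L u"
    using rv by (auto simp: regularly_varying_def)
  have H: "H u = sqrt u powr - \<alpha> * L (sqrt u)" if "0 < u" for u
  proof -
    have "u < (norm (X \<omega>))\<^sup>2 \<longleftrightarrow> sqrt u < norm (X \<omega>)" for \<omega>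
      using that by (metis norm_ge_zero real_sqrt_less_iff real_sqrt_unique)
    then show ?thesis unfolding H_def using L(2)[of "sqrt u"] that by simp
  qed
  have anti: "H v \<le> H u" if "u \<le> v" for u v
    unfolding H_def using that by (intro finite_measure_mono) auto
  show ?thesis
    unfolding H_def[abs_def, symmetric]
  proof
    show "0 < \<alpha> / 2" using \<alpha> by simp
    show "H v \<le> H u" if "u \<le> v" for u v by (rule anti[OF that])
    show "0 < H u" for u
    proof -
      have "\<forall>\<^sub>F v in at_top. 0 < L (sqrt v)"
        using L(1) unfolding slowly_varying_def
        by (intro eventually_compose_filterlim[OF _ sqrt_at_top]) simp
      then have "\<forall>\<^sub>F v in at_top. 0 < H (v::real) \<and> u \<le> v"
        using eventually_gt_at_top[of 0] eventually_ge_at_top[of u]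
        by eventually_elim (simp add: H)
      then obtain v where "0 < H v" "u \<le> v"
        using eventually_happens[of _ "at_top :: real filter"] by fastforce
      then show ?thesis using anti[of u v] by simp
    qed
    show "(H \<longlongrightarrow> 0) at_top"
    proof -
      interpret Z: real_distribution "distr M borel (\<lambda>\<omega>. (norm (X \<omega>))\<^sup>2)"
        by (rule real_distribution_distr) simp
      have "H = (\<lambda>u. 1 - cdf (distr M borel (\<lambda>\<omega>. (norm (X \<omega>))\<^sup>2)) u)"
      proof
        fix u
        have "{\<omega> \<in> space M. u < (norm (X \<omega>))\<^sup>2} = space M - {\<omega> \<in> space M. (norm (X \<omega>))\<^sup>2 \<le> u}" by auto
        then have "H u = 1 - prob {\<omega> \<in> space M. (norm (X \<omega>))\<^sup>2 \<le> u}"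
          unfolding H_def by (simp add: prob_compl)
        then show "H u = 1 - cdf (distr M borel (\<lambda>\<omega>. (norm (X \<omega>))\<^sup>2)) u"
          by (simp add: cdf_def measure_distr vimage_def Int_def conj_commute)
      qed
      moreover have "((\<lambda>u. 1 - cdf (distr M borel (\<lambda>\<omega>. (norm (X \<omega>))\<^sup>2)) u) \<longlongrightarrow> 1 - 1) at_top"
        by (intro tendsto_diff tendsto_const Z.cdf_lim_at_top_prob)
      ultimately show ?thesis by simp
    qed
    fix c :: real assume c: "0 < c"
    have "((\<lambda>v. L (sqrt c * v) / L v) \<longlongrightarrow> 1) at_top"
      using L(1) c unfolding slowly_varying_def by simp
    from filterlim_compose[OF this sqrt_at_top]
    have "((\<lambda>u. sqrt c powr - \<alpha> * (L (sqrt c * sqrt u) / L (sqrt u))) \<longlongrightarrow> sqrt c powr - \<alpha> * 1) at_top"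
      by (intro tendsto_mult tendsto_const)
    moreover have "\<forall>\<^sub>F u in at_top. sqrt c powr - \<alpha> * (L (sqrt c * sqrt u) / L (sqrt u)) = H (c * u) / H u"
      using eventually_gt_at_top[of 0]
    proof eventually_elim
      case (elim u)
      then show ?case using c by (simp add: H real_sqrt_mult powr_mult)
    qed
    ultimately have "((\<lambda>u. H (c * u) / H u) \<longlongrightarrow> sqrt c powr - \<alpha> * 1) at_top"
      by (rule Lim_transform_eventually)
    also have "sqrt c powr - \<alpha> * 1 = c powr - (\<alpha> / 2)"
      using c by (simp add: powr_half_sqrt[symmetric] powr_powr)
    finally show "((\<lambda>u. H (c * u) / H u) \<longlongrightarrow> c powr - (\<alpha> / 2)) at_top" .
  qed
qed

text \<open>
  The comparison is made under the integral, pointwise, because the integrands built from the sample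
  eigenvalues may fail to be measurable.
\<close>

lemma limsup_mult_nn_integral_finite:
  fixes c :: "nat \<Rightarrow> real" and f g :: "nat \<Rightarrow> 'a \<Rightarrow> ennreal"
  assumes f: "\<forall>\<^sub>F N in sequentially. ennreal (c N) * (\<integral>\<^sup>+\<omega>. f N \<omega> \<partial>M) \<le> ennreal C"
    and meas: "\<And>N. f N \<in> borel_measurable M"
    and le: "\<And>N \<omega>. 1 \<le> N \<Longrightarrow> \<omega> \<in> space M \<Longrightarrow> g N \<omega> \<le> ennreal k * f N \<omega>"
  shows "limsup (\<lambda>N. ennreal (c N) * (\<integral>\<^sup>+\<omega>. g N \<omega> \<partial>M)) < \<infinity>"
proof -
  have "\<forall>\<^sub>F N in sequentially. ennreal (c N) * (\<integral>\<^sup>+\<omega>. g N \<omega> \<partial>M) \<le> ennreal k * ennreal C"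
    using f eventually_ge_at_top[of 1]
  proof eventually_elim
    case (elim N)
    have "(\<integral>\<^sup>+\<omega>. g N \<omega> \<partial>M) \<le> (\<integral>\<^sup>+\<omega>. ennreal k * f N \<omega> \<partial>M)"
      using le[OF elim(2)] by (rule nn_integral_mono)
    also have "\<dots> = ennreal k * (\<integral>\<^sup>+\<omega>. f N \<omega> \<partial>M)" by (rule nn_integral_cmult[OF meas])
    finally have "ennreal (c N) * (\<integral>\<^sup>+\<omega>. g N \<omega> \<partial>M) \<le> ennreal (c N) * (ennreal k * (\<integral>\<^sup>+\<omega>. f N \<omega> \<partial>M))"
      by (rule mult_left_mono) simp
    also have "\<dots> = ennreal k * (ennreal (c N) * (\<integral>\<^sup>+\<omega>. f N \<omega> \<partial>M))" by (rule mult.left_commute)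
    also have "\<dots> \<le> ennreal k * ennreal C" by (rule mult_left_mono[OF elim(1)]) simp
    finally show ?case .
  qed
  then have "limsup (\<lambda>N. ennreal (c N) * (\<integral>\<^sup>+\<omega>. g N \<omega> \<partial>M)) \<le> ennreal k * ennreal C"
    by (rule Limsup_bounded)
  also have "\<dots> < \<infinity>" by (simp add: ennreal_mult_less_top)
  finally show ?thesis .
qed

theorem theorem4p2:
  fixes M :: "'w measure"
    and X :: "nat \<Rightarrow> 'w \<Rightarrow> 't::compact_domain L2"
    and \<alpha> :: real
    and ev :: "nat \<Rightarrow> real"
    and v :: "nat \<Rightarrow> 't L2"
    and \<xi> :: "nat \<Rightarrow> 'w \<Rightarrow> real"
    and Q :: "nat \<Rightarrow> nat \<Rightarrow> real"
    and ev_hat :: "nat \<Rightarrow> nat \<Rightarrow> 'w \<Rightarrow> real"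
    and v_hat :: "nat \<Rightarrow> nat \<Rightarrow> 'w \<Rightarrow> 't L2"
  assumes prob: "prob_space M"
    and indep: "prob_space.indep_vars M (\<lambda>_. borel) X UNIV"
    and ident: "\<And>n. distr M borel (X n) = distr M borel (X 0)"
    and mean_zero: "integrable M (X 0)" "(\<integral>\<omega>. X 0 \<omega> \<partial>M) = 0"
    and rv: "regularly_varying M (X 0) \<alpha>"
    and \<alpha>: "2 < \<alpha>" "\<alpha> < 4"
    and eig: "eigensystem (cov_op M (X 0)) ev v"
    and \<xi>: "\<And>j \<omega>. \<xi> j \<omega> = inner (X 0 \<omega>) (v j)"
    and Q_lim: "\<And>n m. 1 \<le> n \<Longrightarrow> 1 \<le> m \<Longrightarrow>
      ((\<lambda>u. measure M {\<omega> \<in> space M.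
               sqrt (\<Sum>\<^sub>\<infinity>j\<in>{n..}. (\<xi> j \<omega>)\<^sup>2) * sqrt (\<Sum>\<^sub>\<infinity>j\<in>{m..}. (\<xi> j \<omega>)\<^sup>2) > u}
           / measure M {\<omega> \<in> space M. (\<Sum>\<^sub>\<infinity>j\<in>{1..}. (\<xi> j \<omega>)\<^sup>2) > u})
        \<longlongrightarrow> Q n m) at_top"
    and Q_pos: "\<And>n m. 1 \<le> n \<Longrightarrow> 1 \<le> m \<Longrightarrow> Q n m > 0"
    and eig_hat: "\<And>N \<omega>. 1 \<le> N \<Longrightarrow> \<omega> \<in> space M \<Longrightarrow>
      eigensystem (sample_cov_op X N \<omega>) (\<lambda>j. ev_hat N j \<omega>) (\<lambda>j. v_hat N j \<omega>)"
    and v_hat_measurable: "\<And>N j. 1 \<le> N \<Longrightarrow> 1 \<le> j \<Longrightarrow> v_hat N j \<in> borel_measurable M"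
    and sign: "\<And>N j \<omega>. 1 \<le> N \<Longrightarrow> 1 \<le> j \<Longrightarrow> \<omega> \<in> space M \<Longrightarrow>
      inner (v_hat N j \<omega>) (v j) \<noteq> 0 \<Longrightarrow> sgn (inner (v_hat N j \<omega>) (v j)) = 1"
  shows "\<forall>\<gamma>. 0 < \<gamma> \<and> \<gamma> < \<alpha> / 2 \<longrightarrow>
    (\<exists>L. slowly_varying L \<and>
      limsup (\<lambda>N. ennreal (real N powr (\<gamma> * (1 - 2 / \<alpha>)) * L (real N)) *
        (\<integral>\<^sup>+\<omega>. ennreal (norm (sample_cov_op X N \<omega> - cov_op M (X 0)) powr \<gamma>) \<partial>M)) < \<infinity> \<and>
      (\<forall>j\<ge>1. limsup (\<lambda>N. ennreal (real N powr (\<gamma> * (1 - 2 / \<alpha>)) * L (real N)) *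
        (\<integral>\<^sup>+\<omega>. ennreal (\<bar>ev_hat N j \<omega> - ev j\<bar> powr \<gamma>) \<partial>M)) < \<infinity>) \<and>
      (\<forall>p. (\<forall>i\<in>{1..p}. ev i > ev (i + 1)) \<longrightarrow>
        (\<forall>j\<in>{1..p}. limsup (\<lambda>N. ennreal (real N powr (\<gamma> * (1 - 2 / \<alpha>)) * L (real N)) *
          (\<integral>\<^sup>+\<omega>. ennreal (norm (v_hat N j \<omega> - v j) powr \<gamma>) \<partial>M)) < \<infinity>)))"
proof (intro allI impI)
  interpret prob_space M by (rule prob)
  fix \<gamma> :: real assume \<gamma>: "0 < \<gamma> \<and> \<gamma> < \<alpha> / 2"
  define Y where "Y n \<omega> = X n \<omega> \<otimes> X n \<omega>" for n \<omega>
  define C where "C = cov_op M (X 0)"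
  define d where "d N \<omega> = norm (sample_cov_op X N \<omega> - C)" for N \<omega>
  have X [measurable]: "X n \<in> borel_measurable M" for n
    using indep by (auto simp: indep_vars_def)
  have indY: "indep_vars (\<lambda>_. borel) Y UNIV"
    unfolding Y_def[abs_def] by (rule indep_vars_compose2[OF indep]) simp
  have identY: "distr M borel (Y n) = distr M borel (Y 0)" for n
  proof -
    have "distr M borel (Y n) = distr (distr M borel (X n)) borel (\<lambda>x. x \<otimes> x)" for n
      by (subst distr_distr) (simp_all add: Y_def[abs_def] o_def)
    then show ?thesis using ident[of n] by simp
  qed
  have normY: "norm (Y 0 \<omega>) = (norm (X 0 \<omega>))\<^sup>2" for \<omega> by (simp add: Y_def norm_tensor_self)
  have tailY: "regularly_varying_tail (\<lambda>u. prob {\<omega> \<in> space M. u < norm (Y 0 \<omega>)}) (\<alpha> / 2)"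
    unfolding normY by (rule regularly_varying_tail_norm_square[OF rv])
  obtain L K where L: "slowly_varying L" and
    rate: "\<forall>\<^sub>F N in sequentially. ennreal (real N powr (\<gamma> * (1 - 1 / (\<alpha> / 2))) * L (real N)) *
      (\<integral>\<^sup>+\<omega>. ennreal (norm ((1 / real N) *\<^sub>R (\<Sum>n=1..N. Y n \<omega>) - (\<integral>\<omega>. Y 0 \<omega> \<partial>M)) powr \<gamma>) \<partial>M) \<le> ennreal K"
    using mean_deviation_rate[OF indY identY tailY, of \<gamma>] \<alpha> \<gamma> by (simp, blast)
  have rate_d: "\<forall>\<^sub>F N in sequentially. ennreal (real N powr (\<gamma> * (1 - 2 / \<alpha>)) * L (real N)) *
      (\<integral>\<^sup>+\<omega>. ennreal (d N \<omega> powr \<gamma>) \<partial>M) \<le> ennreal K"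
    using rate by (simp add: d_def C_def cov_op_def sample_cov_op_def Y_def)
  have [measurable]: "d N \<in> borel_measurable M" for N
    unfolding d_def[abs_def] sample_cov_op_def by measurable
  have finite_limsup: "limsup (\<lambda>N. ennreal (real N powr (\<gamma> * (1 - 2 / \<alpha>)) * L (real N)) *
      (\<integral>\<^sup>+\<omega>. ennreal (h N \<omega> powr \<gamma>) \<partial>M)) < \<infinity>"
    if "\<And>N \<omega>. 1 \<le> N \<Longrightarrow> \<omega> \<in> space M \<Longrightarrow> 0 \<le> h N \<omega> \<and> h N \<omega> \<le> k * d N \<omega>" "0 \<le> k" for h k
  proof (rule limsup_mult_nn_integral_finite[OF rate_d])
    show "(\<lambda>\<omega>. ennreal (d N \<omega> powr \<gamma>)) \<in> borel_measurable M" for N by measurable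
    fix N \<omega> assume "1 \<le> (N::nat)" "\<omega> \<in> space M"
    then have "h N \<omega> powr \<gamma> \<le> (k * d N \<omega>) powr \<gamma>" using that \<gamma> by (intro powr_mono2) auto
    also have "\<dots> = k powr \<gamma> * d N \<omega> powr \<gamma>" using that by (simp add: powr_mult d_def)
    finally show "ennreal (h N \<omega> powr \<gamma>) \<le> ennreal (k powr \<gamma>) * ennreal (d N \<omega> powr \<gamma>)"
      by (simp add: ennreal_mult[symmetric] ennreal_leI)
  qed
  have intY: "integrable M (\<lambda>\<omega>. X 0 \<omega> \<otimes> X 0 \<omega>)"
  proof -
    interpret tail: regularly_varying_variable M "\<lambda>\<omega>. norm (Y 0 \<omega>)"
        "\<lambda>u. prob {\<omega> \<in> space M. u < norm (Y 0 \<omega>)}" "\<alpha> / 2"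
      using tailY unfolding regularly_varying_variable_def regularly_varying_variable_axioms_def
      by (auto simp: prob Y_def[abs_def])
    have "integrable M (\<lambda>\<omega>. norm (Y 0 \<omega>) powr 1)" using \<alpha> by (intro tail.integrable_powr) auto
    then show ?thesis by (simp add: Y_def[abs_def] integrable_norm_iff)
  qed
  have C: "positive_op C" "eigensystem C ev v"
    using positive_op_cov_op[OF intY] eig by (simp_all add: C_def)
  have ev: "\<bar>ev_hat N j \<omega> - ev j\<bar> \<le> 1 * d N \<omega>" if "1 \<le> j" "1 \<le> N" "\<omega> \<in> space M" for N j \<omega>
    using eigenvalue_perturbation[OF positive_op_sample_cov_op eig_hat[OF that(2,3)] C that(1)]
    by (simp add: d_def)
  have v: "\<exists>k\<ge>0. \<forall>N \<omega>. 1 \<le> N \<longrightarrow> \<omega> \<in> space M \<longrightarrow> norm (v_hat N j \<omega> - v j) \<le> k * d N \<omega>"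
    if gaps: "\<forall>i\<in>{1..p}. ev i > ev (i + 1)" and j: "j \<in> {1..p}" for p j
  proof -
    define g where "g = Min ((\<lambda>i. ev i - ev (i + 1)) ` {1..j})"
    have g_le: "g \<le> ev i - ev (i + 1)" if "i \<in> {1..j}" for i
      unfolding g_def using that by (intro Min_le) auto
    have g0: "0 < g" unfolding g_def using j gaps by (subst Min_gr_iff) auto
    have above: "g \<le> ev i - ev j" if "1 \<le> i" "i < j" for i
      using g_le[of i] eigensystemD(1)[OF eig, of "i + 1" j] that by auto
    have "norm (v_hat N j \<omega> - v j) \<le> 2 * sqrt 2 / g * d N \<omega>" if N: "1 \<le> N" "\<omega> \<in> space M" for N \<omega>
    proof -
      have "0 \<le> inner (v_hat N j \<omega>) (v j)"
        using sign[OF N(1) _ N(2), of j] j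
        by (cases "inner (v_hat N j \<omega>) (v j) = 0") (auto simp: sgn_1_pos less_imp_le)
      then show ?thesis
        unfolding d_def using above g_le[of j] j
        by (intro eigenvector_perturbation[OF C positive_op_sample_cov_op eig_hat[OF N] _ g0]) auto
    qed
    then show ?thesis using g0 by (intro exI[of _ "2 * sqrt 2 / g"]) auto
  qed
  show "\<exists>L. slowly_varying L \<and>
      limsup (\<lambda>N. ennreal (real N powr (\<gamma> * (1 - 2 / \<alpha>)) * L (real N)) *
        (\<integral>\<^sup>+\<omega>. ennreal (norm (sample_cov_op X N \<omega> - cov_op M (X 0)) powr \<gamma>) \<partial>M)) < \<infinity> \<and>
      (\<forall>j\<ge>1. limsup (\<lambda>N. ennreal (real N powr (\<gamma> * (1 - 2 / \<alpha>)) * L (real N)) *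
        (\<integral>\<^sup>+\<omega>. ennreal (\<bar>ev_hat N j \<omega> - ev j\<bar> powr \<gamma>) \<partial>M)) < \<infinity>) \<and>
      (\<forall>p. (\<forall>i\<in>{1..p}. ev i > ev (i + 1)) \<longrightarrow>
        (\<forall>j\<in>{1..p}. limsup (\<lambda>N. ennreal (real N powr (\<gamma> * (1 - 2 / \<alpha>)) * L (real N)) *
          (\<integral>\<^sup>+\<omega>. ennreal (norm (v_hat N j \<omega> - v j) powr \<gamma>) \<partial>M)) < \<infinity>))"
  proof (intro exI[of _ L] conjI L allI impI ballI)
    show "limsup (\<lambda>N. ennreal (real N powr (\<gamma> * (1 - 2 / \<alpha>)) * L (real N)) *
        (\<integral>\<^sup>+\<omega>. ennreal (norm (sample_cov_op X N \<omega> - cov_op M (X 0)) powr \<gamma>) \<partial>M)) < \<infinity>"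
      by (rule finite_limsup[of _ 1]) (auto simp: d_def C_def)
    show "limsup (\<lambda>N. ennreal (real N powr (\<gamma> * (1 - 2 / \<alpha>)) * L (real N)) *
        (\<integral>\<^sup>+\<omega>. ennreal (\<bar>ev_hat N j \<omega> - ev j\<bar> powr \<gamma>) \<partial>M)) < \<infinity>" if "1 \<le> j" for j
      by (rule finite_limsup[of _ 1]) (use ev[OF that] in auto)
    fix p j assume pj: "\<forall>i\<in>{1..p}. ev i > ev (i + 1)" "j \<in> {1..p}"
    obtain k where k: "0 \<le> k" "\<And>N \<omega>. 1 \<le> N \<Longrightarrow> \<omega> \<in> space M \<Longrightarrow> norm (v_hat N j \<omega> - v j) \<le> k * d N \<omega>"
      using v[OF pj] by blast
    show "limsup (\<lambda>N. ennreal (real N powr (\<gamma> * (1 - 2 / \<alpha>)) * L (real N)) *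
        (\<integral>\<^sup>+\<omega>. ennreal (norm (v_hat N j \<omega> - v j) powr \<gamma>) \<partial>M)) < \<infinity>"
      by (rule finite_limsup[of _ k]) (use k in auto)
  qed
qed

end
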